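(* Let $\Bbbk$ be a field, $A=\Bbbk[[x,y,z,u,v]]/(xz,xu,yu,yv,zv)$ and $J=\bigl\langle(xy)^2,(yz)^2,(zu)^2,(uv)^2,(vx)^2\bigr\rangle_A$. Let $M$ be a rank one object of $\mathsf{CM}^{\mathsf{lf}}(A)$. Then $M\cong M(\omega,\lambda)$, where $$M(\omega,\lambda):=\Bigl\langle J,\ v^{m_1+1}x+\lambda v^{m_2+1}u,\ x^{n_1+1}y+x^{n_2+1}v,\ y^{p_1+1}z+y^{p_2+1}x,\ z^{q_1+1}u+z^{q_2+1}y,\ u^{t_1+1}v+u^{t_2+1}z\Bigr\rangle_A^{\vee\vee}$$ (the bidual of an ideal of $A$), for some $\omega=\bigl((m_1,m_2),(n_1,n_2),(p_1,p_2),(q_1,q_2),(t_1,t_2)\bigr)\in\mathbb Z^{10}$ and $\lambda\in\Bbbk^*$ with $$\min(m_1,m_2)=\min(n_1,n_2)=\min(p_1,p_2)=\min(q_1,q_2)=\min(t_1,t_2)=1.$$ Moreover, $M(\omega,\lambda)\cong M(\omega',\lambda')$ if and only if $\omega=\omega'$ and $\lambda=\lambda'$.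
   Context: $\mathsf{CM}^{\mathsf{lf}}(A)$ is the category of maximal Cohen--Macaulay $A$-modules $M$ such that $M_{\mathfrak p}$ is free over $A_{\mathfrak p}$ for every non-maximal prime ideal $\mathfrak p$; rank one means all these localizations are free of rank one. Since $A$ is Gorenstein, $N^\vee=\mathrm{Hom}_A(N,A)$. *)

theory Defs
  imports "HOL-Algebra.Algebra" "HOL-Algebra.Algebraic_Closure_Type" "HOL-Library.Extended_Nat"
begin

section \<open>Modules over a commutative ring\<close>

definition module_hom ::
  "('r, 'x) ring_scheme \<Rightarrow> ('r, 'm, 'y) module_scheme \<Rightarrow> ('r, 'n, 'z) module_scheme \<Rightarrow> ('m \<Rightarrow> 'n) set"
  where "module_hom R M N = {f \<in> carrier M \<rightarrow> carrier N.
    (\<forall>a\<in>carrier M. \<forall>b\<in>carrier M. f (a \<oplus>\<^bsub>M\<^esub> b) = f a \<oplus>\<^bsub>N\<^esub> f b) \<and>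
    (\<forall>r\<in>carrier R. \<forall>a\<in>carrier M. f (r \<odot>\<^bsub>M\<^esub> a) = r \<odot>\<^bsub>N\<^esub> f a)}"

definition module_iso ::
  "('r, 'x) ring_scheme \<Rightarrow> ('r, 'm, 'y) module_scheme \<Rightarrow> ('r, 'n, 'z) module_scheme \<Rightarrow> bool"
  where "module_iso R M N \<longleftrightarrow> (\<exists>f\<in>module_hom R M N. bij_betw f (carrier M) (carrier N))"

text \<open>The type of modules extends the type of rings, so that every module carries a
  multiplication and a unit; no definition below refers to these two fields.\<close>

definition regular_module :: "('r, 'x) ring_scheme \<Rightarrow> ('r, 'r) module"
  where "regular_module R =
    \<lparr>carrier = carrier R, monoid.mult = monoid.mult R, one = \<one>\<^bsub>R\<^esub>, ring.zero = \<zero>\<^bsub>R\<^esub>, add = add R,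
     module.smult = monoid.mult R\<rparr>"

abbreviation ideal_module :: "('r, 'x) ring_scheme \<Rightarrow> 'r set \<Rightarrow> ('r, 'r) module"
  where "ideal_module R I \<equiv> (regular_module R)\<lparr>carrier := I\<rparr>"

text \<open>\<open>Hom\<^sub>R(M, R)\<close>; homomorphisms are made extensional, so that equal maps are equal as
  HOL functions.\<close>

definition dual_module :: "('r, 'x) ring_scheme \<Rightarrow> ('r, 'm, 'y) module_scheme \<Rightarrow> ('r, 'm \<Rightarrow> 'r) module"
  where "dual_module R M =
    \<lparr>carrier = module_hom R M (regular_module R) \<inter> extensional (carrier M),
     monoid.mult = undefined, one = undefined,
     ring.zero = (\<lambda>a\<in>carrier M. \<zero>\<^bsub>R\<^esub>),
     add = (\<lambda>f g. \<lambda>a\<in>carrier M. f a \<oplus>\<^bsub>R\<^esub> g a),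
     module.smult = (\<lambda>r f. \<lambda>a\<in>carrier M. r \<otimes>\<^bsub>R\<^esub> f a)\<rparr>"

definition module_span :: "('r, 'x) ring_scheme \<Rightarrow> ('r, 'm, 'y) module_scheme \<Rightarrow> 'm set \<Rightarrow> 'm set"
  where "module_span R M S = \<Inter>{N. submodule N R M \<and> S \<subseteq> N}"

definition finitely_generated_module :: "('r, 'x) ring_scheme \<Rightarrow> ('r, 'm, 'y) module_scheme \<Rightarrow> bool"
  where "finitely_generated_module R M \<longleftrightarrow>
    (\<exists>S. finite S \<and> S \<subseteq> carrier M \<and> module_span R M S = carrier M)"

definition module_basis :: "('r, 'x) ring_scheme \<Rightarrow> ('r, 'm, 'y) module_scheme \<Rightarrow> 'm set \<Rightarrow> bool"
  where "module_basis R M B \<longleftrightarrow> B \<subseteq> carrier M \<and> module_span R M B = carrier M \<and>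
    (\<forall>F c. finite F \<longrightarrow> F \<subseteq> B \<longrightarrow> c \<in> F \<rightarrow> carrier R \<longrightarrow>
       (\<Oplus>\<^bsub>M\<^esub> b\<in>F. c b \<odot>\<^bsub>M\<^esub> b) = \<zero>\<^bsub>M\<^esub> \<longrightarrow> (\<forall>b\<in>F. c b = \<zero>\<^bsub>R\<^esub>))"

definition free_module :: "('r, 'x) ring_scheme \<Rightarrow> ('r, 'm, 'y) module_scheme \<Rightarrow> bool"
  where "free_module R M \<longleftrightarrow> (\<exists>B. module_basis R M B)"

definition free_module_of_rank :: "nat \<Rightarrow> ('r, 'x) ring_scheme \<Rightarrow> ('r, 'm, 'y) module_scheme \<Rightarrow> bool"
  where "free_module_of_rank n R M \<longleftrightarrow> (\<exists>B. module_basis R M B \<and> finite B \<and> card B = n)"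


section \<open>Localization at a prime ideal\<close>

definition loc_rel ::
  "('r, 'x) ring_scheme \<Rightarrow> 'r set \<Rightarrow> ('r, 'm, 'y) module_scheme \<Rightarrow> (('m \<times> 'r) \<times> ('m \<times> 'r)) set"
  where "loc_rel R P M = {((a, s), (b, t)).
    a \<in> carrier M \<and> b \<in> carrier M \<and> s \<in> carrier R - P \<and> t \<in> carrier R - P \<and>
    (\<exists>w\<in>carrier R - P. w \<odot>\<^bsub>M\<^esub> (t \<odot>\<^bsub>M\<^esub> a) = w \<odot>\<^bsub>M\<^esub> (s \<odot>\<^bsub>M\<^esub> b))}"

text \<open>The fraction \<open>a/s\<close>. Operations on fractions take the union of the resulting fractions over
  all representatives, all of which coincide when \<open>P\<close> is prime.\<close>

definition loc_frac ::
  "('r, 'x) ring_scheme \<Rightarrow> 'r set \<Rightarrow> ('r, 'm, 'y) module_scheme \<Rightarrow> 'm \<Rightarrow> 'r \<Rightarrow> ('m \<times> 'r) set"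
  where "loc_frac R P M a s = loc_rel R P M `` {(a, s)}"

definition loc_carrier ::
  "('r, 'x) ring_scheme \<Rightarrow> 'r set \<Rightarrow> ('r, 'm, 'y) module_scheme \<Rightarrow> ('m \<times> 'r) set set"
  where "loc_carrier R P M = (carrier M \<times> (carrier R - P)) // loc_rel R P M"

definition loc_add ::
  "('r, 'x) ring_scheme \<Rightarrow> 'r set \<Rightarrow> ('r, 'm, 'y) module_scheme \<Rightarrow>
   ('m \<times> 'r) set \<Rightarrow> ('m \<times> 'r) set \<Rightarrow> ('m \<times> 'r) set"
  where "loc_add R P M C D =
    (\<Union>(a, s)\<in>C. \<Union>(b, t)\<in>D. loc_frac R P M (t \<odot>\<^bsub>M\<^esub> a \<oplus>\<^bsub>M\<^esub> s \<odot>\<^bsub>M\<^esub> b) (s \<otimes>\<^bsub>R\<^esub> t))"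

definition loc_smult ::
  "('r, 'x) ring_scheme \<Rightarrow> 'r set \<Rightarrow> ('r, 'm, 'y) module_scheme \<Rightarrow>
   ('r \<times> 'r) set \<Rightarrow> ('m \<times> 'r) set \<Rightarrow> ('m \<times> 'r) set"
  where "loc_smult R P M C D =
    (\<Union>(r, s)\<in>C. \<Union>(b, t)\<in>D. loc_frac R P M (r \<odot>\<^bsub>M\<^esub> b) (s \<otimes>\<^bsub>R\<^esub> t))"

definition loc_ring :: "('r, 'x) ring_scheme \<Rightarrow> 'r set \<Rightarrow> ('r \<times> 'r) set ring"
  where "loc_ring R P =
    \<lparr>carrier = loc_carrier R P (regular_module R),
     monoid.mult = loc_smult R P (regular_module R),
     one = loc_frac R P (regular_module R) \<one>\<^bsub>R\<^esub> \<one>\<^bsub>R\<^esub>,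
     ring.zero = loc_frac R P (regular_module R) \<zero>\<^bsub>R\<^esub> \<one>\<^bsub>R\<^esub>,
     add = loc_add R P (regular_module R)\<rparr>"

definition loc_module ::
  "('r, 'x) ring_scheme \<Rightarrow> 'r set \<Rightarrow> ('r, 'm, 'y) module_scheme \<Rightarrow>
   (('r \<times> 'r) set, ('m \<times> 'r) set) module"
  where "loc_module R P M =
    \<lparr>carrier = loc_carrier R P M,
     monoid.mult = undefined, one = undefined,
     ring.zero = loc_frac R P M \<zero>\<^bsub>M\<^esub> \<one>\<^bsub>R\<^esub>,
     add = loc_add R P M,
     module.smult = loc_smult R P M\<rparr>"


section \<open>Maximal Cohen--Macaulay modules\<close>

definition krull_dim :: "('r, 'x) ring_scheme \<Rightarrow> enat"
  where "krull_dim R = Sup {enat n | n. \<exists>P :: nat \<Rightarrow> 'r set.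
    (\<forall>i\<le>n. primeideal (P i) R) \<and> (\<forall>i<n. P i \<subset> P (Suc i))}"

text \<open>The submodule \<open>(r\<^sub>1, \<dots>, r\<^sub>n) M\<close> of \<open>M\<close>\<close>

definition list_mult_module ::
  "('r, 'x) ring_scheme \<Rightarrow> ('r, 'm, 'y) module_scheme \<Rightarrow> 'r list \<Rightarrow> 'm set"
  where "list_mult_module R M rs = module_span R M {r \<odot>\<^bsub>M\<^esub> a | r a. r \<in> set rs \<and> a \<in> carrier M}"

text \<open>Every \<open>r\<^sub>i\<close> is a nonzerodivisor on \<open>M / (r\<^sub>1, \<dots>, r\<^bsub>i-1\<^esub>) M\<close>, and
  \<open>M / (r\<^sub>1, \<dots>, r\<^sub>n) M\<close> is not zero.\<close>

definition regular_sequence ::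
  "('r, 'x) ring_scheme \<Rightarrow> ('r, 'm, 'y) module_scheme \<Rightarrow> 'r list \<Rightarrow> bool"
  where "regular_sequence R M rs \<longleftrightarrow> set rs \<subseteq> carrier R \<and>
    (\<forall>i<length rs. \<forall>a\<in>carrier M.
       rs ! i \<odot>\<^bsub>M\<^esub> a \<in> list_mult_module R M (take i rs) \<longrightarrow> a \<in> list_mult_module R M (take i rs)) \<and>
    list_mult_module R M rs \<noteq> carrier M"

text \<open>Depth over a local ring: its maximal ideal is the set of nonunits.\<close>

definition module_depth :: "('r, 'x) ring_scheme \<Rightarrow> ('r, 'm, 'y) module_scheme \<Rightarrow> enat"
  where "module_depth R M =
    Sup {enat (length rs) | rs. set rs \<subseteq> carrier R - Units R \<and> regular_sequence R M rs}"

text \<open>For modules over a Noetherian local ring. The zero module is maximal Cohen--Macaulay by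
  convention.\<close>

definition maximal_cohen_macaulay :: "('r, 'x) ring_scheme \<Rightarrow> ('r, 'm, 'y) module_scheme \<Rightarrow> bool"
  where "maximal_cohen_macaulay R M \<longleftrightarrow> Module.module R M \<and> finitely_generated_module R M \<and>
    (carrier M = {\<zero>\<^bsub>M\<^esub>} \<or> module_depth R M = krull_dim R)"

definition cm_lf :: "('r, 'x) ring_scheme \<Rightarrow> ('r, 'm, 'y) module_scheme \<Rightarrow> bool"
  where "cm_lf R M \<longleftrightarrow> maximal_cohen_macaulay R M \<and>
    (\<forall>P. primeideal P R \<and> \<not> maximalideal P R \<longrightarrow> free_module (loc_ring R P) (loc_module R P M))"

definition rank_one_cm_lf :: "('r, 'x) ring_scheme \<Rightarrow> ('r, 'm, 'y) module_scheme \<Rightarrow> bool"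
  where "rank_one_cm_lf R M \<longleftrightarrow> cm_lf R M \<and>
    (\<forall>P. primeideal P R \<and> \<not> maximalideal P R \<longrightarrow>
       free_module_of_rank 1 (loc_ring R P) (loc_module R P M))"


section \<open>The ring \<open>k[[x,y,z,u,v]]/(xz,xu,yu,yv,zv)\<close>\<close>

text \<open>\<open>k[[x,y,z,u,v]]\<close> is \<open>k[[x]][[y]][[z]][[u]][[v]]\<close>, the variable \<open>x\<close> being the innermost one.\<close>

type_synonym 'k pow5 = "'k fps fps fps fps fps"

definition const5 :: "'k::field \<Rightarrow> 'k pow5"
  where "const5 c = fps_const (fps_const (fps_const (fps_const (fps_const c))))"

definition varx :: "'k::field pow5"
  where "varx = fps_const (fps_const (fps_const (fps_const fps_X)))"

definition vary :: "'k::field pow5"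
  where "vary = fps_const (fps_const (fps_const fps_X))"

definition varz :: "'k::field pow5"
  where "varz = fps_const (fps_const fps_X)"

definition varu :: "'k::field pow5"
  where "varu = fps_const fps_X"

definition varv :: "'k::field pow5"
  where "varv = fps_X"

definition pow5_ring :: "'k::field pow5 ring"
  where "pow5_ring = ring_of_type_algebra"

definition cusp_rel :: "'k::field pow5 set"
  where "cusp_rel =
    Idl\<^bsub>pow5_ring\<^esub> {varx * varz, varx * varu, vary * varu, vary * varv, varz * varv}"

definition cusp_ring :: "'k::field pow5 set ring"
  where "cusp_ring = pow5_ring Quot cusp_rel"

definition residue :: "'k::field pow5 \<Rightarrow> 'k pow5 set"
  where "residue f = cusp_rel +>\<^bsub>pow5_ring\<^esub> f"

definition cusp_J :: "'k::field pow5 set set"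
  where "cusp_J = Idl\<^bsub>cusp_ring\<^esub> (residue `
    {(varx * vary)\<^sup>2, (vary * varz)\<^sup>2, (varz * varu)\<^sup>2, (varu * varv)\<^sup>2, (varv * varx)\<^sup>2})"

type_synonym weight = "(int \<times> int) \<times> (int \<times> int) \<times> (int \<times> int) \<times> (int \<times> int) \<times> (int \<times> int)"

definition normalized_weight :: "weight \<Rightarrow> bool"
  where "normalized_weight = (\<lambda>((m1, m2), (n1, n2), (p1, p2), (q1, q2), (t1, t2)).
    min m1 m2 = 1 \<and> min n1 n2 = 1 \<and> min p1 p2 = 1 \<and> min q1 q2 = 1 \<and> min t1 t2 = 1)"

text \<open>Exponents are truncated at \<open>0\<close>, which does not happen for
  normalized weights.\<close>

definition cusp_ideal :: "weight \<Rightarrow> 'k::field \<Rightarrow> 'k pow5 set set"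
  where "cusp_ideal = (\<lambda>((m1, m2), (n1, n2), (p1, p2), (q1, q2), (t1, t2)) c.
    Idl\<^bsub>cusp_ring\<^esub> (cusp_J \<union> residue `
     {varv ^ nat (m1 + 1) * varx + const5 c * varv ^ nat (m2 + 1) * varu,
      varx ^ nat (n1 + 1) * vary + varx ^ nat (n2 + 1) * varv,
      vary ^ nat (p1 + 1) * varz + vary ^ nat (p2 + 1) * varx,
      varz ^ nat (q1 + 1) * varu + varz ^ nat (q2 + 1) * vary,
      varu ^ nat (t1 + 1) * varv + varu ^ nat (t2 + 1) * varz}))"

definition cusp_module ::
  "weight \<Rightarrow> 'k::field \<Rightarrow> ('k pow5 set, ('k pow5 set \<Rightarrow> 'k pow5 set) \<Rightarrow> 'k pow5 set) module"
  where "cusp_module w c =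
    dual_module cusp_ring (dual_module cusp_ring (ideal_module cusp_ring (cusp_ideal w c)))"

end

theory Submission
  imports Defs "HOL-Library.Function_Algebras"
begin

text \<open>The ring \<open>A\<close> is the fibre product of five regular planes \<open>B\<^sub>i\<close>, glued cyclically along axes.
  A rank one module that is free on the punctured spectrum is a line bundle there: it is trivial on
  each punctured plane, so it is given by transition functions \<open>a\<^sub>i / b\<^sub>i\<close> in \<open>k((x\<^sub>i))\<^sup>*\<close> on the five
  punctured axes. Units of the planes remove everything from the transition functions except their
  orders, which are the differences \<open>n\<^sub>1 - n\<^sub>2\<close>, and the product \<open>\<lambda>\<close> of their leading coefficients.
  Depth two means that the module consists of all sections of the bundle.

  Concretely, \<open>M\<close> is embedded in the product of the planes by trivializing it at the five minimal
  primes. Depth two makes the image saturated: \<open>w\<close> belongs to it as soon as all \<open>x\<^sub>i w\<close> do. A saturated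
  ideal of \<open>k[[s, t]]\<close> is principal, so after rescaling the components the image contains \<open>x\<^sub>i x\<^bsub>i+1\<^esub>\<close>
  in each plane, and freeness at the primes of the axes yields the transition functions. On the other
  side, every homomorphism between two such modules of sections, even one defined only on a
  sublattice such as the ideal in the definition of \<open>M(\<omega>, \<lambda>)\<close>, is multiplication by an element of
  the product of the planes. Hence dualizing inverts the transition functions, the bidual of the ideal
  has transition functions \<open>x\<^sub>i\<^bsup>n1\<^esup> / x\<^sub>i\<^bsup>n2\<^esup>\<close>, up to \<open>\<lambda>\<close> on the \<open>v\<close>-axis, and isomorphic modules
  have the same invariants.\<close>

section \<open>Power series in one and two variables\<close>

text \<open>Laurent series are avoided: a transition function is kept as a pair of power series and
  the gluing condition is cross-multiplied, so dualizing exchanges the two members. In the normal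
  form both vanish at the origin, which is what min = 1 provides besides fixing the common shift of
  the two exponents. The pair on one axis then extends by zero across the neighbouring axes and
  becomes a section supported on two planes. The other basic sections are the products of the two
  coordinates of one plane. Multiplied by the nonzerodivisor xy + yz + zu + uv + vx, these two kinds
  of sections become the generators of the ideal; this explains the squares in J and the exponents
  increased by one. The scalar \<lambda> survives because the planes form a cycle: a unit has the
  same constant coefficient on both axes of its plane, so rescaling the planes changes the five
  leading coefficients by quotients of consecutive constants, with product 1. Higher coefficients
  disappear, since a unit can be prescribed on both axes subject only to agreement at the
  origin.\<close>

definition fps_map :: "('a \<Rightarrow> 'b) \<Rightarrow> 'a fps \<Rightarrow> 'b fps"
  where "fps_map h F = Abs_fps (\<lambda>n. h (F $ n))"

lemma fps_map_nth [simp]: "fps_map h F $ n = h (F $ n)"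
  by (simp add: fps_map_def)

lemma fps_map_add:
  assumes "\<And>a b. h (a + b) = h a + h b"
  shows "fps_map h (F + G) = fps_map h F + fps_map h G"
  by (rule fps_ext) (simp add: assms)

lemma fps_map_mult:
  fixes h :: "'a :: comm_ring_1 \<Rightarrow> 'b :: comm_ring_1"
  assumes "\<And>a b. h (a + b) = h a + h b" and "\<And>a b. h (a * b) = h a * h b"
  shows "fps_map h (F * G) = fps_map h F * fps_map h G"
proof -
  have "h 0 = 0"
    using assms(1)[of 0 0] by simp
  then have "h (sum f A) = (\<Sum>x\<in>A. h (f x))" for f and A :: "nat set"
    by (induction A rule: infinite_finite_induct) (simp_all add: assms)
  then show ?thesis
    by (intro fps_ext) (simp add: fps_mult_nth assms)
qed

lemma fps_map_1:
  assumes "h 0 = 0" "h 1 = 1"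
  shows "fps_map h 1 = 1"
  by (rule fps_ext) (simp add: assms)

definition fps_flip :: "'a fps fps \<Rightarrow> 'a fps fps"
  where "fps_flip F = Abs_fps (\<lambda>n. Abs_fps (\<lambda>m. F $ m $ n))"

lemma fps_flip_nth [simp]: "fps_flip F $ n $ m = F $ m $ n"
  by (simp add: fps_flip_def)

lemma fps2_eq_iff: "F = G \<longleftrightarrow> (\<forall>m n. F $ m $ n = G $ m $ n)"
  by (simp add: fps_eq_iff)

lemma fps_flip_add: "fps_flip (F + G) = fps_flip F + fps_flip G"
  by (simp add: fps2_eq_iff)

lemma fps_flip_mult: "fps_flip (F * G) = fps_flip F * fps_flip (G :: 'a :: comm_ring_1 fps fps)"
  unfolding fps2_eq_iff fps_flip_nth
  by (simp add: fps_mult_nth fps_sum_nth, subst sum.swap, simp)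

lemma fps_flip_1: "fps_flip (1 :: 'a :: comm_ring_1 fps fps) = 1"
  by (simp add: fps2_eq_iff)

text \<open>The recursion for the inverse series starts from an inverse of the constant coefficient.
  Coefficients in a commutative ring allow iterated use on nested power series.\<close>

lemma fps_dvd_1I:
  fixes f :: "'a :: comm_ring_1 fps"
  assumes "f $ 0 dvd 1"
  shows "f dvd 1"
proof -
  obtain y where "1 = f $ 0 * y"
    using assms by auto
  then have "fps_left_inverse f y * f = 1"
    by (intro fps_left_inverse) (simp add: mult.commute)
  then show ?thesis
    by (metis dvd_triv_right)
qed

text \<open>A series in \<open>'k fps fps\<close> is regarded as an element of \<open>k[[s, t]]\<close>, where \<open>s\<close> is the
  variable of the coefficients.\<close>

definition set_t0 :: "'a::zero fps fps \<Rightarrow> 'a fps"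
  where "set_t0 F = F $ 0"

definition set_s0 :: "'a::zero fps fps \<Rightarrow> 'a fps"
  where "set_s0 F = fps_map (\<lambda>h. h $ 0) F"

definition var_s :: "'a::field fps fps"
  where "var_s = fps_const fps_X"

definition var_t :: "'a::field fps fps"
  where "var_t = fps_X"

lemma set_s0_nth [simp]: "set_s0 F $ n = F $ n $ 0"
  by (simp add: set_s0_def)

lemma set_t0_nth [simp]: "set_t0 F $ n = F $ 0 $ n"
  by (simp add: set_t0_def)

lemma set_t0_simps [simp]:
  "set_t0 (F + G) = set_t0 F + set_t0 (G :: 'a::field fps fps)"
  "set_t0 (F * G) = set_t0 F * set_t0 G"
  "set_t0 (F ^ n) = set_t0 F ^ n"
  "set_t0 (0 :: 'a fps fps) = 0" "set_t0 (1 :: 'a fps fps) = 1"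
  "set_t0 (var_s :: 'a fps fps) = fps_X" "set_t0 (var_t :: 'a fps fps) = 0"
  by (simp_all add: set_t0_def var_s_def var_t_def fps_nth_power_0)

lemma set_s0_add [simp]: "set_s0 (F + G) = set_s0 F + set_s0 (G :: 'a::field fps fps)"
  by (rule fps_ext) simp

lemma set_s0_mult [simp]: "set_s0 (F * G) = set_s0 F * set_s0 (G :: 'a::field fps fps)"
  unfolding set_s0_def by (rule fps_map_mult) simp_all

lemma set_s0_simps [simp]:
  "set_s0 (0 :: 'a::field fps fps) = 0" "set_s0 (1 :: 'a::field fps fps) = 1"
  "set_s0 (var_s :: 'a fps fps) = 0" "set_s0 (var_t :: 'a fps fps) = fps_X"
  by (simp_all add: fps_eq_iff var_s_def var_t_def)

lemma set_s0_power [simp]: "set_s0 (F ^ n) = set_s0 (F :: 'a::field fps fps) ^ n"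
  by (induction n) simp_all

lemma set_minus [simp]:
  "set_t0 (- F) = - set_t0 F" "set_s0 (- F) = - set_s0 F"
  "set_t0 (F - G) = set_t0 F - set_t0 G" "set_s0 (F - G) = set_s0 F - set_s0 (G :: 'a::field fps fps)"
  by (simp_all add: fps_eq_iff)

lemma var_nonzero [simp]: "(var_s :: 'a::field fps fps) \<noteq> 0" "(var_t :: 'a::field fps fps) \<noteq> 0"
  by (simp_all add: var_s_def var_t_def)

lemma var_t_dvd_iff: "var_t dvd F \<longleftrightarrow> set_t0 F = (0 :: 'a::field fps)"
proof
  assume *: "set_t0 F = 0"
  have "F = var_t * Abs_fps (\<lambda>n. F $ Suc n)"
    using * by (auto simp: fps_eq_iff var_t_def set_t0_def)
  then show "var_t dvd F" by (rule dvdI)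
qed (auto elim!: dvdE)

lemma var_s_dvd_iff: "var_s dvd F \<longleftrightarrow> set_s0 F = (0 :: 'a::field fps)"
proof
  assume *: "set_s0 F = 0"
  have "F = var_s * Abs_fps (\<lambda>m. Abs_fps (\<lambda>n. F $ m $ Suc n))"
    using * by (auto simp: fps_eq_iff var_s_def)
  then show "var_s dvd F" by (rule dvdI)
qed (auto elim!: dvdE)

text \<open>\<open>var_s\<close> restricts to a nonzerodivisor on the axis \<open>t = 0\<close>, so
  the quotient by it still vanishes there.\<close>

lemma var_s_var_t_dvd:
  assumes "set_s0 F = (0 :: 'a::field fps)" "set_t0 F = 0"
  shows "var_s * var_t dvd F"
proof -
  obtain G where G: "F = var_s * G"
    using assms(1) by (auto simp: var_s_dvd_iff[symmetric])
  then have "set_t0 G = 0"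
    using assms(2) by simp
  then show ?thesis
    unfolding G by (intro mult_dvd_mono) (simp_all add: var_t_dvd_iff)
qed

section \<open>The ring as a fibre product of five planes\<close>

text \<open>The irreducible components of the spectrum, that is, the planes with coordinates
  \<open>(s, t) = (v, x), (x, y), (y, z), (z, u), (u, v)\<close>.
  Consecutive planes meet in the axis \<open>s = 0\<close> of the first and \<open>t = 0\<close> of the second.\<close>

datatype comp = PV | PX | PY | PZ | PU

fun next_comp :: "comp \<Rightarrow> comp"
  where "next_comp PV = PX" | "next_comp PX = PY" | "next_comp PY = PZ" | "next_comp PZ = PU"
  | "next_comp PU = PV"

fun prev_comp :: "comp \<Rightarrow> comp"
  where "prev_comp PX = PV" | "prev_comp PY = PX" | "prev_comp PZ = PY" | "prev_comp PU = PZ"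
  | "prev_comp PV = PU"

lemma next_prev_comp [simp]: "next_comp (prev_comp i) = i" "prev_comp (next_comp i) = i"
  by (cases i; simp)+

lemma prev_comp_eq_iff [simp]: "prev_comp i = prev_comp j \<longleftrightarrow> i = j"
  by (metis next_prev_comp)

lemma prev_comp_neq [simp]:
  "prev_comp i \<noteq> i" "i \<noteq> prev_comp i" "prev_comp (prev_comp i) \<noteq> i" "i \<noteq> prev_comp (prev_comp i)"
  "next_comp i \<noteq> i" "i \<noteq> next_comp i" "next_comp i \<noteq> prev_comp i" "prev_comp i \<noteq> next_comp i"
  by (cases i; simp)+

lemma all_comp_iff: "(\<forall>i. P i) \<longleftrightarrow> P PV \<and> P PX \<and> P PY \<and> P PZ \<and> P PU"
  by (metis comp.exhaust)

lemma UNIV_comp: "UNIV = {PV, PX, PY, PZ, PU}"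
proof (rule UNIV_eq_I)
  fix i show "i \<in> {PV, PX, PY, PZ, PU}"
    by (cases i) simp_all
qed

type_synonym 'k planes = "comp \<Rightarrow> 'k fps fps"

definition fibre_prod :: "'k::field planes set"
  where "fibre_prod = {g. \<forall>i. set_t0 (g i) = set_s0 (g (prev_comp i))}"

text \<open>The variables are nested as v, u, z, y, x from the outside inwards. On \<open>PV\<close>
  the coefficient variable has to be v, the outermost one; hence the exchange by
  \<open>fps_flip\<close>.\<close>

fun to_planes :: "'k::field pow5 \<Rightarrow> 'k planes"
  where "to_planes f PX = f $ 0 $ 0 $ 0"
  | "to_planes f PY = fps_map (fps_map (\<lambda>h. h $ 0)) (f $ 0 $ 0)"
  | "to_planes f PZ = fps_map (fps_map (\<lambda>h. h $ 0 $ 0)) (f $ 0)"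
  | "to_planes f PU = fps_map (fps_map (\<lambda>h. h $ 0 $ 0 $ 0)) f"
  | "to_planes f PV = fps_flip (fps_map (\<lambda>h. h $ 0 $ 0 $ 0) f)"

lemma to_planes_add: "to_planes (f + g) = to_planes f + to_planes g"
proof
  fix i show "to_planes (f + g) i = (to_planes f + to_planes g) i"
    by (cases i) (simp_all add: fps_map_add fps_flip_add)
qed

lemma to_planes_mult: "to_planes (f * g) = to_planes f * to_planes g"
proof
  fix i show "to_planes (f * g) i = (to_planes f * to_planes g) i"
    by (cases i) (simp_all add: fps_map_mult fps_map_add fps_flip_mult)
qed

lemma to_planes_1: "to_planes 1 = 1"
proof
  fix i show "to_planes 1 i = (1 :: 'a planes) i"
    by (cases i) (simp_all add: fps_map_1 fps_flip_1, simp_all add: fps2_eq_iff)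
qed

lemma to_planes_0: "to_planes 0 = 0"
  using to_planes_add[of 0 0] by simp

lemma to_planes_in_fibre_prod: "to_planes f \<in> fibre_prod"
  by (simp add: fibre_prod_def all_comp_iff fps_eq_iff)

lemma fps5_eq_iff:
  "(f :: 'k::field pow5) = g \<longleftrightarrow> (\<forall>a b c d e. f $ a $ b $ c $ d $ e = g $ a $ b $ c $ d $ e)"
  by (simp add: fps_eq_iff)

definition Abs5 :: "(nat \<Rightarrow> nat \<Rightarrow> nat \<Rightarrow> nat \<Rightarrow> nat \<Rightarrow> 'k) \<Rightarrow> 'k pow5"
  where "Abs5 F = Abs_fps (\<lambda>a. Abs_fps (\<lambda>b. Abs_fps (\<lambda>c. Abs_fps (\<lambda>d. Abs_fps (\<lambda>e. F a b c d e)))))"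

lemma Abs5_nth [simp]: "Abs5 F $ a $ b $ c $ d $ e = F a b c d e"
  by (simp add: Abs5_def)

text \<open>The lift uses only monomials that survive on some plane. A power of a variable lives on
  two planes and the constant on all five; the gluing condition makes the order of the cases
  immaterial.\<close>

lemma fibre_prod_imp_to_planes:
  assumes "g \<in> fibre_prod"
  shows "\<exists>f. to_planes f = g"
proof
  let ?f = "Abs5 (\<lambda>v u z y x.
      if z = 0 \<and> u = 0 \<and> v = 0 then g PX $ y $ x else
      if x = 0 \<and> u = 0 \<and> v = 0 then g PY $ z $ y else
      if x = 0 \<and> y = 0 \<and> v = 0 then g PZ $ u $ z else
      if x = 0 \<and> y = 0 \<and> z = 0 then g PU $ v $ u else
      if y = 0 \<and> z = 0 \<and> u = 0 then g PV $ x $ v else 0)"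
  have "g PX $ 0 $ n = g PV $ n $ 0" "g PY $ 0 $ n = g PX $ n $ 0" "g PZ $ 0 $ n = g PY $ n $ 0"
      "g PU $ 0 $ n = g PZ $ n $ 0" "g PV $ 0 $ n = g PU $ n $ 0" for n
    using assms by (simp_all add: fibre_prod_def all_comp_iff fps_eq_iff)
  \<comment> \<open>Four equations already identify the five constant coefficients; the fifth would
    close a cycle of rewrite rules.\<close>
  note * = this[of "Suc n" for n] this(1-4)[of 0]
  show "to_planes ?f = g"
  proof
    fix i
    have "to_planes ?f i $ m $ n = g i $ m $ n" for m n
      by (cases i; cases m; cases n) (simp_all add: *)
    then show "to_planes ?f i = g i"
      by (simp add: fps2_eq_iff)
  qed
qed

lemma var5_mult_nth [simp]:
  "(varx * f) $ a $ b $ c $ d $ e = (if e = 0 then 0 else f $ a $ b $ c $ d $ (e - 1))"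
  "(vary * f) $ a $ b $ c $ d $ e = (if d = 0 then 0 else f $ a $ b $ c $ (d - 1) $ e)"
  "(varz * f) $ a $ b $ c $ d $ e = (if c = 0 then 0 else f $ a $ b $ (c - 1) $ d $ e)"
  "(varu * f) $ a $ b $ c $ d $ e = (if b = 0 then 0 else f $ a $ (b - 1) $ c $ d $ e)"
  "(varv * f) $ a $ b $ c $ d $ e = (if a = 0 then 0 else f $ (a - 1) $ b $ c $ d $ e)"
  by (simp_all add: varx_def vary_def varz_def varu_def varv_def)

text \<open>A monomial that survives on no plane is divisible by one of the five products. It is
  assigned to the first such product; the conditions in \<open>G2\<close> to \<open>G5\<close>
  exclude what an earlier product has taken.\<close>

lemma to_planes_eq_0_imp:
  assumes "to_planes f = 0"
  shows "\<exists>f1 f2 f3 f4 f5. f = varx * varz * f1 + varx * varu * f2 + vary * varu * f3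
    + vary * varv * f4 + varz * varv * f5"
proof -
  define F where "F = (\<lambda>a b c d e. f $ a $ b $ c $ d $ e)"
  have F: "f $ a $ b $ c $ d $ e = F a b c d e" for a b c d e
    by (simp add: F_def)
  have *: "F 0 0 0 m n = 0" "F 0 0 m n 0 = 0" "F 0 m n 0 0 = 0" "F m n 0 0 0 = 0" "F m 0 0 0 n = 0"
    for m n
    using fun_cong[OF assms, of PX] fun_cong[OF assms, of PY] fun_cong[OF assms, of PZ]
      fun_cong[OF assms, of PU] fun_cong[OF assms, of PV]
    by (simp_all add: fps2_eq_iff F_def)
  define G1 where "G1 = Abs5 (\<lambda>v u z y x. F v u (z+1) y (x+1))"
  define G2 where "G2 = Abs5 (\<lambda>v u z y x. if z > 0 then 0 else F v (u+1) z y (x+1))"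
  define G3 where "G3 = Abs5 (\<lambda>v u z y x. if x > 0 then 0 else F v (u+1) z (y+1) x)"
  define G4 where "G4 = Abs5 (\<lambda>v u z y x. if x > 0 \<and> z > 0 \<or> u > 0 then 0 else F (v+1) u z (y+1) x)"
  define G5 where "G5 = Abs5 (\<lambda>v u z y x. if x > 0 \<or> y > 0 then 0 else F (v+1) u (z+1) y x)"
  have "f $ a $ b $ c $ d $ e = (varx * varz * G1 + varx * varu * G2 + vary * varu * G3
    + vary * varv * G4 + varz * varv * G5) $ a $ b $ c $ d $ e" for a b c d e
    unfolding F G1_def G2_def G3_def G4_def G5_def mult.assoc
    by (cases a; cases b; cases c; cases d; cases e) (simp_all add: * del: fps_mult_nth_0 fps_mult_nth_1')
  then show ?thesis
    unfolding fps5_eq_iff by blast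
qed

lemma pow5_decomp:
  assumes "f $ 0 $ 0 $ 0 $ 0 $ 0 = 0"
  shows "\<exists>f1 f2 f3 f4 f5. (f :: 'k::field pow5) =
    varx * f1 + vary * f2 + varz * f3 + varu * f4 + varv * f5"
proof -
  define F where "F = (\<lambda>a b c d e. f $ a $ b $ c $ d $ e)"
  have F: "f $ a $ b $ c $ d $ e = F a b c d e" for a b c d e
    by (simp add: F_def)
  have *: "F 0 0 0 0 0 = 0"
    using assms by (simp add: F_def)
  have "f $ a $ b $ c $ d $ e = (varx * Abs5 (\<lambda>v u z y x. F v u z y (x+1))
    + vary * Abs5 (\<lambda>v u z y x. if x > 0 then 0 else F v u z (y+1) x)
    + varz * Abs5 (\<lambda>v u z y x. if x > 0 \<or> y > 0 then 0 else F v u (z+1) y x)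
    + varu * Abs5 (\<lambda>v u z y x. if x > 0 \<or> y > 0 \<or> z > 0 then 0 else F v (u+1) z y x)
    + varv * Abs5 (\<lambda>v u z y x. if x > 0 \<or> y > 0 \<or> z > 0 \<or> u > 0 then 0 else F (v+1) u z y x))
       $ a $ b $ c $ d $ e" for a b c d e
    unfolding F
    by (cases a; cases b; cases c; cases d; cases e) (simp_all add: * del: fps_mult_nth_0 fps_mult_nth_1')
  then show ?thesis
    unfolding fps5_eq_iff by blast
qed

text \<open>The image of a variable: it is \<open>s\<close> on the plane named after it and
  \<open>t\<close> on the preceding plane.\<close>

definition axis_var :: "comp \<Rightarrow> 'k::field planes"
  where "axis_var i = (\<lambda>j. if j = i then var_s else if j = prev_comp i then var_t else 0)"

lemma to_planes_var:
  "to_planes varx = axis_var PX" "to_planes vary = axis_var PY" "to_planes varz = axis_var PZ"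
  "to_planes varu = axis_var PU" "to_planes varv = axis_var PV"
proof -
  note d = varx_def vary_def varz_def varu_def varv_def axis_var_def var_s_def var_t_def
  have *: "fps_X $ n = (if n = Suc 0 then 1 else 0)" for n by simp
  show "to_planes varx = axis_var PX" "to_planes vary = axis_var PY" "to_planes varz = axis_var PZ"
    "to_planes varu = axis_var PU" "to_planes varv = axis_var PV"
    by (rule ext, rename_tac i, case_tac i; simp add: d fps2_eq_iff)+
qed

section \<open>The quotient ring and its identification with the fibre product\<close>

lemma pow5_ring_simps [simp]:
  "carrier pow5_ring = UNIV" "a \<otimes>\<^bsub>pow5_ring\<^esub> b = a * b" "a \<oplus>\<^bsub>pow5_ring\<^esub> b = a + b"
  "\<one>\<^bsub>pow5_ring\<^esub> = 1" "\<zero>\<^bsub>pow5_ring\<^esub> = 0"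
  by (simp_all add: pow5_ring_def ring_of_type_algebra_def)

lemma cring_pow5_ring: "cring pow5_ring"
  unfolding pow5_ring_def by (rule cring_from_type_algebra)

interpretation pow5: cring pow5_ring
  by (rule cring_pow5_ring)

lemma pow5_minus [simp]: "\<ominus>\<^bsub>pow5_ring\<^esub> a = - a"
  by (rule pow5.minus_equality) simp_all

lemma ideal_cusp_rel: "ideal cusp_rel pow5_ring"
  unfolding cusp_rel_def by (rule pow5.genideal_ideal) simp

lemma ideal_to_planes_kernel: "ideal {f. to_planes f = 0} pow5_ring"
proof (rule idealI)
  have "to_planes (- f) = 0" if "to_planes f = 0" for f :: "'a pow5"
    using to_planes_add[of f "- f"] that by (simp add: to_planes_0)
  then show "subgroup {f. to_planes f = 0} (add_monoid (pow5_ring :: 'a pow5 ring))"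
    by - (rule group.subgroupI[OF pow5.a_group], unfold a_inv_def[symmetric],
      auto simp: to_planes_add to_planes_0 intro!: exI[of _ 0])
qed (simp_all add: to_planes_mult pow5.ring_axioms)

lemma axis_var_mult_eq_0:
  "j \<noteq> i \<Longrightarrow> j \<noteq> next_comp i \<Longrightarrow> i \<noteq> next_comp j \<Longrightarrow> axis_var i * axis_var j = 0"
  by (auto simp: axis_var_def fun_eq_iff)

lemma cusp_rel_eq_kernel: "cusp_rel = {f. to_planes f = 0}"
proof
  show "cusp_rel \<subseteq> {f. to_planes f = 0}"
    unfolding cusp_rel_def
    by (intro pow5.genideal_minimal ideal_to_planes_kernel)
       (simp add: to_planes_mult to_planes_var axis_var_mult_eq_0)
next
  let ?S = "{varx * varz, varx * varu, vary * varu, vary * varv, varz * varv}"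
  have gen: "?S \<subseteq> cusp_rel"
    unfolding cusp_rel_def by (rule pow5.genideal_self) simp
  have mult: "a * b \<in> cusp_rel" if "a \<in> ?S" for a b
    using ideal.I_r_closed[OF ideal_cusp_rel, of a b] gen that by auto
  have add: "a + b \<in> cusp_rel" if "a \<in> cusp_rel" "b \<in> cusp_rel" for a b
    using additive_subgroup.a_closed[OF ideal.axioms(1)[OF ideal_cusp_rel] that] by simp
  show "{f. to_planes f = 0} \<subseteq> cusp_rel"
    by (auto dest!: to_planes_eq_0_imp intro!: add mult)
qed

lemma residue_eq: "residue f = {g. to_planes g = to_planes f}"
proof -
  have "to_planes g = to_planes f \<longleftrightarrow> (\<exists>h\<in>cusp_rel. g = h + f)" for g
  proof
    assume "to_planes g = to_planes f"
    moreover have "to_planes (g - f) + to_planes f = to_planes g"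
      by (simp add: to_planes_add[symmetric])
    ultimately show "\<exists>h\<in>cusp_rel. g = h + f"
      by (intro bexI[of _ "g - f"]) (simp_all add: cusp_rel_eq_kernel)
  qed (auto simp: to_planes_add cusp_rel_eq_kernel)
  then show ?thesis
    by (auto simp: residue_def a_r_coset_def')
qed

lemma residue_eq_iff: "residue f = residue g \<longleftrightarrow> to_planes f = to_planes g"
  by (auto simp: residue_eq)

lemma carrier_cusp_ring: "carrier cusp_ring = range residue"
  by (auto simp: cusp_ring_def FactRing_def A_RCOSETS_def' residue_def)

lemma cusp_ring_residue [simp]:
  "residue f \<oplus>\<^bsub>cusp_ring\<^esub> residue g = residue (f + g)"
  "residue f \<otimes>\<^bsub>cusp_ring\<^esub> residue g = residue (f * g)"
  using ideal.a_rcos_sum[OF ideal_cusp_rel, of f g]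
    ideal.rcoset_mult_add[OF ideal_cusp_rel, of f g]
  by (simp_all add: cusp_ring_def FactRing_def residue_def)

lemma cusp_ring_one_zero:
  "\<one>\<^bsub>cusp_ring\<^esub> = residue 1" "\<zero>\<^bsub>cusp_ring\<^esub> = residue 0"
  using pow5.a_coset_add_zero[of cusp_rel, symmetric]
  by (simp_all add: cusp_ring_def FactRing_def residue_def)

lemma cring_cusp_ring: "cring cusp_ring"
  unfolding cusp_ring_def by (rule ideal.quotient_is_cring[OF ideal_cusp_rel cring_pow5_ring])

interpretation cusp: cring cusp_ring
  by (rule cring_cusp_ring)

definition planes_of :: "'k::field pow5 set \<Rightarrow> 'k planes"
  where "planes_of C = the_elem (to_planes ` C)"

lemma planes_of_residue [simp]: "planes_of (residue f) = to_planes f"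
proof -
  have "to_planes ` residue f = {to_planes f}"
    by (auto simp: residue_eq)
  then show ?thesis
    by (simp add: planes_of_def)
qed

lemma planes_of_simps [simp]:
  "a \<in> carrier cusp_ring \<Longrightarrow> b \<in> carrier cusp_ring \<Longrightarrow>
     planes_of (a \<oplus>\<^bsub>cusp_ring\<^esub> b) = planes_of a + planes_of b"
  "a \<in> carrier cusp_ring \<Longrightarrow> b \<in> carrier cusp_ring \<Longrightarrow>
     planes_of (a \<otimes>\<^bsub>cusp_ring\<^esub> b) = planes_of a * planes_of b"
  "planes_of \<one>\<^bsub>cusp_ring\<^esub> = 1" "planes_of \<zero>\<^bsub>cusp_ring\<^esub> = 0"
  by (auto simp: carrier_cusp_ring cusp_ring_one_zero to_planes_add to_planes_mult to_planes_1
      to_planes_0)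

lemma planes_of_uminus [simp]:
  assumes "a \<in> carrier cusp_ring"
  shows "planes_of (\<ominus>\<^bsub>cusp_ring\<^esub> a) = - planes_of a"
proof -
  have "planes_of a + planes_of (\<ominus>\<^bsub>cusp_ring\<^esub> a) = 0"
    using assms by (simp only: planes_of_simps[symmetric] cusp.a_inv_closed cusp.r_neg)
  then show ?thesis
    by (simp add: eq_neg_iff_add_eq_0 add.commute)
qed

lemma bij_betw_planes_of: "bij_betw planes_of (carrier cusp_ring) fibre_prod"
  unfolding bij_betw_def
proof
  show "inj_on planes_of (carrier cusp_ring)"
    by (auto simp: inj_on_def carrier_cusp_ring residue_eq_iff)
  show "planes_of ` carrier cusp_ring = fibre_prod"
    using to_planes_in_fibre_prod fibre_prod_imp_to_planes
    unfolding carrier_cusp_ring image_image planes_of_residue by blast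
qed

definition of_planes :: "'k::field planes \<Rightarrow> 'k pow5 set"
  where "of_planes = inv_into (carrier cusp_ring) planes_of"

lemma planes_of_in [simp]: "a \<in> carrier cusp_ring \<Longrightarrow> planes_of a \<in> fibre_prod"
  using bij_betw_planes_of by (auto simp: bij_betw_def)

lemma planes_of_eq_iff:
  "a \<in> carrier cusp_ring \<Longrightarrow> b \<in> carrier cusp_ring \<Longrightarrow> planes_of a = planes_of b \<longleftrightarrow> a = b"
  using bij_betw_planes_of by (auto simp: bij_betw_def inj_on_def)

lemma of_planes [simp]:
  "g \<in> fibre_prod \<Longrightarrow> of_planes g \<in> carrier cusp_ring"
  "g \<in> fibre_prod \<Longrightarrow> planes_of (of_planes g) = g"
  "a \<in> carrier cusp_ring \<Longrightarrow> of_planes (planes_of a) = a"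
  unfolding of_planes_def
  by (simp_all add: bij_betw_inv_into_left[OF bij_betw_planes_of]
      bij_betw_inv_into_right[OF bij_betw_planes_of]
      bij_betwE[OF bij_betw_inv_into[OF bij_betw_planes_of], THEN bspec])

lemma fibre_prod_closed [simp]:
  "0 \<in> fibre_prod" "1 \<in> fibre_prod"
  "g \<in> fibre_prod \<Longrightarrow> h \<in> fibre_prod \<Longrightarrow> g + h \<in> fibre_prod"
  "g \<in> fibre_prod \<Longrightarrow> h \<in> fibre_prod \<Longrightarrow> g * h \<in> fibre_prod"
  by (simp_all add: fibre_prod_def)

lemma of_planes_simps:
  "g \<in> fibre_prod \<Longrightarrow> h \<in> fibre_prod \<Longrightarrow>
     of_planes (g + h) = of_planes g \<oplus>\<^bsub>cusp_ring\<^esub> of_planes h"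
  "g \<in> fibre_prod \<Longrightarrow> h \<in> fibre_prod \<Longrightarrow>
     of_planes (g * h) = of_planes g \<otimes>\<^bsub>cusp_ring\<^esub> of_planes h"
  by (simp_all add: planes_of_eq_iff[symmetric])

lemma axis_var_in [simp]: "axis_var i \<in> fibre_prod"
  by (auto simp: fibre_prod_def axis_var_def)

lemma fibre_prodD: "g \<in> fibre_prod \<Longrightarrow> set_t0 (g i) = set_s0 (g (prev_comp i))"
  by (simp only: fibre_prod_def mem_Collect_eq)

lemma fibre_prod_const:
  assumes "g \<in> fibre_prod"
  shows "g i $ 0 $ 0 = g j $ 0 $ 0"
proof -
  have prev: "g i $ 0 $ 0 = g (prev_comp i) $ 0 $ 0" for i
    using arg_cong[OF fibre_prodD[OF assms, of i], of "\<lambda>F. F $ 0"] by simp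
  have "g i $ 0 $ 0 = g PV $ 0 $ 0" for i
    using prev[of PX] prev[of PY] prev[of PZ] prev[of PU] by (cases i) simp_all
  then show ?thesis
    by metis
qed

text \<open>All planes share the constant coefficient of a representative. If it is nonzero, the
  representative is already invertible as a power series.\<close>

lemma cusp_ring_nonunit_const:
  assumes "a \<in> carrier cusp_ring - Units cusp_ring"
  shows "planes_of a i $ 0 $ 0 = 0"
proof (rule ccontr)
  assume *: "planes_of a i $ 0 $ 0 \<noteq> 0"
  obtain f where f: "a = residue f"
    using assms by (auto simp: carrier_cusp_ring)
  have "f $ 0 $ 0 $ 0 $ 0 $ 0 \<noteq> 0"
    using * fibre_prod_const[OF to_planes_in_fibre_prod, of f PX i] by (simp add: f)
  then have "f dvd 1"
    by (intro fps_dvd_1I) (simp add: dvd_field_iff)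
  then obtain g where "f * g = 1"
    by (metis dvdE)
  then have "a \<otimes>\<^bsub>cusp_ring\<^esub> residue g = \<one>\<^bsub>cusp_ring\<^esub>" "residue g \<otimes>\<^bsub>cusp_ring\<^esub> a = \<one>\<^bsub>cusp_ring\<^esub>"
    by (simp_all add: f mult.commute cusp_ring_one_zero)
  then have "a \<in> Units cusp_ring"
    using assms unfolding Units_def carrier_cusp_ring by blast
  with assms show False
    by simp
qed

text \<open>The five axis variables generate the maximal ideal. This extends a condition on
  multiplication by these variables, as in saturation, to multiplication by every nonunit.\<close>

lemma fibre_prod_decomp:
  assumes "g \<in> fibre_prod" "g i $ 0 $ 0 = 0"
  shows "\<exists>c. (\<forall>j. c j \<in> fibre_prod) \<and> g = axis_var PX * c PX + axis_var PY * c PY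
    + axis_var PZ * c PZ + axis_var PU * c PU + axis_var PV * c PV"
proof -
  obtain f where f: "to_planes f = g"
    using fibre_prod_imp_to_planes[OF assms(1)] by auto
  then have "f $ 0 $ 0 $ 0 $ 0 $ 0 = 0"
    using fibre_prod_const[OF assms(1), of PX i] assms(2) by auto
  then obtain f1 f2 f3 f4 f5 where
    "f = varx * f1 + vary * f2 + varz * f3 + varu * f4 + varv * f5"
    using pow5_decomp by blast
  then have "g = axis_var PX * to_planes f1 + axis_var PY * to_planes f2
    + axis_var PZ * to_planes f3 + axis_var PU * to_planes f4 + axis_var PV * to_planes f5"
    by (simp add: f[symmetric] to_planes_add to_planes_mult to_planes_var)
  then show ?thesis
    by (intro exI[of _ "case_comp (to_planes f5) (to_planes f1) (to_planes f2) (to_planes f3)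
      (to_planes f4)"])
      (simp add: all_comp_iff to_planes_in_fibre_prod)
qed

section \<open>Isomorphisms of modules\<close>

text \<open>Closure under the two operations is what makes the inverse of a bijective homomorphism a
  homomorphism, hence what symmetry of \<open>module_iso\<close> rests on.\<close>

definition module_closed :: "('r, 'x) ring_scheme \<Rightarrow> ('r, 'm, 'y) module_scheme \<Rightarrow> bool"
  where "module_closed R M \<longleftrightarrow>
    (\<forall>a\<in>carrier M. \<forall>b\<in>carrier M. a \<oplus>\<^bsub>M\<^esub> b \<in> carrier M) \<and>
    (\<forall>r\<in>carrier R. \<forall>a\<in>carrier M. r \<odot>\<^bsub>M\<^esub> a \<in> carrier M)"

lemma module_iso_closed:
  assumes "module_closed R M" "module_iso R M N"
  shows "module_closed R N"
proof -
  obtain f where f: "f \<in> module_hom R M N" "bij_betw f (carrier M) (carrier N)"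
    using assms(2) by (auto simp: module_iso_def)
  then have N: "carrier N = f ` carrier M"
    by (simp add: bij_betw_def)
  show ?thesis
    unfolding module_closed_def N
    using f(1) assms(1) by (auto simp: module_hom_def module_closed_def)
      (metis imageI)+
qed

lemma module_hom_inv_into:
  assumes M: "module_closed R M"
    and f: "f \<in> module_hom R M N" "bij_betw f (carrier M) (carrier N)"
  shows "inv_into (carrier M) f \<in> module_hom R N M"
proof -
  define g where "g = inv_into (carrier M) f"
  have g: "bij_betw g (carrier N) (carrier M)"
    unfolding g_def by (rule bij_betw_inv_into[OF f(2)])
  have gf: "g (f a) = a" if "a \<in> carrier M" for a
    unfolding g_def by (rule bij_betw_inv_into_left[OF f(2) that])
  have N: "carrier N = f ` carrier M"
    using f(2) by (simp add: bij_betw_def)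
  have "g (f a \<oplus>\<^bsub>N\<^esub> f b) = g (f a) \<oplus>\<^bsub>M\<^esub> g (f b)" if "a \<in> carrier M" "b \<in> carrier M" for a b
  proof -
    have "f a \<oplus>\<^bsub>N\<^esub> f b = f (a \<oplus>\<^bsub>M\<^esub> b)"
      using f(1) that by (simp add: module_hom_def)
    then show ?thesis
      using that M by (simp add: gf module_closed_def)
  qed
  moreover have "g (r \<odot>\<^bsub>N\<^esub> f a) = r \<odot>\<^bsub>M\<^esub> g (f a)" if "a \<in> carrier M" "r \<in> carrier R" for a r
  proof -
    have "r \<odot>\<^bsub>N\<^esub> f a = f (r \<odot>\<^bsub>M\<^esub> a)"
      using f(1) that by (simp add: module_hom_def)
    then show ?thesis
      using that M by (simp add: gf module_closed_def)
  qed
  ultimately show ?thesis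
    using g by (auto simp: module_hom_def N bij_betw_def g_def)
qed

lemma module_iso_sym:
  assumes "module_closed R M" "module_iso R M N"
  shows "module_iso R N M"
  using module_hom_inv_into[OF assms(1)] assms(2) bij_betw_inv_into
  unfolding module_iso_def by blast

lemma module_iso_trans:
  assumes "module_iso R M N" "module_iso R N K"
  shows "module_iso R M K"
proof -
  obtain f g where f: "f \<in> module_hom R M N" "bij_betw f (carrier M) (carrier N)"
    and g: "g \<in> module_hom R N K" "bij_betw g (carrier N) (carrier K)"
    using assms by (auto simp: module_iso_def)
  have "f a \<in> carrier N" if "a \<in> carrier M" for a
    using f(2) that by (auto simp: bij_betw_def)
  then have "g \<circ> f \<in> module_hom R M K"
    using f(1) g(1) by (auto simp: module_hom_def)
  then show ?thesis
    using bij_betw_trans[OF f(2) g(2)] by (auto simp: module_iso_def)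
qed

section \<open>Line bundles on the punctured spectrum\<close>

definition planes_module :: "'k::field planes set \<Rightarrow> ('k pow5 set, 'k planes) module"
  where "planes_module S = \<lparr>carrier = S, monoid.mult = (*), one = 1, ring.zero = 0, add = (+),
    module.smult = (\<lambda>r g. planes_of r * g)\<rparr>"

lemma planes_module_simps [simp]:
  "carrier (planes_module S) = S" "g \<oplus>\<^bsub>planes_module S\<^esub> h = g + h"
  "r \<odot>\<^bsub>planes_module S\<^esub> g = planes_of r * g"
  by (simp_all add: planes_module_def)

text \<open>Sections of the line bundle which is trivial on every plane and is glued by the
  transition function \<open>a\<^sub>i / b\<^sub>i\<close> on the axis \<open>t = 0\<close> of the \<open>i\<close>-th plane.\<close>

definition glued :: "(comp \<Rightarrow> 'k::field fps) \<Rightarrow> (comp \<Rightarrow> 'k fps) \<Rightarrow> 'k planes set"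
  where "glued a b = {g. \<forall>i. b i * set_t0 (g i) = a i * set_s0 (g (prev_comp i))}"

lemma gluedD: "g \<in> glued a b \<Longrightarrow> b i * set_t0 (g i) = a i * set_s0 (g (prev_comp i))"
  by (simp only: glued_def mem_Collect_eq)

lemma gluedI: "(\<And>i. b i * set_t0 (g i) = a i * set_s0 (g (prev_comp i))) \<Longrightarrow> g \<in> glued a b"
  by (simp only: glued_def mem_Collect_eq) blast

lemma glued_add: "g \<in> glued a b \<Longrightarrow> h \<in> glued a b \<Longrightarrow> g + h \<in> glued a b"
  by (rule gluedI) (simp add: gluedD distrib_left)

lemma glued_mult:
  assumes "g \<in> glued a b" "h \<in> glued a' b'"
  shows "g * h \<in> glued (a * a') (b * b')"
proof (rule gluedI)
  fix i
  show "(b * b') i * set_t0 ((g * h) i) = (a * a') i * set_s0 ((g * h) (prev_comp i))"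
    using arg_cong2[OF gluedD[OF assms(1), of i] gluedD[OF assms(2), of i], of "(*)"]
    by (simp add: ac_simps)
qed

lemma glued_cancel:
  assumes "g \<in> glued (c * a) (c * b)" "\<And>i. c i \<noteq> 0"
  shows "g \<in> glued a b"
  by (rule gluedI) (use gluedD[OF assms(1)] assms(2) in \<open>simp add: mult.assoc\<close>)

lemma fibre_prod_eq_glued: "fibre_prod = glued 1 1"
  by (simp add: fibre_prod_def glued_def)

lemma glued_smult: "c \<in> fibre_prod \<Longrightarrow> g \<in> glued a b \<Longrightarrow> c * g \<in> glued a b"
  using glued_mult[of c 1 1 g a b] by (simp add: fibre_prod_eq_glued)

lemma module_closed_glued: "module_closed cusp_ring (planes_module (glued a b))"
  by (simp add: module_closed_def glued_add glued_smult)

text \<open>The one-variable series read in \<open>t\<close>; its counterpart in \<open>s\<close> is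
  \<open>fps_const\<close>.\<close>

definition series_t :: "'k::field fps \<Rightarrow> 'k fps fps"
  where "series_t p = fps_map fps_const p"

lemma series_t_nth [simp]: "series_t p $ m $ n = (if n = 0 then p $ m else 0)"
  by (simp add: series_t_def)

lemma set_series [simp]:
  "set_t0 (fps_const p) = p" "set_s0 (fps_const p) = fps_const (p $ 0)"
  "set_s0 (series_t p) = p" "set_t0 (series_t p) = fps_const (p $ 0)"
  by (simp_all add: fps_eq_iff)

text \<open>The class of xy, yz, zu, uv or vx. It vanishes on every axis, so it satisfies any gluing
  condition.\<close>

definition corner :: "comp \<Rightarrow> 'k::field planes"
  where "corner i = (\<lambda>j. if j = i then var_s * var_t else 0)"

text \<open>A section supported on the two planes that meet in the axis \<open>i\<close>. Its
  restrictions to this axis from the two sides are \<open>a i\<close> and \<open>b i\<close>, for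
  which the gluing condition is trivially true.\<close>

definition edge :: "(comp \<Rightarrow> 'k::field fps) \<Rightarrow> (comp \<Rightarrow> 'k fps) \<Rightarrow> comp \<Rightarrow> 'k planes"
  where "edge a b i = (\<lambda>j. if j = i then fps_const (a i)
    else if j = prev_comp i then series_t (b i) else 0)"

text \<open>Vanishing at the origin makes \<open>edge\<close> vanish on the outer axes of its two
  planes, so that it can be zero on the remaining planes; being nonzero permits
  cancellation.\<close>

definition admissible :: "(comp \<Rightarrow> 'k::field fps) \<Rightarrow> bool"
  where "admissible a \<longleftrightarrow> (\<forall>i. a i \<noteq> 0 \<and> a i $ 0 = 0)"

text \<open>Corners and edges are enough to pin down homomorphisms. The notion covers the module of
  all sections and the submodule coming from the ideal that defines
  \<open>cusp_module\<close>.\<close>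

definition lattice_in :: "(comp \<Rightarrow> 'k::field fps) \<Rightarrow> (comp \<Rightarrow> 'k fps) \<Rightarrow> 'k planes set \<Rightarrow> bool"
  where "lattice_in a b L \<longleftrightarrow> L \<subseteq> glued a b \<and> (\<forall>g\<in>L. \<forall>h\<in>L. g + h \<in> L) \<and>
    (\<forall>c\<in>fibre_prod. \<forall>g\<in>L. c * g \<in> L) \<and> (\<forall>i. corner i \<in> L \<and> edge a b i \<in> L)"

lemma corner_in_glued [simp]: "corner i \<in> glued a b"
  by (rule gluedI) (simp add: corner_def)

lemma corner_in_fibre_prod [simp]: "corner i \<in> fibre_prod"
  by (simp add: fibre_prod_eq_glued)

lemma corner_mult_in_fibre_prod [simp]: "corner i * g \<in> fibre_prod"
  unfolding fibre_prod_eq_glued by (rule gluedI) (simp add: corner_def)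

lemma edge_in_glued: "admissible a \<Longrightarrow> admissible b \<Longrightarrow> edge a b i \<in> glued a b"
  by (rule gluedI) (auto simp: edge_def admissible_def)

lemma lattice_in_glued: "admissible a \<Longrightarrow> admissible b \<Longrightarrow> lattice_in a b (glued a b)"
  by (simp add: lattice_in_def glued_add glued_smult edge_in_glued)

text \<open>Since \<open>f\<close> is linear over \<open>fibre_prod\<close>, it is determined by its values on the corners, where
  it is multiplication by \<open>h\<close>; the edges bound the denominators of \<open>h\<close> and determine how its
  components are glued.\<close>

lemma lattice_hom_is_mult:
  assumes L: "lattice_in a b L" and a: "admissible a" and b: "admissible b"
    and f: "\<And>l. l \<in> L \<Longrightarrow> f l \<in> glued a' b'"
    and lin: "\<And>c l. c \<in> fibre_prod \<Longrightarrow> l \<in> L \<Longrightarrow> f (c * l) = c * f l"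
  shows "\<exists>h\<in>glued (a' * b) (b' * a). \<forall>l\<in>L. f l = h * l"
proof -
  have corner: "corner i \<in> L" and edge: "edge a b i \<in> L" for i
    using L by (simp_all add: lattice_in_def)
  \<comment> \<open>An element \<open>l\<close> of the lattice need not be a scalar, but
    \<open>corner i * l\<close> is one. Hence \<open>f\<close> of
    \<open>corner i * (corner i * l)\<close> can be computed in two ways, with either
    \<open>l\<close> or \<open>corner i\<close> as the argument of \<open>f\<close>.\<close>
  have *: "var_s * var_t * f l i = l i * f (corner i) i" if l: "l \<in> L" for l i
  proof -
    have "corner i * (corner i * f l) = f (corner i * (corner i * l))"
      using l L by (simp add: lin lattice_in_def)
    moreover have "corner i * (corner i * l) = (corner i * l) * corner i"
      by (simp only: ac_simps)
    moreover have "f (corner i * l * corner i) = corner i * l * f (corner i)"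
      by (rule lin) (simp_all add: corner)
    ultimately have "corner i * (corner i * f l) = corner i * l * f (corner i)"
      by simp
    from fun_cong[OF this, of i] show ?thesis
      by (simp add: corner_def mult.assoc)
  qed
  \<comment> \<open>The two edges that meet the plane \<open>i\<close> restrict to nonzero series on
    its two axes, where the left side of \<open>*\<close> vanishes. So \<open>f (corner i) i\<close>
    vanishes on both axes.\<close>
  have "\<exists>h. f (corner i) i = var_s * var_t * h" for i
  proof -
    have "set_t0 (f (corner i) i) = 0"
      using arg_cong[OF *[OF edge[of i], of i], of set_t0] a
      by (simp add: edge_def admissible_def)
    moreover have "set_s0 (f (corner i) i) = 0"
      using arg_cong[OF *[OF edge[of "next_comp i"], of i], of set_s0] b
      by (simp add: edge_def admissible_def)
    ultimately show ?thesis
      using var_s_var_t_dvd by (auto elim!: dvdE)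
  qed
  then obtain h where h: "\<And>i. f (corner i) i = var_s * var_t * h i"
    by metis
  have fh: "f l = h * l" if "l \<in> L" for l
    using *[OF that] by (simp add: h fun_eq_iff mult.commute)
  \<comment> \<open>The gluing condition of \<open>f\<close> applied to an edge reads off the
    transition function of \<open>h\<close>: that of the target divided by that of the
    source.\<close>
  have "h \<in> glued (a' * b) (b' * a)"
  proof (rule gluedI)
    fix i
    show "(b' * a) i * set_t0 (h i) = (a' * b) i * set_s0 (h (prev_comp i))"
      using gluedD[OF f[OF edge[of i]], of i] unfolding fh[OF edge]
      by (simp add: edge_def ac_simps)
  qed
  with fh show ?thesis
    by blast
qed

section \<open>Duals and biduals of lattices\<close>

lemma dual_module_simps:
  "carrier (dual_module R M) = module_hom R M (regular_module R) \<inter> extensional (carrier M)"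
  "f \<oplus>\<^bsub>dual_module R M\<^esub> g = (\<lambda>a\<in>carrier M. f a \<oplus>\<^bsub>R\<^esub> g a)"
  "r \<odot>\<^bsub>dual_module R M\<^esub> f = (\<lambda>a\<in>carrier M. r \<otimes>\<^bsub>R\<^esub> f a)"
  by (simp_all add: dual_module_def)

lemma regular_module_simps:
  "carrier (regular_module R) = carrier R" "a \<oplus>\<^bsub>regular_module R\<^esub> b = a \<oplus>\<^bsub>R\<^esub> b"
  "a \<odot>\<^bsub>regular_module R\<^esub> b = a \<otimes>\<^bsub>R\<^esub> b"
  by (simp_all add: regular_module_def)

lemma of_planes_smult:
  "r \<in> carrier cusp_ring \<Longrightarrow> g \<in> fibre_prod \<Longrightarrow>
     of_planes (planes_of r * g) = r \<otimes>\<^bsub>cusp_ring\<^esub> of_planes g"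
  by (simp add: of_planes_simps)

text \<open>This is \<open>lattice_hom_is_mult\<close> for the target \<open>glued 1 1\<close>,
  which is the ring itself. The answer depends on \<open>a\<close> and \<open>b\<close> only, not on
  the sublattice. Injectivity is tested on corners.\<close>

lemma dual_lattice:
  assumes M: "module_closed cusp_ring M" "module_iso cusp_ring M (planes_module L)"
    and L: "lattice_in a b L" and a: "admissible a" and b: "admissible b"
  shows "module_iso cusp_ring (planes_module (glued b a)) (dual_module cusp_ring M)"
proof -
  obtain \<theta> where \<theta>: "\<theta> \<in> module_hom cusp_ring M (planes_module L)"
    and bij: "bij_betw \<theta> (carrier M) L"
    using M(2) by (auto simp: module_iso_def)
  have \<theta>_in: "\<theta> m \<in> L" if "m \<in> carrier M" for m
    using bij that by (auto simp: bij_betw_def)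
  have \<theta>_add: "\<theta> (m \<oplus>\<^bsub>M\<^esub> n) = \<theta> m + \<theta> n" if "m \<in> carrier M" "n \<in> carrier M" for m n
    using \<theta> that by (simp add: module_hom_def)
  have \<theta>_smult: "\<theta> (r \<odot>\<^bsub>M\<^esub> m) = planes_of r * \<theta> m" if "r \<in> carrier cusp_ring" "m \<in> carrier M" for r m
    using \<theta> that by (simp add: module_hom_def)
  have closed: "\<And>m n. m \<in> carrier M \<Longrightarrow> n \<in> carrier M \<Longrightarrow> m \<oplus>\<^bsub>M\<^esub> n \<in> carrier M"
    "\<And>r m. r \<in> carrier cusp_ring \<Longrightarrow> m \<in> carrier M \<Longrightarrow> r \<odot>\<^bsub>M\<^esub> m \<in> carrier M"
    using M(1) by (auto simp: module_closed_def)
  have ab: "(a * b) i \<noteq> 0" for i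
    using a b by (simp add: admissible_def)
  have prod_in: "h * l \<in> fibre_prod" if "h \<in> glued b a" "l \<in> L" for h l
  proof -
    have "h * l \<in> glued (b * a) (a * b)"
      using that L by (intro glued_mult) (auto simp: lattice_in_def)
    then have "h * l \<in> glued ((a * b) * 1) ((a * b) * 1)"
      by (simp add: mult.commute)
    from glued_cancel[OF this ab] show ?thesis
      by (simp add: fibre_prod_eq_glued)
  qed
  define \<Psi> where "\<Psi> h = (\<lambda>m\<in>carrier M. of_planes (h * \<theta> m))" for h
  have \<Psi>_in: "\<Psi> h \<in> carrier (dual_module cusp_ring M)" if "h \<in> glued b a" for h
    using that
    by (simp add: \<Psi>_def dual_module_simps module_hom_def regular_module_simps closed \<theta>_add \<theta>_smult
        distrib_left of_planes_simps[symmetric] prod_in \<theta>_in mult.left_commute[of h]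
        of_planes_smult[symmetric])
  have "\<Psi> \<in> module_hom cusp_ring (planes_module (glued b a)) (dual_module cusp_ring M)"
    unfolding module_hom_def
    by (auto simp: \<Psi>_in dual_module_simps(2,3))
      (auto simp: \<Psi>_def distrib_right of_planes_simps prod_in \<theta>_in mult.assoc intro!: restrict_ext)
  moreover have "bij_betw \<Psi> (glued b a) (carrier (dual_module cusp_ring M))"
    unfolding bij_betw_def
  proof
    show "inj_on \<Psi> (glued b a)"
    proof (rule inj_onI)
      fix h h' assume h: "h \<in> glued b a" "h' \<in> glued b a" and eq: "\<Psi> h = \<Psi> h'"
      show "h = h'"
      proof
        fix i
        have "corner i \<in> \<theta> ` carrier M"
          using L bij by (simp add: lattice_in_def bij_betw_def)
        then obtain m where m: "m \<in> carrier M" "\<theta> m = corner i"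
          by (auto elim!: imageE)
        have "planes_of (\<Psi> h m) = planes_of (\<Psi> h' m)"
          by (simp add: eq)
        then have "h * corner i = h' * corner i"
          using h m by (simp add: \<Psi>_def prod_in[OF _ \<theta>_in[OF m(1)], unfolded m(2)])
        from fun_cong[OF this, of i] show "h i = h' i"
          by (simp add: corner_def)
      qed
    qed
    show "\<Psi> ` glued b a = carrier (dual_module cusp_ring M)"
    proof
      show "\<Psi> ` glued b a \<subseteq> carrier (dual_module cusp_ring M)"
        using \<Psi>_in by auto
      show "carrier (dual_module cusp_ring M) \<subseteq> \<Psi> ` glued b a"
      proof
        fix F assume "F \<in> carrier (dual_module cusp_ring M)"
        then have F: "F \<in> extensional (carrier M)" "\<And>m. m \<in> carrier M \<Longrightarrow> F m \<in> carrier cusp_ring"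
          "\<And>r m. r \<in> carrier cusp_ring \<Longrightarrow> m \<in> carrier M \<Longrightarrow> F (r \<odot>\<^bsub>M\<^esub> m) = r \<otimes>\<^bsub>cusp_ring\<^esub> F m"
          by (auto simp: dual_module_simps module_hom_def regular_module_simps)
        define f where "f = (\<lambda>l. planes_of (F (inv_into (carrier M) \<theta> l)))"
        have f: "f (\<theta> m) = planes_of (F m)" if "m \<in> carrier M" for m
          using bij_betw_inv_into_left[OF bij that] by (simp add: f_def)
        have img: "L = \<theta> ` carrier M"
          using bij by (simp add: bij_betw_def)
        have "\<exists>h\<in>glued (1 * b) (1 * a). \<forall>l\<in>L. f l = h * l"
        proof (rule lattice_hom_is_mult[OF L a b])
          show "f l \<in> glued 1 1" if "l \<in> L" for l
            using that by (auto simp: img f fibre_prod_eq_glued[symmetric] F)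
          show "f (c * l) = c * f l" if c: "c \<in> fibre_prod" and l: "l \<in> L" for c l
          proof -
            obtain m where m: "l = \<theta> m" "m \<in> carrier M"
              using l by (auto simp: img)
            have "c * l = \<theta> (of_planes c \<odot>\<^bsub>M\<^esub> m)"
              using c m by (simp add: \<theta>_smult)
            then show ?thesis
              using c m by (simp add: f closed F)
          qed
        qed
        then obtain h where h: "h \<in> glued b a" "\<And>l. l \<in> L \<Longrightarrow> f l = h * l"
          by auto
        have "F = \<Psi> h"
        proof (rule extensionalityI[OF F(1)])
          show "\<Psi> h \<in> extensional (carrier M)"
            by (simp add: \<Psi>_def)
          fix m assume m: "m \<in> carrier M"
          have "planes_of (F m) = h * \<theta> m"
            using h(2)[OF \<theta>_in[OF m]] by (simp add: f[OF m])
          then show "F m = \<Psi> h m"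
            using m of_planes(3)[OF F(2)[OF m]] by (simp add: \<Psi>_def)
        qed
        with h(1) show "F \<in> \<Psi> ` glued b a"
          by blast
      qed
    qed
  qed
  ultimately show ?thesis
    by (auto simp: module_iso_def)
qed

text \<open>The second dual is taken of all sections of the inverse bundle, so biduality enlarges
  the sublattice to all sections of the original one.\<close>

lemma bidual_lattice:
  assumes "module_closed cusp_ring M" "module_iso cusp_ring M (planes_module L)"
    and "lattice_in a b L" "admissible a" "admissible b"
  shows "module_iso cusp_ring (planes_module (glued a b))
    (dual_module cusp_ring (dual_module cusp_ring M))"
proof (rule dual_lattice)
  have *: "module_iso cusp_ring (planes_module (glued b a)) (dual_module cusp_ring M)"
    using assms by (rule dual_lattice)
  then show "module_closed cusp_ring (dual_module cusp_ring M)"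
    by (rule module_iso_closed[OF module_closed_glued])
  from * show "module_iso cusp_ring (dual_module cusp_ring M) (planes_module (glued b a))"
    by (rule module_iso_sym[OF module_closed_glued])
qed (use assms in \<open>auto intro: lattice_in_glued\<close>)

section \<open>The modules \<open>M(\<omega>, \<lambda>)\<close>\<close>

fun weight1 :: "weight \<Rightarrow> comp \<Rightarrow> int"
  where "weight1 ((m1, m2), (n1, n2), (p1, p2), (q1, q2), (t1, t2)) i =
    (case i of PV \<Rightarrow> m1 | PX \<Rightarrow> n1 | PY \<Rightarrow> p1 | PZ \<Rightarrow> q1 | PU \<Rightarrow> t1)"

fun weight2 :: "weight \<Rightarrow> comp \<Rightarrow> int"
  where "weight2 ((m1, m2), (n1, n2), (p1, p2), (q1, q2), (t1, t2)) i =
    (case i of PV \<Rightarrow> m2 | PX \<Rightarrow> n2 | PY \<Rightarrow> p2 | PZ \<Rightarrow> q2 | PU \<Rightarrow> t2)"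

lemma normalized_weight_iff: "normalized_weight w \<longleftrightarrow> (\<forall>i. min (weight1 w i) (weight2 w i) = 1)"
  by (cases w) (auto simp: normalized_weight_def all_comp_iff)

lemma weight_eq_iff: "w = w' \<longleftrightarrow> weight1 w = weight1 w' \<and> weight2 w = weight2 w'"
  by (cases w; cases w') (auto simp: fun_eq_iff all_comp_iff)

definition glue1 :: "weight \<Rightarrow> comp \<Rightarrow> 'k::field fps"
  where "glue1 w i = fps_X ^ nat (weight1 w i)"

definition glue2 :: "weight \<Rightarrow> 'k::field \<Rightarrow> comp \<Rightarrow> 'k fps"
  where "glue2 w c i = (if i = PV then fps_const c else 1) * fps_X ^ nat (weight2 w i)"

text \<open>If the minimum of two integers is 1, both are positive, so the monomials vanish at the
  origin.\<close>

lemma admissible_glue: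
  assumes "normalized_weight w"
  shows "admissible (glue1 w)" and "c \<noteq> 0 \<Longrightarrow> admissible (glue2 w c)"
proof -
  have "weight1 w i > 0 \<and> weight2 w i > 0" for i
  proof -
    have "min (weight1 w i) (weight2 w i) = 1"
      using assms by (simp add: normalized_weight_iff)
    then show ?thesis
      by (auto simp: min_def split: if_splits)
  qed
  then show "admissible (glue1 w)" "c \<noteq> 0 \<Longrightarrow> admissible (glue2 w c)"
    by (simp_all add: admissible_def glue1_def glue2_def fps_nth_power_0)
qed

section \<open>The generators of the ideal as elements of the product of the planes\<close>

lemma planes_power [simp]: "((g :: 'k::field planes) ^ n) i = g i ^ n"
  by (induction n) simp_all

lemma to_planes_power: "to_planes (f ^ n) = to_planes f ^ n"
  by (induction n) (simp_all add: to_planes_1 to_planes_mult)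

lemma to_planes_const5: "to_planes (const5 c) = (\<lambda>i. fps_const (fps_const c))"
proof
  fix i show "to_planes (const5 c) i = fps_const (fps_const c)"
    by (cases i) (simp_all add: const5_def fps2_eq_iff)
qed

lemma series_t_monomial: "series_t (fps_const c * fps_X ^ n) = fps_const (fps_const c) * var_t ^ n"
  by (auto simp: fps2_eq_iff var_t_def)

text \<open>The image of xy + yz + zu + uv + vx. Multiplication by it turns each corner into its
  square and raises the exponents of an edge by one while adding the other coordinate as a factor,
  as in x^n becoming x^(n+1) y.\<close>

definition corner_scale :: "'k::field planes"
  where "corner_scale = (\<lambda>i. var_s * var_t)"

lemma corner_scale_cancel: "corner_scale * g = corner_scale * h \<longleftrightarrow> g = h"
  by (auto simp: corner_scale_def fun_eq_iff)

lemma corner_scale_in [simp]: "corner_scale * g \<in> fibre_prod"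
  unfolding fibre_prod_eq_glued by (rule gluedI) (simp add: corner_scale_def)

abbreviation J_gens :: "'k::field pow5 set"
  where "J_gens \<equiv> {(varx * vary)\<^sup>2, (vary * varz)\<^sup>2, (varz * varu)\<^sup>2, (varu * varv)\<^sup>2, (varv * varx)\<^sup>2}"

fun edge_gens :: "weight \<Rightarrow> 'k::field \<Rightarrow> comp \<Rightarrow> 'k pow5"
  where "edge_gens ((m1, m2), (n1, n2), (p1, p2), (q1, q2), (t1, t2)) c i = (case i of
      PV \<Rightarrow> varv ^ nat (m1 + 1) * varx + const5 c * varv ^ nat (m2 + 1) * varu
    | PX \<Rightarrow> varx ^ nat (n1 + 1) * vary + varx ^ nat (n2 + 1) * varv
    | PY \<Rightarrow> vary ^ nat (p1 + 1) * varz + vary ^ nat (p2 + 1) * varx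
    | PZ \<Rightarrow> varz ^ nat (q1 + 1) * varu + varz ^ nat (q2 + 1) * vary
    | PU \<Rightarrow> varu ^ nat (t1 + 1) * varv + varu ^ nat (t2 + 1) * varz)"

lemma cusp_ideal_eq:
  "cusp_ideal w c = Idl\<^bsub>cusp_ring\<^esub> (cusp_J \<union> residue ` range (edge_gens w c))"
proof -
  obtain m1 m2 n1 n2 p1 p2 q1 q2 t1 t2 where
    "w = ((m1, m2), (n1, n2), (p1, p2), (q1, q2), (t1, t2))"
    by (metis surj_pair)
  then show ?thesis
    by (simp add: cusp_ideal_def UNIV_comp)
qed

lemma to_planes_J_gens: "to_planes ` J_gens = range (\<lambda>i. corner_scale * corner i)"
proof -
  have range: "range f = {f PX, f PY, f PZ, f PU, f PV}" for f :: "comp \<Rightarrow> 'a planes"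
    by (auto simp: UNIV_comp)
  have *: "(axis_var i * axis_var j)\<^sup>2 = (corner_scale * corner i :: 'a planes)" if "j = next_comp i" for i j
  proof
    fix l show "((axis_var i * axis_var j)\<^sup>2) l = (corner_scale * corner i :: 'a planes) l"
      using that by (auto simp: axis_var_def corner_scale_def corner_def power2_eq_square ac_simps)
  qed
  show ?thesis
    by (simp add: range to_planes_power to_planes_mult to_planes_var *)
qed

lemma to_planes_edge_gens:
  assumes "normalized_weight w"
  shows "to_planes (edge_gens w c i) = corner_scale * edge (glue1 w) (glue2 w c) i"
proof -
  obtain m1 m2 n1 n2 p1 p2 q1 q2 t1 t2 where
    w: "w = ((m1, m2), (n1, n2), (p1, p2), (q1, q2), (t1, t2))"
    by (metis surj_pair)
  have "nat (a + 1) = Suc (nat a)" "nat (b + 1) = Suc (nat b)" if "min a b = 1" for a b :: int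
    using that by (auto simp: min_def split: if_splits)
  then have Suc: "nat (m1 + 1) = Suc (nat m1)" "nat (m2 + 1) = Suc (nat m2)"
    "nat (n1 + 1) = Suc (nat n1)" "nat (n2 + 1) = Suc (nat n2)"
    "nat (p1 + 1) = Suc (nat p1)" "nat (p2 + 1) = Suc (nat p2)"
    "nat (q1 + 1) = Suc (nat q1)" "nat (q2 + 1) = Suc (nat q2)"
    "nat (t1 + 1) = Suc (nat t1)" "nat (t2 + 1) = Suc (nat t2)"
    using assms unfolding normalized_weight_def w prod.case by blast+
  have const: "fps_const (fps_X ^ n) = var_s ^ n" for n
    by (simp add: var_s_def fps_const_power)
  have series: "series_t (fps_const c * fps_X ^ n) = fps_const (fps_const c) * var_t ^ n"
    "series_t (fps_X ^ n) = var_t ^ n" for n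
    using series_t_monomial[of c] series_t_monomial[of 1] by simp_all
  show ?thesis
  proof
    fix j show "to_planes (edge_gens w c i) j = (corner_scale * edge (glue1 w) (glue2 w c) i) j"
      unfolding w
      by (cases i; cases j)
        (simp_all add: Suc to_planes_add to_planes_mult to_planes_power to_planes_var to_planes_const5
          axis_var_def corner_scale_def edge_def glue1_def glue2_def const series mult_ac)
  qed
qed

text \<open>Division by the nonzerodivisor \<open>corner_scale\<close> maps the ideal isomorphically
  onto \<open>L\<close>, and it maps the generators of the ideal to the corners and edges.\<close>

lemma cusp_ideal_lattice:
  assumes w: "normalized_weight w" and c: "c \<noteq> 0"
  defines "L \<equiv> {g. corner_scale * g \<in> planes_of ` cusp_ideal w c}"
  shows "lattice_in (glue1 w) (glue2 w c) L"
    and "module_closed cusp_ring (ideal_module cusp_ring (cusp_ideal w c))"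
    and "module_iso cusp_ring (ideal_module cusp_ring (cusp_ideal w c)) (planes_module L)"
proof -
  let ?I = "cusp_ideal w c"
  let ?N = "glued (glue1 w) (glue2 w c)"
  note adm = admissible_glue[OF w] admissible_glue(2)[OF w c]
  have res: "range residue \<subseteq> carrier cusp_ring"
    by (simp add: carrier_cusp_ring)
  then have "residue ` J_gens \<subseteq> carrier cusp_ring"
    by blast
  then have J: "ideal cusp_J cusp_ring" "residue ` J_gens \<subseteq> cusp_J"
    unfolding cusp_J_def by (rule cusp.genideal_ideal, rule cusp.genideal_self)
  then have gens: "cusp_J \<union> residue ` range (edge_gens w c) \<subseteq> carrier cusp_ring"
    using res ideal.Icarr by fastforce
  have I: "ideal ?I cusp_ring" and gens_in: "cusp_J \<union> residue ` range (edge_gens w c) \<subseteq> ?I"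
    unfolding cusp_ideal_eq by (rule cusp.genideal_ideal[OF gens], rule cusp.genideal_self[OF gens])
  \<comment> \<open>All multiples of \<open>corner_scale\<close> by sections form an ideal. It
    contains the generators, hence the whole ideal, and this bounds \<open>L\<close> from
    above.\<close>
  define K where "K = {r \<in> carrier cusp_ring. \<exists>g\<in>?N. planes_of r = corner_scale * g}"
  have K: "ideal K cusp_ring"
  proof (rule idealI[OF cusp.ring_axioms])
    show "subgroup K (add_monoid cusp_ring)"
    proof (rule group.subgroupI[OF cusp.a_group])
      show "K \<noteq> {}"
      proof -
        have "(0 :: 'a planes) \<in> ?N"
          by (rule gluedI) simp
        then have "\<zero>\<^bsub>cusp_ring\<^esub> \<in> K"
          unfolding K_def mem_Collect_eq planes_of_simps(4)
          by (intro conjI cusp.zero_closed bexI[of _ 0]) simp_all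
        then show ?thesis
          by blast
      qed
      show "inv\<^bsub>add_monoid cusp_ring\<^esub> r \<in> K" if "r \<in> K" for r
      proof -
        obtain g where g: "r \<in> carrier cusp_ring" "g \<in> ?N" "planes_of r = corner_scale * g"
          using \<open>r \<in> K\<close> by (auto simp: K_def)
        have "planes_of (\<ominus>\<^bsub>cusp_ring\<^esub> r) = corner_scale * (- 1 * g)"
          using g by (simp add: fun_eq_iff)
        moreover have "- 1 * g \<in> ?N"
          using gluedD[OF g(2)] by (intro gluedI) (simp add: fun_eq_iff)
        ultimately show ?thesis
          using g(1) unfolding a_inv_def[symmetric] K_def by blast
      qed
    qed (auto simp: K_def glued_add distrib_left intro!: bexI[OF _ glued_add])
    have "\<exists>g\<in>?N. planes_of x * (corner_scale * h) = corner_scale * g"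
      if "x \<in> carrier cusp_ring" "h \<in> ?N" for x h
      using glued_smult[OF planes_of_in[OF that(1)] that(2)] by (metis mult.left_commute)
    then show "x \<otimes>\<^bsub>cusp_ring\<^esub> r \<in> K" "r \<otimes>\<^bsub>cusp_ring\<^esub> x \<in> K" if "r \<in> K" "x \<in> carrier cusp_ring" for r x
      using that by (auto simp: K_def cusp.m_comm[of r x])
  qed
  have J_K: "cusp_J \<subseteq> K"
    unfolding cusp_J_def
  proof (rule cusp.genideal_minimal[OF K], rule subsetI)
    fix r :: "'a pow5 set" assume "r \<in> residue ` J_gens"
    then have "planes_of r \<in> to_planes ` J_gens" "r \<in> carrier cusp_ring"
      by (auto simp: carrier_cusp_ring simp del: insert_iff)
    then show "r \<in> K"
      unfolding to_planes_J_gens K_def using corner_in_glued by blast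
  qed
  have "residue (edge_gens w c i) \<in> K" for i
    unfolding K_def mem_Collect_eq planes_of_residue to_planes_edge_gens[OF w] carrier_cusp_ring
    using edge_in_glued[OF adm(1) adm(3)] by blast
  then have "residue ` range (edge_gens w c) \<subseteq> K"
    by blast
  with J_K have "?I \<subseteq> K"
    unfolding cusp_ideal_eq by (intro cusp.genideal_minimal[OF K]) auto
  then have I_carr: "r \<in> carrier cusp_ring" and I_N: "\<exists>g\<in>?N. planes_of r = corner_scale * g"
    if "r \<in> ?I" for r
    using that by (auto simp: K_def)
  have I_add: "r \<oplus>\<^bsub>cusp_ring\<^esub> s \<in> ?I" if "r \<in> ?I" "s \<in> ?I" for r s
    using additive_subgroup.a_closed[OF ideal.axioms(1)[OF I] that] .
  have I_mult: "r \<otimes>\<^bsub>cusp_ring\<^esub> s \<in> ?I" if "r \<in> carrier cusp_ring" "s \<in> ?I" for r s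
    using ideal.I_l_closed[OF I that(2,1)] .
  show "lattice_in (glue1 w) (glue2 w c) L"
    unfolding lattice_in_def
  proof (intro conjI ballI allI)
    show "L \<subseteq> ?N"
    proof
      fix g assume "g \<in> L"
      then obtain r where "r \<in> ?I" "corner_scale * g = planes_of r"
        by (auto simp: L_def)
      then show "g \<in> ?N"
        using I_N by (metis corner_scale_cancel)
    qed
    show "g + h \<in> L" if gh: "g \<in> L" "h \<in> L" for g h
    proof -
      obtain r s where r: "r \<in> ?I" "corner_scale * g = planes_of r"
        and s: "s \<in> ?I" "corner_scale * h = planes_of s"
        using gh by (auto simp: L_def)
      have "corner_scale * (g + h) = planes_of (r \<oplus>\<^bsub>cusp_ring\<^esub> s)"
        using r s by (simp add: I_carr distrib_left)
      then show ?thesis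
        using I_add[OF r(1) s(1)] by (auto simp: L_def)
    qed
    show "d * g \<in> L" if d: "d \<in> fibre_prod" and g: "g \<in> L" for d g
    proof -
      obtain r where r: "r \<in> ?I" "corner_scale * g = planes_of r"
        using g by (auto simp: L_def)
      have "corner_scale * (d * g) = planes_of (of_planes d \<otimes>\<^bsub>cusp_ring\<^esub> r)"
        using r d by (simp add: I_carr mult.left_commute[of corner_scale])
      then show ?thesis
        using I_mult[OF _ r(1), of "of_planes d"] d by (auto simp: L_def)
    qed
    show "corner i \<in> L" for i
    proof -
      have "corner_scale * (corner i :: 'a planes) \<in> to_planes ` J_gens"
        unfolding to_planes_J_gens by simp
      then obtain f :: "'a pow5" where f: "corner_scale * corner i = to_planes f" "f \<in> J_gens"
        by (rule imageE)
      from f(2) have "residue f \<in> ?I"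
        using J(2) gens_in by blast
      then show ?thesis
        unfolding L_def mem_Collect_eq f(1) planes_of_residue[symmetric] by (rule imageI)
    qed
    show "edge (glue1 w) (glue2 w c) i \<in> L" for i
    proof -
      have "residue (edge_gens w c i) \<in> ?I"
        using gens_in by auto
      then show ?thesis
        unfolding L_def mem_Collect_eq to_planes_edge_gens[OF w, symmetric] planes_of_residue[symmetric]
        by (rule imageI)
    qed
  qed
  show "module_closed cusp_ring (ideal_module cusp_ring ?I)"
    by (simp add: module_closed_def regular_module_def I_add I_mult)
  \<comment> \<open>The isomorphism is built in the direction in which it is a multiplication, and
    then inverted.\<close>
  define \<phi> where "\<phi> g = of_planes (corner_scale * g)" for g :: "'a planes"
  have L_iff: "g \<in> L \<longleftrightarrow> \<phi> g \<in> ?I" for g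
    by (auto simp: L_def \<phi>_def I_carr intro!: image_eqI[of "corner_scale * g" planes_of "of_planes (corner_scale * g)"])
  have "\<phi> \<in> module_hom cusp_ring (planes_module L) (ideal_module cusp_ring ?I)"
    by (auto simp: module_hom_def regular_module_def L_iff \<phi>_def distrib_left of_planes_simps
        of_planes_smult mult.left_commute[of corner_scale])
  moreover have "bij_betw \<phi> L ?I"
    unfolding bij_betw_def
  proof
    show "inj_on \<phi> L"
      by (rule inj_onI) (metis \<phi>_def corner_scale_cancel corner_scale_in of_planes(2))
    show "\<phi> ` L = ?I"
    proof
      show "\<phi> ` L \<subseteq> ?I"
        by (auto simp: L_iff)
      show "?I \<subseteq> \<phi> ` L"
      proof
        fix r assume r: "r \<in> ?I"
        then obtain g where "planes_of r = corner_scale * g"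
          using I_N by blast
        then have "\<phi> g = r"
          using of_planes(3)[OF I_carr[OF r]] by (simp add: \<phi>_def)
        then show "r \<in> \<phi> ` L"
          using r L_iff by blast
      qed
    qed
  qed
  ultimately have "module_iso cusp_ring (planes_module L) (ideal_module cusp_ring ?I)"
    by (auto simp: module_iso_def regular_module_def)
  moreover have "module_closed cusp_ring (planes_module L)"
    using \<open>lattice_in (glue1 w) (glue2 w c) L\<close> by (simp add: module_closed_def lattice_in_def)
  ultimately show "module_iso cusp_ring (ideal_module cusp_ring ?I) (planes_module L)"
    using module_iso_sym by blast
qed

lemma cusp_module_iso_glued:
  assumes w: "normalized_weight w" and c: "c \<noteq> 0"
  shows "module_iso cusp_ring (planes_module (glued (glue1 w) (glue2 w c))) (cusp_module w c)"
  unfolding cusp_module_def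
  using cusp_ideal_lattice[OF assms] admissible_glue[OF w] c by (intro bidual_lattice) auto

text \<open>An isomorphism is multiplication by some \<open>h\<close>, and its inverse by some
  \<open>h'\<close>, so \<open>h\<close> is a unit on every plane. On each axis, units affect
  neither the order of the transition function nor, up to constants, its leading
  coefficient.\<close>

lemma glued_iso_imp_eq:
  assumes w: "normalized_weight w" "normalized_weight w'" and c: "c \<noteq> 0" "c' \<noteq> 0"
    and iso: "module_iso cusp_ring (planes_module (glued (glue1 w) (glue2 w c)))
      (planes_module (glued (glue1 w') (glue2 w' c')))"
  shows "w = w' \<and> c = c'"
proof -
  have mult: "\<exists>h\<in>glued (glue1 w' * glue2 w c) (glue2 w' c' * glue1 w).
      \<forall>l\<in>glued (glue1 w) (glue2 w c). f l = h * l"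
    if "f \<in> module_hom cusp_ring (planes_module (glued (glue1 w) (glue2 w c)))
      (planes_module (glued (glue1 w') (glue2 w' c')))"
      "normalized_weight w" "c \<noteq> 0" for f w c w' c'
  proof (rule lattice_hom_is_mult)
    show "admissible (glue1 w)" "admissible (glue2 w c)"
      by (rule admissible_glue[OF that(2)], rule admissible_glue(2)[OF that(2,3)])
    then show "lattice_in (glue1 w) (glue2 w c) (glued (glue1 w) (glue2 w c))"
      by (rule lattice_in_glued)
    show "f l \<in> glued (glue1 w') (glue2 w' c')" if "l \<in> glued (glue1 w) (glue2 w c)" for l
      using \<open>f \<in> _\<close> that by (auto simp: module_hom_def)
    show "f (d * l) = d * f l" if d: "d \<in> fibre_prod" and l: "l \<in> glued (glue1 w) (glue2 w c)" for d l
    proof -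
      have "\<forall>r\<in>carrier cusp_ring. f (planes_of r * l) = planes_of r * f l"
        using \<open>f \<in> _\<close> l by (simp add: module_hom_def)
      from this[rule_format, of "of_planes d"] show ?thesis
        using d by simp
    qed
  qed
  obtain f where f: "f \<in> module_hom cusp_ring (planes_module (glued (glue1 w) (glue2 w c)))
      (planes_module (glued (glue1 w') (glue2 w' c')))"
    and f_bij: "bij_betw f (glued (glue1 w) (glue2 w c)) (glued (glue1 w') (glue2 w' c'))"
    using iso by (auto simp: module_iso_def)
  obtain h where h: "h \<in> glued (glue1 w' * glue2 w c) (glue2 w' c' * glue1 w)"
    "\<And>l. l \<in> glued (glue1 w) (glue2 w c) \<Longrightarrow> f l = h * l"
    using mult[OF f w(1) c(1)] by blast
  have unit: "h i $ 0 $ 0 \<noteq> 0" for i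
  proof -
    let ?g = "inv_into (glued (glue1 w) (glue2 w c)) f"
    have "?g \<in> module_hom cusp_ring (planes_module (glued (glue1 w') (glue2 w' c')))
      (planes_module (glued (glue1 w) (glue2 w c)))"
      using module_hom_inv_into[OF module_closed_glued f] f_bij by simp
    then obtain h' where h': "\<And>l. l \<in> glued (glue1 w') (glue2 w' c') \<Longrightarrow> ?g l = h' * l"
      using mult[OF _ w(2) c(2)] by blast
    have "f (corner i) \<in> glued (glue1 w') (glue2 w' c')"
      using f_bij by (auto simp: bij_betw_def)
    then have "corner i = h' * (h * corner i)"
      using bij_betw_inv_into_left[OF f_bij corner_in_glued] by (simp add: h(2) h'[symmetric])
    from fun_cong[OF this, of i] have "h' i * h i = 1"
      by (simp add: corner_def)
    from arg_cong[OF this, of "\<lambda>F. F $ 0 $ 0"] show ?thesis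
      by auto
  qed
  define d where "d i = (if i = PV then c else 1)" for i
  define d' where "d' i = (if i = PV then c' else 1)" for i
  have eq: "nat (weight2 w' i) + nat (weight1 w i) = nat (weight1 w' i) + nat (weight2 w i) \<and>
    d' i * h i $ 0 $ 0 = d i * h (prev_comp i) $ 0 $ 0" for i
  proof -
    let ?p = "fps_const (d' i) * set_t0 (h i)" and ?q = "fps_const (d i) * set_s0 (h (prev_comp i))"
    let ?m = "nat (weight2 w' i) + nat (weight1 w i)" and ?n = "nat (weight1 w' i) + nat (weight2 w i)"
    have nz: "?p $ 0 \<noteq> 0" "?q $ 0 \<noteq> 0"
      using unit c by (simp_all add: d_def d'_def)
    have *: "fps_X ^ ?m * ?p = fps_X ^ ?n * ?q"
      using gluedD[OF h(1), of i]
      by (simp add: glue1_def glue2_def d_def d'_def power_add ac_simps split: if_splits)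
    have "subdegree (fps_X ^ ?m * ?p) = ?m" "subdegree (fps_X ^ ?n * ?q) = ?n"
      using nz by (intro subdegreeI; simp add: fps_X_power_mult_nth)+
    then have mn: "?m = ?n"
      using * by metis
    with * have "?p = ?q"
      by simp
    from arg_cong[OF this, of "\<lambda>F. F $ 0"] mn show ?thesis
      by simp
  qed
  \<comment> \<open>On four axes the constant coefficients of \<open>h\<close> on the adjacent
    planes agree; closing the cycle over the v-axis then compares \<open>c\<close> with
    \<open>c'\<close>.\<close>
  have "h PX $ 0 $ 0 = h PV $ 0 $ 0" "h PY $ 0 $ 0 = h PX $ 0 $ 0" "h PZ $ 0 $ 0 = h PY $ 0 $ 0"
    "h PU $ 0 $ 0 = h PZ $ 0 $ 0" "c' * h PV $ 0 $ 0 = c * h PU $ 0 $ 0"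
    using eq[of PV] eq[of PX] eq[of PY] eq[of PZ] eq[of PU] by (simp_all add: d_def d'_def)
  then have "c = c'"
    using unit[of PV] by simp
  \<comment> \<open>Orders determine the difference of the two weights, and the minimum 1 then
    determines both.\<close>
  moreover have "weight1 w i = weight1 w' i \<and> weight2 w i = weight2 w' i" for i
  proof -
    have "min (weight1 w i) (weight2 w i) = 1" "min (weight1 w' i) (weight2 w' i) = 1"
      using w by (simp_all add: normalized_weight_iff)
    then show ?thesis
      using eq[of i] by (auto simp: min_def split: if_splits)
  qed
  ultimately show ?thesis
    by (auto simp: weight_eq_iff)
qed

lemma cusp_module_iso_iff:
  assumes w: "normalized_weight w" "normalized_weight w'" and c: "c \<noteq> 0" "c' \<noteq> 0"
  shows "module_iso cusp_ring (cusp_module w c) (cusp_module w' c') \<longleftrightarrow> w = w' \<and> c = c'"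
proof
  note iso = cusp_module_iso_glued[OF w(1) c(1)] cusp_module_iso_glued[OF w(2) c(2)]
  assume "module_iso cusp_ring (cusp_module w c) (cusp_module w' c')"
  with iso(1) have "module_iso cusp_ring (planes_module (glued (glue1 w) (glue2 w c)))
      (cusp_module w' c')"
    by (rule module_iso_trans)
  then have "module_iso cusp_ring (planes_module (glued (glue1 w) (glue2 w c)))
      (planes_module (glued (glue1 w') (glue2 w' c')))"
    by (rule module_iso_trans) (rule module_iso_sym[OF module_closed_glued iso(2)])
  then show "w = w' \<and> c = c'"
    by (rule glued_iso_imp_eq[OF w c])
next
  assume "w = w' \<and> c = c'"
  then show "module_iso cusp_ring (cusp_module w c) (cusp_module w' c')"
    by (auto simp: module_iso_def module_hom_def intro!: exI[of _ id])
qed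

section \<open>Saturated ideals of \<open>k[[s, t]]\<close> are principal\<close>

lemma var_t_decomp: "\<exists>G. F = fps_const (set_t0 F) + var_t * (G :: 'k::field fps fps)"
proof -
  have "var_t dvd F - fps_const (set_t0 F)"
    by (simp add: var_t_dvd_iff)
  then show ?thesis
    by (metis add.commute diff_add_cancel dvdE)
qed

text \<open>Modulo \<open>t\<close> the ideal becomes an ideal of the discrete valuation ring \<open>k[[s]]\<close>, and saturation
  makes \<open>t\<close> a nonzerodivisor modulo the ideal; a generator is lifted from \<open>k[[s]]\<close> by
  successive approximation.\<close>

lemma saturated_ideal_generated_mod_t:
  fixes I :: "'k::field fps fps set"
  assumes add: "\<And>f g. f \<in> I \<Longrightarrow> g \<in> I \<Longrightarrow> f + g \<in> I"
    and mult: "\<And>f g. g \<in> I \<Longrightarrow> f * g \<in> I"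
    and sat: "\<And>w. var_s * w \<in> I \<Longrightarrow> var_t * w \<in> I \<Longrightarrow> w \<in> I"
    and ex: "f0 \<in> I" "set_t0 f0 \<noteq> 0"
  shows "\<exists>f\<in>I. f \<noteq> 0 \<and> (\<forall>g\<in>I. f dvd g)"
proof -
  obtain f where f: "f \<in> I" "set_t0 f \<noteq> 0"
    and min: "\<And>g. g \<in> I \<Longrightarrow> set_t0 g \<noteq> 0 \<Longrightarrow> subdegree (set_t0 f) \<le> subdegree (set_t0 g)"
    using ex_has_least_nat[of "\<lambda>f. f \<in> I \<and> set_t0 f \<noteq> 0" f0 "\<lambda>f. subdegree (set_t0 f)"] ex by auto
  have diff: "f - g \<in> I" if "f \<in> I" "g \<in> I" for f g
    using add[OF that(1) mult[OF that(2), of "- 1"]] by simp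
  \<comment> \<open>Write \<open>f\<close> as \<open>q\<close> s^n + t \<open>f1\<close> with a unit
    \<open>q\<close> in s. A combination of \<open>f\<close> and \<open>var_t * w\<close> cancels
    the second term and leaves s^n \<open>w\<close> in the ideal; as \<open>var_t * w\<close> is in
    it too, saturation lowers n step by step to 0.\<close>
  have div_t: "w \<in> I" if w: "var_t * w \<in> I" for w
  proof -
    define n where "n = subdegree (set_t0 f)"
    define q where "q = fps_shift n (set_t0 f)"
    have "set_t0 f = q * fps_X ^ n"
      unfolding q_def n_def by (rule subdegree_decompose)
    then have "set_t0 f * inverse q = (q * inverse q) * fps_X ^ n"
      by (simp add: ac_simps)
    moreover have "q * inverse q = 1"
      using nth_subdegree_nonzero[OF f(2)] by (intro inverse_mult_eq_1') (simp add: q_def n_def)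
    ultimately have u: "set_t0 f * inverse q = fps_X ^ n"
      by simp
    obtain f1 where f1: "f = fps_const (set_t0 f) + var_t * f1"
      using var_t_decomp by blast
    have "fps_const (inverse q) * w * f - (fps_const (inverse q) * f1) * (var_t * w) \<in> I"
      by (intro diff mult f(1) w)
    also have "fps_const (inverse q) * w * f - (fps_const (inverse q) * f1) * (var_t * w) = fps_const (set_t0 f * inverse q) * w"
      by (subst f1) (simp add: algebra_simps)
    also have "\<dots> = var_s ^ n * w"
      by (simp add: u var_s_def fps_const_power)
    finally have "var_s ^ n * w \<in> I" .
    then show "w \<in> I"
    proof (induction n)
      case (Suc n)
      have "var_s ^ n * w \<in> I"
      proof (rule sat)
        show "var_s * (var_s ^ n * w) \<in> I"
          using Suc.prems by (simp add: mult.assoc)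
        show "var_t * (var_s ^ n * w) \<in> I"
          using mult[OF w, of "var_s ^ n"] by (simp add: ac_simps)
      qed
      then show ?case
        by (rule Suc.IH)
    qed simp
  qed
  have step: "\<exists>p g'. g' \<in> I \<and> g = fps_const p * f + var_t * g'" if g: "g \<in> I" for g
  proof -
    have "set_t0 f dvd set_t0 g"
    proof (cases "set_t0 g = 0")
      case False
      then show ?thesis
        using min[OF g] f(2) fps_dvd_iff by blast
    qed simp
    then obtain p where p: "set_t0 g = p * set_t0 f"
      by (metis dvdE mult.commute)
    then have "var_t dvd g - fps_const p * f"
      by (simp add: var_t_dvd_iff)
    then obtain g' where g': "g - fps_const p * f = var_t * g'"
      by (elim dvdE)
    moreover have "g - fps_const p * f \<in> I"
      by (intro diff mult g f)
    ultimately show ?thesis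
      using div_t[of g'] by (metis add.commute diff_add_cancel)
  qed
  then obtain P G where PG: "\<And>g. g \<in> I \<Longrightarrow> G g \<in> I"
    "\<And>g. g \<in> I \<Longrightarrow> g = fps_const (P g) * f + var_t * G g"
    by metis
  \<comment> \<open>The quotient by \<open>f\<close>, whose coefficient of t^n is the partial
    quotient found after n divisions by t.\<close>
  define H where "H g = Abs_fps (\<lambda>n. P ((G ^^ n) g))" for g
  have H: "H g = fps_const (P g) + var_t * H (G g)" for g
  proof (rule fps_ext)
    fix n show "H g $ n = (fps_const (P g) + var_t * H (G g)) $ n"
      by (cases n) (simp_all add: H_def var_t_def funpow_swap1)
  qed
  \<comment> \<open>The error for \<open>g\<close> is t times the error for \<open>G g\<close>.
    Induction on n over all elements of the ideal replaces a convergence argument.\<close>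
  have "(g - f * H g) $ n = 0" if "g \<in> I" for g n
    using that
  proof (induction n arbitrary: g)
    case 0
    have "g - f * H g = var_t * (G g - f * H (G g))"
      by (subst PG(2)[OF 0], subst H) (simp add: algebra_simps)
    then show ?case
      by (simp add: var_t_def)
  next
    case (Suc n)
    have "g - f * H g = var_t * (G g - f * H (G g))"
      by (subst PG(2)[OF Suc.prems], subst H) (simp add: algebra_simps)
    then show ?case
      using Suc.IH[OF PG(1)[OF Suc.prems]] by (simp add: var_t_def)
  qed
  then have "g = f * H g" if "g \<in> I" for g
    using that by (metis eq_iff_diff_eq_0 fps_ext fps_zero_nth)
  with f show ?thesis
    by (intro bexI[of _ f]) (auto intro: dvdI)
qed

text \<open>Here \<open>subdegree\<close> is the order in t. Dividing the ideal by the largest power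
  of t common to all its elements preserves saturation and produces an element not divisible by
  t.\<close>

lemma saturated_ideal_principal:
  fixes I :: "'k::field fps fps set"
  assumes add: "\<And>f g. f \<in> I \<Longrightarrow> g \<in> I \<Longrightarrow> f + g \<in> I"
    and mult: "\<And>f g. g \<in> I \<Longrightarrow> f * g \<in> I"
    and sat: "\<And>w. var_s * w \<in> I \<Longrightarrow> var_t * w \<in> I \<Longrightarrow> w \<in> I"
    and nz: "f0 \<in> I" "f0 \<noteq> 0"
  shows "\<exists>f\<in>I. f \<noteq> 0 \<and> (\<forall>g\<in>I. f dvd g)"
proof -
  obtain f1 where f1: "f1 \<in> I" "f1 \<noteq> 0"
    and min: "\<And>g. g \<in> I \<Longrightarrow> g \<noteq> 0 \<Longrightarrow> subdegree f1 \<le> subdegree g"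
    using ex_has_least_nat[of "\<lambda>f. f \<in> I \<and> f \<noteq> 0" f0 subdegree] nz by auto
  define n where "n = subdegree f1"
  have dec: "g = var_t ^ n * fps_shift n g" if "g \<in> I" for g
  proof (cases "g = 0")
    case False
    then have "n \<le> subdegree g"
      using min[OF that] by (simp add: n_def)
    then show ?thesis
      by (metis fps_shift_times_fps_X_power mult.commute var_t_def)
  qed simp
  define I' where "I' = {w. var_t ^ n * w \<in> I}"
  have "\<exists>f\<in>I'. f \<noteq> 0 \<and> (\<forall>g\<in>I'. f dvd g)"
  proof (rule saturated_ideal_generated_mod_t)
    show "f + g \<in> I'" if "f \<in> I'" "g \<in> I'" for f g
      using that add by (simp add: I'_def distrib_left)
    show "f * g \<in> I'" if "g \<in> I'" for f g
      using that mult[of "var_t ^ n * g" f] by (simp add: I'_def ac_simps)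
    show "w \<in> I'" if "var_s * w \<in> I'" "var_t * w \<in> I'" for w
      using that sat[of "var_t ^ n * w"] by (simp add: I'_def ac_simps)
    show "fps_shift n f1 \<in> I'"
      using dec[OF f1(1)] f1(1) by (simp add: I'_def)
    have "fps_shift n f1 $ 0 \<noteq> 0"
      using f1(2) by (simp add: n_def)
    then show "set_t0 (fps_shift n f1) \<noteq> 0"
      by (simp add: set_t0_def)
  qed
  then obtain f where f: "f \<in> I'" "f \<noteq> 0" "\<And>g. g \<in> I' \<Longrightarrow> f dvd g"
    by blast
  have "var_t ^ n * f dvd g" if "g \<in> I" for g
  proof -
    have "fps_shift n g \<in> I'"
      using dec[OF that] that by (simp add: I'_def)
    then show ?thesis
      by (subst dec[OF that]) (intro mult_dvd_mono f(3) dvd_refl)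
  qed
  with f(1,2) show ?thesis
    by (intro bexI[of _ "var_t ^ n * f"]) (auto simp: I'_def)
qed

section \<open>Saturated submodules of the product of the planes\<close>

definition planes_submodule :: "'k::field planes set \<Rightarrow> bool"
  where "planes_submodule N \<longleftrightarrow> (\<forall>g\<in>N. \<forall>h\<in>N. g + h \<in> N) \<and> (\<forall>c\<in>fibre_prod. \<forall>g\<in>N. c * g \<in> N)"

definition saturated :: "'k::field planes set \<Rightarrow> bool"
  where "saturated N \<longleftrightarrow> (\<forall>w. (\<forall>i. axis_var i * w \<in> N) \<longrightarrow> w \<in> N)"

text \<open>Generation by \<open>e\<close> of the localization at the prime of the axis
  \<open>i\<close>: the condition on \<open>c\<close> says that the denominator lies outside this
  prime.\<close>

definition axis_generator :: "'k::field planes set \<Rightarrow> comp \<Rightarrow> 'k planes \<Rightarrow> bool"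
  where "axis_generator N i e \<longleftrightarrow> e \<in> N \<and> (\<forall>m\<in>N. \<exists>c\<in>fibre_prod. \<exists>d\<in>fibre_prod.
    set_t0 (c i) \<noteq> 0 \<and> c * m = d * e)"

definition single :: "comp \<Rightarrow> 'k::field fps fps \<Rightarrow> 'k planes"
  where "single i w = (\<lambda>j. if j = i then w else 0)"

text \<open>On each neighbouring plane the restriction to the common axis is continued independently
  of the other coordinate; the two remaining planes receive the constant coefficient. So every
  series on a plane acts on elements supported there.\<close>

lemma fibre_prod_extend: "\<exists>g\<in>fibre_prod. g i = (p :: 'k::field fps fps)"
proof
  let ?g = "\<lambda>j. if j = i then p else if j = next_comp i then fps_const (set_s0 p)
    else if j = prev_comp i then series_t (set_t0 p) else fps_const (fps_const (p $ 0 $ 0))"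
  have "set_t0 (?g j) = set_s0 (?g (prev_comp j))" for j
    by (cases i; cases j) simp_all
  then show "?g \<in> fibre_prod"
    unfolding fibre_prod_def by blast
qed simp

lemma planes_submodule_single:
  assumes "planes_submodule N" "single i w \<in> N"
  shows "single i (p * w) \<in> N"
proof -
  obtain g where g: "g \<in> fibre_prod" "g i = p"
    using fibre_prod_extend by blast
  then have "single i (p * w) = g * single i w"
    by (auto simp: single_def fun_eq_iff)
  then show ?thesis
    using assms g(1) by (simp add: planes_submodule_def)
qed

text \<open>The elements of \<open>N\<close> supported on one plane form a saturated ideal, with a
  generator \<open>f i\<close>. Multiplication by a corner moves any element of \<open>N\<close>
  into this ideal, hence the divisibility.\<close>

lemma saturated_corner_scaling:
  fixes N :: "'k::field planes set"
  assumes N: "planes_submodule N" "saturated N"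
    and nz: "\<And>i. \<exists>p. p \<noteq> 0 \<and> single i p \<in> N"
  shows "\<exists>f. (\<forall>i. f i \<noteq> 0 \<and> single i (f i) \<in> N) \<and> (\<forall>m\<in>N. \<exists>g. corner_scale * m = f * g)"
proof -
  obtain p where "single PV p \<in> N"
    using nz by blast
  then have "single PV (0 * p) \<in> N"
    by (rule planes_submodule_single[OF N(1)])
  also have "single PV (0 * p) = 0"
    by (simp add: single_def fun_eq_iff)
  finally have zero: "0 \<in> N" .
  have "\<exists>f\<in>{w. single i w \<in> N}. f \<noteq> 0 \<and> (\<forall>g\<in>{w. single i w \<in> N}. f dvd g)" for i
  proof -
    obtain f0 where f0: "f0 \<noteq> 0" "single i f0 \<in> N"
      using nz by blast
    show ?thesis
    proof (rule saturated_ideal_principal)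
      show "f + g \<in> {w. single i w \<in> N}" if "f \<in> {w. single i w \<in> N}" "g \<in> {w. single i w \<in> N}" for f g
      proof -
        have "single i (f + g) = single i f + single i g"
          by (auto simp: single_def)
        then show ?thesis
          using that N(1) by (simp add: planes_submodule_def)
      qed
      show "f * g \<in> {w. single i w \<in> N}" if "g \<in> {w. single i w \<in> N}" for f g
        using that planes_submodule_single[OF N(1)] by simp
      show "w \<in> {w. single i w \<in> N}"
        if w: "var_s * w \<in> {w. single i w \<in> N}" "var_t * w \<in> {w. single i w \<in> N}" for w
      proof -
        have "axis_var j * single i w \<in> N" for j
        proof -
          have "axis_var j * single i w = (if j = i then single i (var_s * w)
              else if i = prev_comp j then single i (var_t * w) else 0)"
            by (auto simp: axis_var_def single_def fun_eq_iff)
          then show ?thesis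
            using w zero by auto
        qed
        then show ?thesis
          using N(2) by (simp add: saturated_def)
      qed
    qed (use f0 in auto)
  qed
  then have "\<forall>i. \<exists>f. single i f \<in> N \<and> f \<noteq> 0 \<and> (\<forall>g. single i g \<in> N \<longrightarrow> f dvd g)"
    by blast
  from choice[OF this] obtain f where f: "\<And>i. single i (f i) \<in> N" "\<And>i. f i \<noteq> 0"
    "\<And>i g. single i g \<in> N \<Longrightarrow> f i dvd g"
    by blast
  have "\<exists>g. corner_scale * m = f * g" if m: "m \<in> N" for m
  proof -
    have "f i dvd var_s * var_t * m i" for i
    proof (rule f(3))
      have "single i (var_s * var_t * m i) = corner i * m"
        by (auto simp: single_def corner_def fun_eq_iff)
      then show "single i (var_s * var_t * m i) \<in> N"
        using m N(1) by (simp add: planes_submodule_def)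
    qed
    then have "\<forall>i. \<exists>g. var_s * var_t * m i = f i * g"
      by (simp add: dvd_def)
    from choice[OF this] obtain g where "\<And>i. var_s * var_t * m i = f i * g i"
      by blast
    then have "corner_scale * m = f * g"
      by (simp add: corner_scale_def fun_eq_iff)
    then show ?thesis
      by blast
  qed
  with f show ?thesis
    by blast
qed

text \<open>Multiplying by \<open>corner_scale\<close> and dividing by \<open>f\<close> is
  injective, commutes with scalars and sends \<open>single i (f i)\<close> to
  \<open>corner i\<close>.\<close>

lemma saturated_rescale:
  fixes N :: "'k::field planes set"
  assumes N: "planes_submodule N" "saturated N" and e: "\<And>i. \<exists>e. axis_generator N i e"
    and f: "\<And>i. f i \<noteq> 0 \<and> single i (f i) \<in> N" and g: "\<forall>m\<in>N. \<exists>g. corner_scale * m = f * g"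
  defines "N' \<equiv> {g. \<exists>m\<in>N. corner_scale * m = f * g}"
  shows "planes_submodule N'" "saturated N'" "\<And>i. \<exists>e. axis_generator N' i e" "\<And>i. corner i \<in> N'"
    "module_iso cusp_ring (planes_module N) (planes_module N')"
proof -
  have f_cancel: "f * g = f * h \<longleftrightarrow> g = h" for g h
    using f by (auto simp: fun_eq_iff)
  show "planes_submodule N'"
    unfolding planes_submodule_def
  proof (intro conjI ballI)
    fix g h assume "g \<in> N'" "h \<in> N'"
    then obtain m n where "m \<in> N" "n \<in> N" "corner_scale * m = f * g" "corner_scale * n = f * h"
      by (auto simp: N'_def)
    then show "g + h \<in> N'"
      using N(1) unfolding N'_def by (auto simp: planes_submodule_def distrib_left intro!: bexI[of _ "m + n"])
  next
    fix c g :: "'k planes" assume "c \<in> fibre_prod" "g \<in> N'"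
    moreover then obtain m where "m \<in> N" "corner_scale * m = f * g"
      by (auto simp: N'_def)
    ultimately show "c * g \<in> N'"
      using N(1) unfolding N'_def
      by (auto simp: planes_submodule_def mult.left_commute[of _ c] intro!: bexI[of _ "c * m"])
  qed
  show "saturated N'"
    unfolding saturated_def
  proof (intro allI impI)
    fix w assume w: "\<forall>i. axis_var i * w \<in> N'"
    then have "\<forall>i. \<exists>m. m \<in> N \<and> corner_scale * m = f * (axis_var i * w)"
      unfolding N'_def by blast
    from choice[OF this] obtain m where m: "\<And>i. m i \<in> N"
      "\<And>i. corner_scale * m i = f * (axis_var i * w)"
      by blast
    \<comment> \<open>The plane \<open>i\<close> carries two axis variables, \<open>s\<close> and
      \<open>t\<close>. Cancelling each of them in its equation shows that \<open>f i * w i\<close>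
      is divisible by the other.\<close>
    have "var_s * var_t dvd f i * w i" for i
    proof (rule var_s_var_t_dvd)
      have "var_s * var_t * m i i = f i * (var_s * w i)"
        using fun_cong[OF m(2)[of i], of i] by (simp add: corner_scale_def axis_var_def)
      then have "var_t * m i i = f i * w i"
        by (simp add: ac_simps)
      from arg_cong[OF this, of set_t0] show "set_t0 (f i * w i) = 0"
        by simp
      have "var_s * var_t * m (next_comp i) i = f i * (var_t * w i)"
        using fun_cong[OF m(2)[of "next_comp i"], of i] by (simp add: corner_scale_def axis_var_def)
      then have "var_s * m (next_comp i) i = f i * w i"
        by (simp add: ac_simps)
      from arg_cong[OF this, of set_s0] show "set_s0 (f i * w i) = 0"
        by simp
    qed
    then have "\<forall>i. \<exists>n. f i * w i = var_s * var_t * n"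
      by (simp add: dvd_def)
    from choice[OF this] obtain n where "\<And>i. f i * w i = var_s * var_t * n i"
      by blast
    then have n: "corner_scale * n = f * w"
      by (simp add: corner_scale_def fun_eq_iff)
    have "corner_scale * (axis_var i * n) = corner_scale * m i" for i
      by (simp add: m(2) mult.left_commute[of corner_scale] n mult.left_commute[of f])
    then have "axis_var i * n \<in> N" for i
      using m(1) by (simp add: corner_scale_cancel)
    then have "n \<in> N"
      using N(2) by (simp add: saturated_def)
    with n show "w \<in> N'"
      by (auto simp: N'_def)
  qed
  show "\<exists>e. axis_generator N' i e" for i
  proof -
    obtain e where e: "axis_generator N i e"
      using assms(3) by blast
    then obtain e' where e': "corner_scale * e = f * e'"
      using g by (auto simp: axis_generator_def)
    have "axis_generator N' i e'"
      unfolding axis_generator_def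
    proof (intro conjI ballI)
      show "e' \<in> N'"
        using e e' by (auto simp: N'_def axis_generator_def)
      fix h assume "h \<in> N'"
      then obtain m where m: "m \<in> N" "corner_scale * m = f * h"
        by (auto simp: N'_def)
      obtain c d where cd: "c \<in> fibre_prod" "d \<in> fibre_prod" "set_t0 (c i) \<noteq> 0" "c * m = d * e"
        using e m(1) unfolding axis_generator_def by blast
      have "f * (c * h) = c * (corner_scale * m)"
        by (simp add: m ac_simps)
      also have "\<dots> = d * (corner_scale * e)"
        by (simp add: mult.left_commute[of _ corner_scale] cd)
      also have "\<dots> = f * (d * e')"
        by (simp add: e' ac_simps)
      finally have "c * h = d * e'"
        by (simp add: f_cancel)
      with cd show "\<exists>c\<in>fibre_prod. \<exists>d\<in>fibre_prod. set_t0 (c i) \<noteq> 0 \<and> c * h = d * e'"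
        by blast
    qed
    then show ?thesis
      by blast
  qed
  show "corner i \<in> N'" for i
  proof -
    have "corner_scale * single i (f i) = f * corner i"
      by (auto simp: fun_eq_iff corner_scale_def single_def corner_def ac_simps)
    then show ?thesis
      using f[of i] by (auto simp: N'_def)
  qed
  from bchoice[OF g] obtain \<phi> where \<phi>: "\<And>m. m \<in> N \<Longrightarrow> corner_scale * m = f * \<phi> m"
    by blast
  have "\<phi> \<in> module_hom cusp_ring (planes_module N) (planes_module N')"
    unfolding module_hom_def
  proof (clarsimp, intro conjI ballI)
    show "\<phi> \<in> N \<rightarrow> N'"
      using \<phi> by (auto simp: N'_def)
    fix m n assume mn: "m \<in> N" "n \<in> N"
    then have "m + n \<in> N"
      using N(1) by (simp add: planes_submodule_def)
    from \<phi>[OF this] have "f * \<phi> (m + n) = f * (\<phi> m + \<phi> n)"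
      by (simp add: distrib_left \<phi>[OF mn(1), symmetric] \<phi>[OF mn(2), symmetric])
    then show "\<phi> (m + n) = \<phi> m + \<phi> n"
      by (simp only: f_cancel)
  next
    fix r :: "'k pow5 set" and m assume r: "r \<in> carrier cusp_ring" and m: "m \<in> N"
    then have "planes_of r * m \<in> N"
      using N(1) by (simp add: planes_submodule_def)
    from \<phi>[OF this] have "f * \<phi> (planes_of r * m) = f * (planes_of r * \<phi> m)"
      by (simp add: mult.left_commute[of _ "planes_of r"] \<phi>[OF m, symmetric])
    then show "\<phi> (planes_of r * m) = planes_of r * \<phi> m"
      by (simp only: f_cancel)
  qed
  moreover have "inj_on \<phi> N"
    by (rule inj_onI) (metis \<phi> corner_scale_cancel)
  moreover have "\<phi> ` N = N'"
    unfolding N'_def using \<phi> f_cancel by (auto simp: image_iff)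
  ultimately show "module_iso cusp_ring (planes_module N) (planes_module N')"
    by (auto simp: module_iso_def bij_betw_def)
qed

text \<open>Induction on the sum of the exponents. If all are positive, each product
  \<open>axis_var j * w\<close> satisfies the hypothesis with one exponent lowered; a zero exponent
  is the claim itself.\<close>

lemma saturated_powers:
  fixes N :: "'k::field planes set" and k :: "comp \<Rightarrow> nat"
  assumes N: "planes_submodule N" "saturated N" and "\<And>i. axis_var i ^ k i * w \<in> N"
  shows "w \<in> N"
  using assms(3)
proof (induction "k PV + k PX + k PY + k PZ + k PU" arbitrary: k w rule: less_induct)
  case less
  show ?case
  proof (cases "\<exists>i. k i = 0")
    case True
    then obtain i where "k i = 0"
      by blast
    then show ?thesis
      using less.prems[of i] by simp
  next
    case False
    have "axis_var j * w \<in> N" for j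
    proof (rule less.hyps)
      let ?k = "k(j := k j - 1)"
      have "k j > 0"
        using False by simp
      then show "?k PV + ?k PX + ?k PY + ?k PZ + ?k PU < k PV + k PX + k PY + k PZ + k PU"
        by (cases j) simp_all
      show "axis_var i ^ ?k i * (axis_var j * w) \<in> N" for i
      proof (cases "i = j")
        case True
        then show ?thesis
          using less.prems[of j] \<open>k j > 0\<close> by (cases "k j") (simp_all add: ac_simps)
      next
        case False
        then show ?thesis
          using less.prems[of i] N(1) by (simp add: planes_submodule_def mult.left_commute[of _ "axis_var j"])
      qed
    qed
    then show ?thesis
      using N(2) by (simp add: saturated_def)
  qed
qed

lemma fibre_prod_set_s0: "c \<in> fibre_prod \<Longrightarrow> set_s0 (c (prev_comp i)) = set_t0 (c i)"
  using fibre_prodD[of c i] by simp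

text \<open>If \<open>e\<close> vanished on one side of the axis then the corner on that side would not be locally
  generated by \<open>e\<close>.\<close>

lemma axis_generator_nonzero:
  assumes corner: "\<And>i. corner i \<in> N" and e: "axis_generator N i e"
  shows "set_t0 (e i) \<noteq> 0" "set_s0 (e (prev_comp i)) \<noteq> 0"
proof -
  let ?j = "prev_comp i"
  obtain c d where cd: "c \<in> fibre_prod" "d \<in> fibre_prod" "set_t0 (c i) \<noteq> 0" "c * corner i = d * e"
    using e corner[of i] unfolding axis_generator_def by blast
  obtain c' d' where cd': "c' \<in> fibre_prod" "d' \<in> fibre_prod" "set_t0 (c' i) \<noteq> 0" "c' * corner ?j = d' * e"
    using e corner[of ?j] unfolding axis_generator_def by blast
  have 1: "c i * (var_s * var_t) = d i * e i" "d ?j * e ?j = 0"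
    using fun_cong[OF cd(4), of i] fun_cong[OF cd(4), of ?j] by (simp_all add: corner_def)
  have 2: "c' ?j * (var_s * var_t) = d' ?j * e ?j" "d' i * e i = 0"
    using fun_cong[OF cd'(4), of i] fun_cong[OF cd'(4), of ?j] by (simp_all add: corner_def)
  have "c' ?j \<noteq> 0" "c i \<noteq> 0"
    using cd(3) cd'(3) fibre_prod_set_s0[OF cd'(1), of i] by auto
  with 1(1) 2(1) have "e ?j \<noteq> 0" "e i \<noteq> 0"
    by auto
  \<comment> \<open>A scalar that vanishes on one of the two planes vanishes on their common axis by
    gluing. So the remaining component of \<open>d\<close> and of \<open>d'\<close> has a coordinate
    to cancel against the corner.\<close>
  with 1(2) 2(2) have "d ?j = 0" "d' i = 0"
    by auto
  then have "set_t0 (d i) = 0" "set_s0 (d' ?j) = 0"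
    using fibre_prod_set_s0[OF cd(2), of i] fibre_prod_set_s0[OF cd'(2), of i] by simp_all
  then obtain p p' where p: "d i = var_t * p" "d' ?j = var_s * p'"
    unfolding var_t_dvd_iff[symmetric] var_s_dvd_iff[symmetric] by (elim dvdE)
  show "set_t0 (e i) \<noteq> 0"
  proof
    have "c i * var_s = p * e i"
      using 1(1) p(1) by (simp add: ac_simps)
    moreover assume "set_t0 (e i) = 0"
    ultimately have "set_t0 (c i * var_s) = 0"
      by simp
    then show False
      using cd(3) by simp
  qed
  show "set_s0 (e ?j) \<noteq> 0"
  proof
    have "c' ?j * var_t = p' * e ?j"
      using 2(1) p(2) by (simp add: ac_simps)
    moreover assume "set_s0 (e ?j) = 0"
    ultimately have "set_s0 (c' ?j * var_t) = 0"
      by simp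
    then show False
      using cd'(3) fibre_prod_set_s0[OF cd'(1), of i] by simp
  qed
qed

text \<open>Restricting a local relation \<open>c * m = d * e i\<close> to the axis from both sides
  gives the gluing condition. Conversely, near each axis a section is a multiple of
  \<open>e i\<close> up to corners, after multiplication by a power of the variable; saturation
  removes these powers.\<close>

lemma saturated_eq_glued:
  fixes N :: "'k::field planes set"
  assumes N: "planes_submodule N" "saturated N" and corner: "\<And>i. corner i \<in> N"
    and e: "\<And>i. axis_generator N i (e i)"
  shows "N = glued (\<lambda>i. set_t0 (e i i)) (\<lambda>i. set_s0 (e i (prev_comp i)))"
proof
  define a where "a = (\<lambda>i. set_t0 (e i i))"
  define b where "b = (\<lambda>i. set_s0 (e i (prev_comp i)))"
  have nz: "a i \<noteq> 0" "b i \<noteq> 0" for i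
    using axis_generator_nonzero[OF corner e] by (simp_all add: a_def b_def)
  have e_in: "e i \<in> N" for i
    using e by (simp add: axis_generator_def)
  have add: "m + n \<in> N" if "m \<in> N" "n \<in> N" for m n
    using that N(1) by (simp add: planes_submodule_def)
  have mult: "c * m \<in> N" if "c \<in> fibre_prod" "m \<in> N" for c m
    using that N(1) by (simp add: planes_submodule_def)
  show "N \<subseteq> glued a b"
  proof (rule subsetI, rule gluedI)
    fix m i assume "m \<in> N"
    then obtain c d where cd: "c \<in> fibre_prod" "d \<in> fibre_prod" "set_t0 (c i) \<noteq> 0" "c * m = d * e i"
      using e[of i] unfolding axis_generator_def by blast
    have 1: "set_t0 (c i) * set_t0 (m i) = set_t0 (d i) * a i"
      using arg_cong[OF fun_cong[OF cd(4), of i], of set_t0] by (simp add: a_def)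
    have 2: "set_t0 (c i) * set_s0 (m (prev_comp i)) = set_t0 (d i) * b i"
      using arg_cong[OF fun_cong[OF cd(4), of "prev_comp i"], of set_s0]
      by (simp add: b_def fibre_prod_set_s0 cd(1,2))
    have "set_t0 (c i) * (b i * set_t0 (m i)) = b i * (set_t0 (d i) * a i)"
      unfolding 1[symmetric] by (rule mult.left_commute)
    also have "\<dots> = a i * (set_t0 (d i) * b i)"
      by (simp add: ac_simps)
    also have "\<dots> = set_t0 (c i) * (a i * set_s0 (m (prev_comp i)))"
      unfolding 2[symmetric] by (rule mult.left_commute)
    finally show "b i * set_t0 (m i) = a i * set_s0 (m (prev_comp i))"
      using cd(3) by simp
  qed
  show "glued a b \<subseteq> N"
  proof
    fix w assume w: "w \<in> glued a b"
    have "\<exists>k. axis_var i ^ k * w \<in> N" for i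
    proof -
      let ?j = "prev_comp i"
      \<comment> \<open>The power of the variable that \<open>a i\<close> divides: h is the
        restriction of \<open>w\<close> times X^n, divided by \<open>a i\<close>.\<close>
      define n where "n = subdegree (a i)"
      define q where "q = fps_shift n (a i)"
      have aq: "a i = q * fps_X ^ n"
        unfolding q_def n_def by (rule subdegree_decompose)
      have qq: "q * inverse q = 1"
        using nth_subdegree_nonzero[OF nz(1), of i] by (intro inverse_mult_eq_1') (simp add: q_def n_def)
      define h where "h = set_t0 (w i) * inverse q"
      have h1: "h * a i = fps_X ^ n * set_t0 (w i)"
      proof -
        have "h * a i = set_t0 (w i) * (q * inverse q) * fps_X ^ n"
          by (subst aq) (simp add: h_def ac_simps)
        then show ?thesis
          by (simp add: qq mult.commute)
      qed
      have h2: "h * b i = fps_X ^ n * set_s0 (w ?j)"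
      proof -
        have "a i * (h * b i) = b i * (fps_X ^ n * set_t0 (w i))"
          by (simp add: h1[symmetric] ac_simps)
        also have "\<dots> = fps_X ^ n * (b i * set_t0 (w i))"
          by (simp add: ac_simps)
        also have "\<dots> = a i * (fps_X ^ n * set_s0 (w ?j))"
          by (simp add: gluedD[OF w] ac_simps)
        finally show ?thesis
          using nz by simp
      qed
      \<comment> \<open>The additional factor X, matched by \<open>Suc n\<close> below, makes
        \<open>H\<close> vanish at the origin, so that it extends by zero to the other
        planes.\<close>
      define H where "H = edge (\<lambda>_. fps_X * h) (\<lambda>_. fps_X * h) i"
      have H: "H \<in> fibre_prod"
        unfolding fibre_prod_eq_glued by (rule gluedI) (simp add: H_def edge_def)
      define v where "v = axis_var i ^ Suc n * w - H * e i"
      have v0: "v l = 0" if "l \<noteq> i" "l \<noteq> ?j" for l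
        using that by (simp add: v_def H_def edge_def axis_var_def)
      \<comment> \<open>The difference vanishes on the common axis by the choice of
        \<open>h\<close>, and on the outer axes by the additional factor; hence it is a combination
        of two corners.\<close>
      have "set_t0 (v i) = 0" "set_s0 (v i) = 0"
        using h1 by (simp_all add: v_def H_def edge_def axis_var_def a_def mult.assoc)
      then have 1: "var_s * var_t dvd v i"
        by (intro var_s_var_t_dvd)
      have "set_t0 (v ?j) = 0" "set_s0 (v ?j) = 0"
        using h2 by (simp_all add: v_def H_def edge_def axis_var_def b_def mult.assoc)
      then have 2: "var_s * var_t dvd v ?j"
        by (intro var_s_var_t_dvd)
      obtain p1 p2 where p: "v i = var_s * var_t * p1" "v ?j = var_s * var_t * p2"
        using 1 2 by (elim dvdE)
      obtain c1 c2 where c: "c1 \<in> fibre_prod" "c1 i = p1" "c2 \<in> fibre_prod" "c2 ?j = p2"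
        using fibre_prod_extend[of i p1] fibre_prod_extend[of ?j p2] by blast
      have "v = c1 * corner i + c2 * corner ?j"
      proof
        fix l show "v l = (c1 * corner i + c2 * corner ?j) l"
          using v0[of l] p c by (auto simp: corner_def)
      qed
      then have "v \<in> N"
        using c corner by (simp add: add mult)
      moreover have "axis_var i ^ Suc n * w = v + H * e i"
        by (simp add: v_def fun_eq_iff)
      ultimately show ?thesis
        using add[OF _ mult[OF H e_in], of v] by metis
    qed
    then have "\<forall>i. \<exists>k. axis_var i ^ k * w \<in> N"
      by blast
    from choice[OF this] obtain k where "\<And>i. axis_var i ^ k i * w \<in> N"
      by blast
    then show "w \<in> N"
      by (rule saturated_powers[OF N])
  qed
qed

section \<open>Normal form of the transition functions\<close>

lemma fps_X_power_mult_eq_iff: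
  assumes "l + m = k + n"
  shows "fps_X ^ l * p = fps_X ^ k * q \<longleftrightarrow> fps_X ^ n * p = fps_X ^ m * (q :: 'k::field fps)"
proof -
  have *: "fps_X ^ n * p = fps_X ^ m * q"
    if "fps_X ^ l * p = fps_X ^ k * q" "l + m = k + n" for l m k n and p q :: "'k fps"
  proof -
    have "fps_X ^ k * (fps_X ^ n * p) = fps_X ^ m * (fps_X ^ l * p)"
      using that(2) by (simp add: power_add[symmetric] mult.assoc[symmetric] add.commute)
    also have "\<dots> = fps_X ^ k * (fps_X ^ m * q)"
      unfolding that(1) by (rule mult.left_commute)
    finally show ?thesis
      by simp
  qed
  show ?thesis
  proof
    assume "fps_X ^ l * p = fps_X ^ k * q"
    then show "fps_X ^ n * p = fps_X ^ m * q"
      using assms by (rule *)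
  next
    assume "fps_X ^ n * p = fps_X ^ m * q"
    then show "fps_X ^ l * p = fps_X ^ k * q"
      by (rule *) (use assms in simp)
  qed
qed

lemma fps2_unit: "F $ 0 $ 0 \<noteq> 0 \<Longrightarrow> \<exists>G. F * G = (1 :: 'k::field fps fps)"
  using fps_dvd_1I[of F] fps_dvd_1I[of "F $ 0"] by (metis dvdE dvd_field_iff)

text \<open>Units on the planes change the transition function on an axis by the quotient of their
  restrictions to it. Suitable restrictions absorb \<open>A\<close> and \<open>B\<close>, the unit
  parts of \<open>a\<close> and \<open>b\<close>, up to one constant.\<close>

lemma glued_normalize:
  fixes a b :: "comp \<Rightarrow> 'k::field fps"
  assumes nz: "\<And>i. a i \<noteq> 0" "\<And>i. b i \<noteq> 0"
  shows "\<exists>w c. normalized_weight w \<and> c \<noteq> 0 \<and>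
    module_iso cusp_ring (planes_module (glued a b)) (planes_module (glued (glue1 w) (glue2 w c)))"
proof -
  define k where "k i = subdegree (a i)" for i
  define l where "l i = subdegree (b i)" for i
  define A where "A i = fps_shift (k i) (a i)" for i
  define B where "B i = fps_shift (l i) (b i)" for i
  have a: "a i = fps_X ^ k i * A i" and b: "b i = fps_X ^ l i * B i" for i
    unfolding A_def k_def B_def l_def by (metis mult.commute subdegree_decompose)+
  have A0: "A i $ 0 \<noteq> 0" and B0: "B i $ 0 \<noteq> 0" for i
    using nth_subdegree_nonzero[OF nz(1), of i] nth_subdegree_nonzero[OF nz(2), of i]
    by (simp_all add: A_def k_def B_def l_def)
  \<comment> \<open>The restrictions \<sigma> B and \<tau> A of a unit must agree at the origin of
    its plane, which forces \<tau> to be \<sigma> times this ratio. Choosing \<sigma> along the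
    chain from \<open>PV\<close> cancels the constants on four axes; on the v-axis the product
    \<open>c\<close> of all ratios remains.\<close>
  define r where "r i = B i $ 0 / A (next_comp i) $ 0" for i
  have r0: "r i \<noteq> 0" for i
    by (simp add: r_def A0 B0)
  define \<sigma> where "\<sigma> i = (case i of PV \<Rightarrow> 1 | PX \<Rightarrow> r PV | PY \<Rightarrow> r PV * r PX
    | PZ \<Rightarrow> r PV * r PX * r PY | PU \<Rightarrow> r PV * r PX * r PY * r PZ)" for i
  define c where "c = r PV * r PX * r PY * r PZ * r PU"
  define \<tau> where "\<tau> i = \<sigma> i * r i" for i
  have \<sigma>0: "\<sigma> i \<noteq> 0" for i
    by (cases i) (simp_all add: \<sigma>_def r0)
  have \<sigma>\<tau>: "(if i = PV then c else 1) * \<sigma> i = \<tau> (prev_comp i)" for i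
    by (cases i) (simp_all add: \<sigma>_def \<tau>_def c_def)
  \<comment> \<open>Both orders are shifted by the same integer, which keeps their difference and
    makes the smaller one 1.\<close>
  define w1 where "w1 i = 1 - min (int (k i)) (int (l i)) + int (k i)" for i
  define w2 where "w2 i = 1 - min (int (k i)) (int (l i)) + int (l i)" for i
  define w where "w = ((w1 PV, w2 PV), (w1 PX, w2 PX), (w1 PY, w2 PY), (w1 PZ, w2 PZ), (w1 PU, w2 PU))"
  have w12: "weight1 w i = w1 i" "weight2 w i = w2 i" for i
    by (cases i; simp add: w_def)+
  have w: "normalized_weight w"
    by (simp add: normalized_weight_iff w12 w1_def w2_def min_def)
  have sum: "l i + nat (weight1 w i) = k i + nat (weight2 w i)" for i
    by (simp add: w12 w1_def w2_def min_def) arith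
  \<comment> \<open>The series with prescribed restrictions to the two axes: their sum minus the
    common constant coefficient.\<close>
  define U where "U i = fps_const (fps_const (\<sigma> i)) * fps_const (B i)
    + fps_const (fps_const (\<tau> i)) * series_t (A (next_comp i))
    - fps_const (fps_const (\<sigma> i * B i $ 0))" for i
  have \<tau>: "\<tau> i * A (next_comp i) $ 0 = \<sigma> i * B i $ 0" for i
    by (simp add: \<tau>_def r_def A0)
  have U_t0: "set_t0 (U i) = fps_const (\<sigma> i) * B i" for i
    using \<tau>[of i] by (simp add: U_def mult.commute)
  have U_s0: "set_s0 (U i) = fps_const (\<tau> i) * A (next_comp i)" for i
    by (simp add: U_def)
  have "U i $ 0 $ 0 \<noteq> 0" for i
    using arg_cong[OF U_t0[of i], of "\<lambda>F. F $ 0"] \<sigma>0[of i] B0[of i] by simp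
  then have "\<forall>i. \<exists>V. U i * V = 1"
    using fps2_unit by blast
  from choice[OF this] obtain V where V: "\<And>i. U i * V i = 1"
    by blast
  have UV: "U * V = 1"
    by (simp add: fun_eq_iff V)
  have iff: "g \<in> glued a b \<longleftrightarrow> U * g \<in> glued (glue1 w) (glue2 w c)" for g
  proof -
    have "b i * set_t0 (g i) = a i * set_s0 (g (prev_comp i)) \<longleftrightarrow>
      glue2 w c i * set_t0 ((U * g) i) = glue1 w i * set_s0 ((U * g) (prev_comp i))" for i
    proof -
      let ?P = "B i * set_t0 (g i)" and ?Q = "A i * set_s0 (g (prev_comp i))"
      let ?m = "nat (weight1 w i)" and ?n = "nat (weight2 w i)"
      have \<tau>0: "fps_const (\<tau> (prev_comp i)) \<noteq> 0"
        by (simp add: \<tau>_def \<sigma>0 r0)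
      have 1: "fps_const (\<tau> (prev_comp i)) = (if i = PV then fps_const c else 1) * fps_const (\<sigma> i)"
        by (subst \<sigma>\<tau>[symmetric]) simp
      have "b i * set_t0 (g i) = a i * set_s0 (g (prev_comp i)) \<longleftrightarrow>
        fps_X ^ l i * ?P = fps_X ^ k i * ?Q"
        by (simp add: a b mult.assoc)
      also have "\<dots> \<longleftrightarrow> fps_X ^ ?n * ?P = fps_X ^ ?m * ?Q"
        by (rule fps_X_power_mult_eq_iff) (rule sum)
      also have "\<dots> \<longleftrightarrow> fps_const (\<tau> (prev_comp i)) * (fps_X ^ ?n * ?P) =
          fps_const (\<tau> (prev_comp i)) * (fps_X ^ ?m * ?Q)"
        using \<tau>0 by simp
      also have "fps_const (\<tau> (prev_comp i)) * (fps_X ^ ?n * ?P) = glue2 w c i * set_t0 ((U * g) i)"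
        unfolding 1 by (simp add: glue2_def U_t0 mult_ac del: fps_const_mult)
      also have "fps_const (\<tau> (prev_comp i)) * (fps_X ^ ?m * ?Q) = glue1 w i * set_s0 ((U * g) (prev_comp i))"
        by (simp add: glue1_def U_s0 mult_ac)
      finally show ?thesis .
    qed
    then show ?thesis
      by (simp add: glued_def)
  qed
  have "(*) U \<in> module_hom cusp_ring (planes_module (glued a b)) (planes_module (glued (glue1 w) (glue2 w c)))"
    by (simp add: module_hom_def iff distrib_left mult.left_commute)
  moreover have "bij_betw ((*) U) (glued a b) (glued (glue1 w) (glue2 w c))"
  proof (rule bij_betwI[where g = "(*) V"])
    have *: "U * (V * g) = g" "V * (U * g) = g" for g
      using UV by (simp_all only: mult.assoc[symmetric] mult.commute[of V U] mult_1_left)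
    show "(*) U \<in> glued a b \<rightarrow> glued (glue1 w) (glue2 w c)"
      "(*) V \<in> glued (glue1 w) (glue2 w c) \<rightarrow> glued a b"
      by (auto simp: iff *)
    show "V * (U * g) = g" "U * (V * g) = g" for g
      by (simp_all add: *)
  qed
  ultimately have "module_iso cusp_ring (planes_module (glued a b)) (planes_module (glued (glue1 w) (glue2 w c)))"
    by (auto simp: module_iso_def)
  moreover have "c \<noteq> 0"
    by (simp add: c_def r0)
  ultimately show ?thesis
    using w by blast
qed

lemma saturated_classification:
  fixes N :: "'k::field planes set"
  assumes N: "planes_submodule N" "saturated N" and e: "\<And>i. \<exists>e. axis_generator N i e"
    and nz: "\<And>i. \<exists>p. p \<noteq> 0 \<and> single i p \<in> N"
  shows "\<exists>w c. normalized_weight w \<and> c \<noteq> 0 \<and>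
    module_iso cusp_ring (planes_module N) (planes_module (glued (glue1 w) (glue2 w c)))"
proof -
  obtain f where f: "\<And>i. f i \<noteq> 0 \<and> single i (f i) \<in> N"
    "\<forall>m\<in>N. \<exists>g. corner_scale * m = f * g"
    using saturated_corner_scaling[OF N nz] by blast
  define N' where "N' = {g. \<exists>m\<in>N. corner_scale * m = f * g}"
  note N' = saturated_rescale[OF N e f, folded N'_def]
  have "\<forall>i. \<exists>e. axis_generator N' i e"
    using N'(3) by blast
  from choice[OF this] obtain e' where e': "\<And>i. axis_generator N' i (e' i)"
    by blast
  obtain w c where "normalized_weight w" "c \<noteq> 0" "module_iso cusp_ring (planes_module N')
    (planes_module (glued (glue1 w) (glue2 w c)))"
    using glued_normalize[of "\<lambda>i. set_t0 (e' i i)" "\<lambda>i. set_s0 (e' i (prev_comp i))"]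
      axis_generator_nonzero[OF N'(4) e'] saturated_eq_glued[OF N'(1,2,4) e'] by auto
  then show ?thesis
    using module_iso_trans[OF N'(5)] by blast
qed

section \<open>Localization at a prime ideal\<close>

lemma module_regular_module: "cring R \<Longrightarrow> Module.module R (regular_module R)"
proof -
  assume "cring R"
  then interpret cring R .
  have "abelian_group (regular_module R)"
    by (rule abelian_groupI)
      (auto simp: regular_module_def a_ac intro: l_neg a_inv_closed)
  then show ?thesis
    by (intro moduleI) (auto simp: regular_module_def l_distr r_distr m_assoc is_cring)
qed

locale module_at_prime = Module.module R M for R and M (structure) +
  fixes P
  assumes prime: "primeideal P R"
begin

abbreviation "S \<equiv> carrier R - P"
abbreviation "fraction \<equiv> loc_frac R P M"

lemma S_one [simp]: "\<one>\<^bsub>R\<^esub> \<in> S"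
  using primeideal.I_notcarr[OF prime] ideal.one_imp_carrier[OF primeideal.axioms(1)[OF prime]]
  by auto

lemma S_mult: "s \<in> S \<Longrightarrow> t \<in> S \<Longrightarrow> s \<otimes>\<^bsub>R\<^esub> t \<in> S"
  using primeideal.I_prime[OF prime] by auto

lemma smult_left_commute:
  "r \<in> carrier R \<Longrightarrow> s \<in> carrier R \<Longrightarrow> a \<in> carrier M \<Longrightarrow> r \<odot>\<^bsub>M\<^esub> (s \<odot>\<^bsub>M\<^esub> a) = s \<odot>\<^bsub>M\<^esub> (r \<odot>\<^bsub>M\<^esub> a)"
  by (simp add: smult_assoc1[symmetric] R.m_comm)

lemma equiv_loc_rel: "equiv (carrier M \<times> S) (loc_rel R P M)"
proof (rule equivI)
  show "loc_rel R P M \<subseteq> (carrier M \<times> S) \<times> (carrier M \<times> S)"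
    by (auto simp: loc_rel_def)
  show "refl_on (carrier M \<times> S) (loc_rel R P M)"
    using S_one by (auto simp: refl_on_def loc_rel_def)
  show "sym (loc_rel R P M)"
  proof (rule symI)
    fix x y assume "(x, y) \<in> loc_rel R P M"
    then obtain a s b t w where "x = (a, s)" "a \<in> carrier M" "s \<in> S" "y = (b, t)" "b \<in> carrier M" "t \<in> S"
      "w \<in> S" "w \<odot>\<^bsub>M\<^esub> (s \<odot>\<^bsub>M\<^esub> b) = w \<odot>\<^bsub>M\<^esub> (t \<odot>\<^bsub>M\<^esub> a)"
      unfolding loc_rel_def by (auto dest: sym)
    then show "(y, x) \<in> loc_rel R P M"
      unfolding loc_rel_def by blast
  qed
  show "trans (loc_rel R P M)"
  proof (rule transI)
    fix x y z assume "(x, y) \<in> loc_rel R P M" "(y, z) \<in> loc_rel R P M"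
    then obtain a s b t c u w w' where x: "x = (a, s)" "a \<in> carrier M" "s \<in> S"
      and y: "b \<in> carrier M" "t \<in> S" and z: "z = (c, u)" "c \<in> carrier M" "u \<in> S"
      and w: "w \<in> S" "w \<odot>\<^bsub>M\<^esub> (t \<odot>\<^bsub>M\<^esub> a) = w \<odot>\<^bsub>M\<^esub> (s \<odot>\<^bsub>M\<^esub> b)"
      and w': "w' \<in> S" "w' \<odot>\<^bsub>M\<^esub> (u \<odot>\<^bsub>M\<^esub> b) = w' \<odot>\<^bsub>M\<^esub> (t \<odot>\<^bsub>M\<^esub> c)"
      unfolding loc_rel_def by blast
    note carr = x y z w(1) w'(1)
    \<comment> \<open>Besides both witnesses, the denominator \<open>t\<close> of the middle
      fraction enters the new witness.\<close>
    have "(w \<otimes>\<^bsub>R\<^esub> w' \<otimes>\<^bsub>R\<^esub> t) \<odot>\<^bsub>M\<^esub> (u \<odot>\<^bsub>M\<^esub> a) = (u \<otimes>\<^bsub>R\<^esub> w') \<odot>\<^bsub>M\<^esub> (w \<odot>\<^bsub>M\<^esub> (t \<odot>\<^bsub>M\<^esub> a))"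
      using carr by (simp add: smult_assoc1[symmetric] R.m_ac)
    also have "\<dots> = (s \<otimes>\<^bsub>R\<^esub> w) \<odot>\<^bsub>M\<^esub> (w' \<odot>\<^bsub>M\<^esub> (u \<odot>\<^bsub>M\<^esub> b))"
      using carr by (simp add: w(2)) (simp add: smult_assoc1[symmetric] R.m_ac)
    also have "\<dots> = (w \<otimes>\<^bsub>R\<^esub> w' \<otimes>\<^bsub>R\<^esub> t) \<odot>\<^bsub>M\<^esub> (s \<odot>\<^bsub>M\<^esub> c)"
      using carr by (simp add: w'(2)) (simp add: smult_assoc1[symmetric] R.m_ac)
    finally show "(x, z) \<in> loc_rel R P M"
      using S_mult[OF S_mult[OF w(1) w'(1)] y(2)] x z by (auto simp: loc_rel_def)
  qed
qed

lemma frac_eq_iff: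
  assumes "a \<in> carrier M" "s \<in> S" "b \<in> carrier M" "t \<in> S"
  shows "fraction a s = fraction b t \<longleftrightarrow> (\<exists>w\<in>S. w \<odot>\<^bsub>M\<^esub> (t \<odot>\<^bsub>M\<^esub> a) = w \<odot>\<^bsub>M\<^esub> (s \<odot>\<^bsub>M\<^esub> b))"
  unfolding loc_frac_def
  using eq_equiv_class_iff[OF equiv_loc_rel, of "(a, s)" "(b, t)"] assms by (auto simp: loc_rel_def)

lemma frac_self: "a \<in> carrier M \<Longrightarrow> s \<in> S \<Longrightarrow> (a, s) \<in> fraction a s"
  unfolding loc_frac_def by (rule equiv_class_self[OF equiv_loc_rel]) simp

lemma frac_memD:
  assumes "(b, t) \<in> fraction a s" "a \<in> carrier M" "s \<in> S"
  shows "b \<in> carrier M" "t \<in> S" "\<exists>w\<in>S. w \<odot>\<^bsub>M\<^esub> (t \<odot>\<^bsub>M\<^esub> a) = w \<odot>\<^bsub>M\<^esub> (s \<odot>\<^bsub>M\<^esub> b)"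
  using assms by (auto simp: loc_frac_def loc_rel_def)

lemma frac_eqI:
  assumes "a \<in> carrier M" "s \<in> S" "b \<in> carrier M" "t \<in> S" "t \<odot>\<^bsub>M\<^esub> a = s \<odot>\<^bsub>M\<^esub> b"
  shows "fraction a s = fraction b t"
  using assms S_one by (auto simp: frac_eq_iff)

lemma carrier_loc_module: "carrier (loc_module R P M) = {fraction a s | a s. a \<in> carrier M \<and> s \<in> S}"
  by (auto simp: loc_module_def loc_carrier_def quotient_def loc_frac_def)

text \<open>The union in \<open>loc_add\<close> has equal members, by multiplying the witnesses of
  the two equalities of fractions, and \<open>frac_self\<close> makes it nonempty.\<close>

lemma loc_add_frac:
  assumes "a \<in> carrier M" "s \<in> S" "b \<in> carrier M" "t \<in> S"
  shows "loc_add R P M (fraction a s) (fraction b t) = fraction (t \<odot>\<^bsub>M\<^esub> a \<oplus>\<^bsub>M\<^esub> s \<odot>\<^bsub>M\<^esub> b) (s \<otimes>\<^bsub>R\<^esub> t)"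
proof -
  have "fraction (t' \<odot>\<^bsub>M\<^esub> a' \<oplus>\<^bsub>M\<^esub> s' \<odot>\<^bsub>M\<^esub> b') (s' \<otimes>\<^bsub>R\<^esub> t') = fraction (t \<odot>\<^bsub>M\<^esub> a \<oplus>\<^bsub>M\<^esub> s \<odot>\<^bsub>M\<^esub> b) (s \<otimes>\<^bsub>R\<^esub> t)"
    if mem: "(a', s') \<in> fraction a s" "(b', t') \<in> fraction b t" for a' s' b' t'
  proof -
    note as = frac_memD[OF mem(1) assms(1,2)] and bt = frac_memD[OF mem(2) assms(3,4)]
    obtain w where w: "w \<in> S" "w \<odot>\<^bsub>M\<^esub> (s' \<odot>\<^bsub>M\<^esub> a) = w \<odot>\<^bsub>M\<^esub> (s \<odot>\<^bsub>M\<^esub> a')"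
      using as(3) by blast
    obtain w' where w': "w' \<in> S" "w' \<odot>\<^bsub>M\<^esub> (t' \<odot>\<^bsub>M\<^esub> b) = w' \<odot>\<^bsub>M\<^esub> (t \<odot>\<^bsub>M\<^esub> b')"
      using bt(3) by blast
    note carr = assms as(1,2) bt(1,2) w(1) w'(1)
    have "(w \<otimes>\<^bsub>R\<^esub> w') \<odot>\<^bsub>M\<^esub> ((s \<otimes>\<^bsub>R\<^esub> t) \<odot>\<^bsub>M\<^esub> (t' \<odot>\<^bsub>M\<^esub> a')) = (w' \<otimes>\<^bsub>R\<^esub> t \<otimes>\<^bsub>R\<^esub> t') \<odot>\<^bsub>M\<^esub> (w \<odot>\<^bsub>M\<^esub> (s \<odot>\<^bsub>M\<^esub> a'))"
      using carr by (simp add: smult_assoc1[symmetric] R.m_ac)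
    also have "\<dots> = (w \<otimes>\<^bsub>R\<^esub> w') \<odot>\<^bsub>M\<^esub> ((s' \<otimes>\<^bsub>R\<^esub> t') \<odot>\<^bsub>M\<^esub> (t \<odot>\<^bsub>M\<^esub> a))"
      unfolding w(2)[symmetric] using carr by (simp add: smult_assoc1[symmetric] R.m_ac)
    finally have 1: "(w \<otimes>\<^bsub>R\<^esub> w') \<odot>\<^bsub>M\<^esub> ((s \<otimes>\<^bsub>R\<^esub> t) \<odot>\<^bsub>M\<^esub> (t' \<odot>\<^bsub>M\<^esub> a')) =
      (w \<otimes>\<^bsub>R\<^esub> w') \<odot>\<^bsub>M\<^esub> ((s' \<otimes>\<^bsub>R\<^esub> t') \<odot>\<^bsub>M\<^esub> (t \<odot>\<^bsub>M\<^esub> a))" .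
    have "(w \<otimes>\<^bsub>R\<^esub> w') \<odot>\<^bsub>M\<^esub> ((s \<otimes>\<^bsub>R\<^esub> t) \<odot>\<^bsub>M\<^esub> (s' \<odot>\<^bsub>M\<^esub> b')) = (w \<otimes>\<^bsub>R\<^esub> s \<otimes>\<^bsub>R\<^esub> s') \<odot>\<^bsub>M\<^esub> (w' \<odot>\<^bsub>M\<^esub> (t \<odot>\<^bsub>M\<^esub> b'))"
      using carr by (simp add: smult_assoc1[symmetric] R.m_ac)
    also have "\<dots> = (w \<otimes>\<^bsub>R\<^esub> w') \<odot>\<^bsub>M\<^esub> ((s' \<otimes>\<^bsub>R\<^esub> t') \<odot>\<^bsub>M\<^esub> (s \<odot>\<^bsub>M\<^esub> b))"
      unfolding w'(2)[symmetric] using carr by (simp add: smult_assoc1[symmetric] R.m_ac)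
    finally have 2: "(w \<otimes>\<^bsub>R\<^esub> w') \<odot>\<^bsub>M\<^esub> ((s \<otimes>\<^bsub>R\<^esub> t) \<odot>\<^bsub>M\<^esub> (s' \<odot>\<^bsub>M\<^esub> b')) =
      (w \<otimes>\<^bsub>R\<^esub> w') \<odot>\<^bsub>M\<^esub> ((s' \<otimes>\<^bsub>R\<^esub> t') \<odot>\<^bsub>M\<^esub> (s \<odot>\<^bsub>M\<^esub> b))" .
    have c: "w \<otimes>\<^bsub>R\<^esub> w' \<in> carrier R" "s \<otimes>\<^bsub>R\<^esub> t \<in> carrier R" "s' \<otimes>\<^bsub>R\<^esub> t' \<in> carrier R"
      "t' \<odot>\<^bsub>M\<^esub> a' \<in> carrier M" "s' \<odot>\<^bsub>M\<^esub> b' \<in> carrier M" "t \<odot>\<^bsub>M\<^esub> a \<in> carrier M" "s \<odot>\<^bsub>M\<^esub> b \<in> carrier M"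
      using carr by simp_all
    have "(w \<otimes>\<^bsub>R\<^esub> w') \<odot>\<^bsub>M\<^esub> ((s \<otimes>\<^bsub>R\<^esub> t) \<odot>\<^bsub>M\<^esub> (t' \<odot>\<^bsub>M\<^esub> a' \<oplus>\<^bsub>M\<^esub> s' \<odot>\<^bsub>M\<^esub> b')) =
      (w \<otimes>\<^bsub>R\<^esub> w') \<odot>\<^bsub>M\<^esub> ((s' \<otimes>\<^bsub>R\<^esub> t') \<odot>\<^bsub>M\<^esub> (t \<odot>\<^bsub>M\<^esub> a \<oplus>\<^bsub>M\<^esub> s \<odot>\<^bsub>M\<^esub> b))"
      using c 1 2 by (simp add: smult_r_distr)
    moreover have "w \<otimes>\<^bsub>R\<^esub> w' \<in> S" "s \<otimes>\<^bsub>R\<^esub> t \<in> S" "s' \<otimes>\<^bsub>R\<^esub> t' \<in> S"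
      using carr by (simp_all only: S_mult)
    ultimately show ?thesis
      using c by (subst frac_eq_iff) (auto intro: M.add.m_closed)
  qed
  then have "loc_add R P M (fraction a s) (fraction b t) =
    (\<Union>x\<in>fraction a s. \<Union>y\<in>fraction b t. fraction (t \<odot>\<^bsub>M\<^esub> a \<oplus>\<^bsub>M\<^esub> s \<odot>\<^bsub>M\<^esub> b) (s \<otimes>\<^bsub>R\<^esub> t))"
    unfolding loc_add_def by (intro SUP_cong refl) auto
  also have "\<dots> = fraction (t \<odot>\<^bsub>M\<^esub> a \<oplus>\<^bsub>M\<^esub> s \<odot>\<^bsub>M\<^esub> b) (s \<otimes>\<^bsub>R\<^esub> t)"
    using frac_self[OF assms(1,2)] frac_self[OF assms(3,4)] by blast
  finally show ?thesis .
qed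

lemma loc_module_simps:
  "\<zero>\<^bsub>loc_module R P M\<^esub> = fraction \<zero>\<^bsub>M\<^esub> \<one>\<^bsub>R\<^esub>"
  "a \<in> carrier M \<Longrightarrow> s \<in> S \<Longrightarrow> b \<in> carrier M \<Longrightarrow> t \<in> S \<Longrightarrow>
     fraction a s \<oplus>\<^bsub>loc_module R P M\<^esub> fraction b t = fraction (t \<odot>\<^bsub>M\<^esub> a \<oplus>\<^bsub>M\<^esub> s \<odot>\<^bsub>M\<^esub> b) (s \<otimes>\<^bsub>R\<^esub> t)"
  by (simp_all add: loc_module_def loc_add_frac)

lemma frac_in: "a \<in> carrier M \<Longrightarrow> s \<in> S \<Longrightarrow> fraction a s \<in> carrier (loc_module R P M)"
  unfolding carrier_loc_module by blast

lemma abelian_group_loc_module: "abelian_group (loc_module R P M)"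
proof (rule abelian_groupI)
  let ?L = "loc_module R P M"
  fix x assume "x \<in> carrier ?L"
  then obtain a s where x: "x = fraction a s" "a \<in> carrier M" "s \<in> S"
    by (auto simp: carrier_loc_module)
  have "\<zero>\<^bsub>?L\<^esub> \<oplus>\<^bsub>?L\<^esub> x = fraction (s \<odot>\<^bsub>M\<^esub> \<zero>\<^bsub>M\<^esub> \<oplus>\<^bsub>M\<^esub> \<one>\<^bsub>R\<^esub> \<odot>\<^bsub>M\<^esub> a) (\<one>\<^bsub>R\<^esub> \<otimes>\<^bsub>R\<^esub> s)"
    unfolding x(1) loc_module_simps(1) by (rule loc_module_simps(2)) (use x S_one in auto)
  then show "\<zero>\<^bsub>?L\<^esub> \<oplus>\<^bsub>?L\<^esub> x = x"
    using x by simp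
  have "fraction (\<ominus>\<^bsub>M\<^esub> a) s \<oplus>\<^bsub>?L\<^esub> x = fraction (s \<odot>\<^bsub>M\<^esub> (\<ominus>\<^bsub>M\<^esub> a) \<oplus>\<^bsub>M\<^esub> s \<odot>\<^bsub>M\<^esub> a) (s \<otimes>\<^bsub>R\<^esub> s)"
    unfolding x(1) by (rule loc_module_simps(2)) (use x in auto)
  also have "s \<odot>\<^bsub>M\<^esub> (\<ominus>\<^bsub>M\<^esub> a) \<oplus>\<^bsub>M\<^esub> s \<odot>\<^bsub>M\<^esub> a = \<zero>\<^bsub>M\<^esub>"
    using x by (simp add: smult_r_distr[symmetric] M.l_neg)
  also have "fraction \<zero>\<^bsub>M\<^esub> (s \<otimes>\<^bsub>R\<^esub> s) = fraction \<zero>\<^bsub>M\<^esub> \<one>\<^bsub>R\<^esub>"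
    by (rule frac_eqI) (use x S_one S_mult in auto)
  finally show "\<exists>y\<in>carrier ?L. y \<oplus>\<^bsub>?L\<^esub> x = \<zero>\<^bsub>?L\<^esub>"
    using x frac_in[of "\<ominus>\<^bsub>M\<^esub> a" s] by (auto simp: loc_module_simps(1))
  fix y assume "y \<in> carrier ?L"
  then obtain b t where y: "y = fraction b t" "b \<in> carrier M" "t \<in> S"
    by (auto simp: carrier_loc_module)
  have xy: "x \<oplus>\<^bsub>?L\<^esub> y = fraction (t \<odot>\<^bsub>M\<^esub> a \<oplus>\<^bsub>M\<^esub> s \<odot>\<^bsub>M\<^esub> b) (s \<otimes>\<^bsub>R\<^esub> t)"
    unfolding x(1) y(1) by (rule loc_module_simps(2)) (use x y in auto)
  then show "x \<oplus>\<^bsub>?L\<^esub> y \<in> carrier ?L"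
    using x y S_mult by (auto intro!: frac_in)
  have yx: "y \<oplus>\<^bsub>?L\<^esub> x = fraction (s \<odot>\<^bsub>M\<^esub> b \<oplus>\<^bsub>M\<^esub> t \<odot>\<^bsub>M\<^esub> a) (t \<otimes>\<^bsub>R\<^esub> s)"
    unfolding x(1) y(1) by (rule loc_module_simps(2)) (use x y in auto)
  show "x \<oplus>\<^bsub>?L\<^esub> y = y \<oplus>\<^bsub>?L\<^esub> x"
    unfolding xy yx using x y by (simp add: M.a_comm R.m_comm)
  fix z assume "z \<in> carrier ?L"
  then obtain c u where z: "z = fraction c u" "c \<in> carrier M" "u \<in> S"
    by (auto simp: carrier_loc_module)
  have yz: "y \<oplus>\<^bsub>?L\<^esub> z = fraction (u \<odot>\<^bsub>M\<^esub> b \<oplus>\<^bsub>M\<^esub> t \<odot>\<^bsub>M\<^esub> c) (t \<otimes>\<^bsub>R\<^esub> u)"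
    unfolding z(1) y(1) by (rule loc_module_simps(2)) (use z y in auto)
  have st: "s \<otimes>\<^bsub>R\<^esub> t \<in> S" "t \<otimes>\<^bsub>R\<^esub> u \<in> S"
    using x y z S_mult by blast+
  have "x \<oplus>\<^bsub>?L\<^esub> y \<oplus>\<^bsub>?L\<^esub> z =
    fraction (u \<odot>\<^bsub>M\<^esub> (t \<odot>\<^bsub>M\<^esub> a \<oplus>\<^bsub>M\<^esub> s \<odot>\<^bsub>M\<^esub> b) \<oplus>\<^bsub>M\<^esub> (s \<otimes>\<^bsub>R\<^esub> t) \<odot>\<^bsub>M\<^esub> c) (s \<otimes>\<^bsub>R\<^esub> t \<otimes>\<^bsub>R\<^esub> u)"
    unfolding xy z(1) by (rule loc_module_simps(2)) (use x y z st in auto)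
  also have "\<dots> = fraction ((t \<otimes>\<^bsub>R\<^esub> u) \<odot>\<^bsub>M\<^esub> a \<oplus>\<^bsub>M\<^esub> s \<odot>\<^bsub>M\<^esub> (u \<odot>\<^bsub>M\<^esub> b \<oplus>\<^bsub>M\<^esub> t \<odot>\<^bsub>M\<^esub> c)) (s \<otimes>\<^bsub>R\<^esub> (t \<otimes>\<^bsub>R\<^esub> u))"
    using x y z
    by (simp add: smult_r_distr smult_assoc1 M.a_assoc R.m_assoc smult_left_commute[of u])
  also have "\<dots> = x \<oplus>\<^bsub>?L\<^esub> (y \<oplus>\<^bsub>?L\<^esub> z)"
    unfolding yz x(1) by (rule loc_module_simps(2)[symmetric]) (use x y z st in auto)
  finally show "x \<oplus>\<^bsub>?L\<^esub> y \<oplus>\<^bsub>?L\<^esub> z = x \<oplus>\<^bsub>?L\<^esub> (y \<oplus>\<^bsub>?L\<^esub> z)" .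
qed (use frac_in[OF M.zero_closed S_one] in \<open>simp add: loc_module_simps(1)\<close>)

end

text \<open>Elements of the localized ring are fractions of the regular module, so all facts about
  fractions apply to them.\<close>

lemma (in module_at_prime) module_at_prime_regular: "module_at_prime R (regular_module R) P"
  by (intro module_at_prime.intro module_at_prime_axioms.intro prime module_regular_module R.is_cring)

context module_at_prime
begin

lemma regular_frac_eq_iff:
  assumes "a \<in> carrier R" "s \<in> S" "b \<in> carrier R" "t \<in> S"
  shows "loc_frac R P (regular_module R) a s = loc_frac R P (regular_module R) b t \<longleftrightarrow>
    (\<exists>w\<in>S. w \<otimes>\<^bsub>R\<^esub> (t \<otimes>\<^bsub>R\<^esub> a) = w \<otimes>\<^bsub>R\<^esub> (s \<otimes>\<^bsub>R\<^esub> b))"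
  using module_at_prime.frac_eq_iff[OF module_at_prime_regular, of a s b t] assms
  by (simp add: regular_module_simps)

lemma loc_smult_frac:
  assumes "r \<in> carrier R" "s \<in> S" "b \<in> carrier M" "t \<in> S"
  shows "loc_smult R P M (loc_frac R P (regular_module R) r s) (fraction b t) = fraction (r \<odot>\<^bsub>M\<^esub> b) (s \<otimes>\<^bsub>R\<^esub> t)"
proof -
  note reg = module_at_prime.frac_memD[OF module_at_prime_regular, unfolded regular_module_simps]
  have "fraction (r' \<odot>\<^bsub>M\<^esub> b') (s' \<otimes>\<^bsub>R\<^esub> t') = fraction (r \<odot>\<^bsub>M\<^esub> b) (s \<otimes>\<^bsub>R\<^esub> t)"
    if mem: "(r', s') \<in> loc_frac R P (regular_module R) r s" "(b', t') \<in> fraction b t" for r' s' b' t'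
  proof -
    note rs = reg[OF mem(1) assms(1,2)] and bt = frac_memD[OF mem(2) assms(3,4)]
    obtain w where w: "w \<in> S" "w \<otimes>\<^bsub>R\<^esub> (s' \<otimes>\<^bsub>R\<^esub> r) = w \<otimes>\<^bsub>R\<^esub> (s \<otimes>\<^bsub>R\<^esub> r')"
      using rs(3) by blast
    obtain w' where w': "w' \<in> S" "w' \<odot>\<^bsub>M\<^esub> (t' \<odot>\<^bsub>M\<^esub> b) = w' \<odot>\<^bsub>M\<^esub> (t \<odot>\<^bsub>M\<^esub> b')"
      using bt(3) by blast
    note carr = assms rs(1,2) bt(1,2) w(1) w'(1)
    have "(w \<otimes>\<^bsub>R\<^esub> w') \<odot>\<^bsub>M\<^esub> ((s \<otimes>\<^bsub>R\<^esub> t) \<odot>\<^bsub>M\<^esub> (r' \<odot>\<^bsub>M\<^esub> b')) = (w \<otimes>\<^bsub>R\<^esub> (s \<otimes>\<^bsub>R\<^esub> r')) \<odot>\<^bsub>M\<^esub> (w' \<odot>\<^bsub>M\<^esub> (t \<odot>\<^bsub>M\<^esub> b'))"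
      using carr by (simp add: smult_assoc1[symmetric] R.m_ac)
    also have "\<dots> = (w \<otimes>\<^bsub>R\<^esub> w') \<odot>\<^bsub>M\<^esub> ((s' \<otimes>\<^bsub>R\<^esub> t') \<odot>\<^bsub>M\<^esub> (r \<odot>\<^bsub>M\<^esub> b))"
      unfolding w(2)[symmetric] w'(2)[symmetric] using carr by (simp add: smult_assoc1[symmetric] R.m_ac)
    finally have "(w \<otimes>\<^bsub>R\<^esub> w') \<odot>\<^bsub>M\<^esub> ((s \<otimes>\<^bsub>R\<^esub> t) \<odot>\<^bsub>M\<^esub> (r' \<odot>\<^bsub>M\<^esub> b')) =
      (w \<otimes>\<^bsub>R\<^esub> w') \<odot>\<^bsub>M\<^esub> ((s' \<otimes>\<^bsub>R\<^esub> t') \<odot>\<^bsub>M\<^esub> (r \<odot>\<^bsub>M\<^esub> b))" .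
    moreover have "w \<otimes>\<^bsub>R\<^esub> w' \<in> S" "s \<otimes>\<^bsub>R\<^esub> t \<in> S" "s' \<otimes>\<^bsub>R\<^esub> t' \<in> S"
      using carr by (simp_all only: S_mult)
    moreover have "r' \<odot>\<^bsub>M\<^esub> b' \<in> carrier M" "r \<odot>\<^bsub>M\<^esub> b \<in> carrier M"
      using carr by simp_all
    ultimately show ?thesis
      by (subst frac_eq_iff) auto
  qed
  then have "loc_smult R P M (loc_frac R P (regular_module R) r s) (fraction b t) =
    (\<Union>x\<in>loc_frac R P (regular_module R) r s. \<Union>y\<in>fraction b t. fraction (r \<odot>\<^bsub>M\<^esub> b) (s \<otimes>\<^bsub>R\<^esub> t))"
    unfolding loc_smult_def by (intro SUP_cong refl) auto
  also have "\<dots> = fraction (r \<odot>\<^bsub>M\<^esub> b) (s \<otimes>\<^bsub>R\<^esub> t)"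
    using module_at_prime.frac_self[OF module_at_prime_regular, of r s] frac_self[OF assms(3,4)] assms(1,2)
    unfolding regular_module_simps by blast
  finally show ?thesis .
qed

lemma carrier_loc_ring:
  "carrier (loc_ring R P) = {loc_frac R P (regular_module R) r s | r s. r \<in> carrier R \<and> s \<in> S}"
  using module_at_prime.carrier_loc_module[OF module_at_prime_regular]
  by (simp add: loc_ring_def loc_module_def regular_module_simps)

text \<open>The numerator \<open>e\<close> of a basis element works, since its denominator is a unit
  of the localized ring. Clearing denominators translates spanning and independence into statements
  about \<open>M\<close>.\<close>

lemma free_of_rank_one_generator:
  assumes "free_module_of_rank 1 (loc_ring R P) (loc_module R P M)"
  shows "\<exists>e\<in>carrier M. (\<forall>a\<in>carrier M. \<exists>s\<in>S. \<exists>r\<in>carrier R. s \<odot>\<^bsub>M\<^esub> a = r \<odot>\<^bsub>M\<^esub> e) \<and>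
    (\<forall>r\<in>carrier R. r \<odot>\<^bsub>M\<^esub> e = \<zero>\<^bsub>M\<^esub> \<longrightarrow> (\<exists>w\<in>S. w \<otimes>\<^bsub>R\<^esub> r = \<zero>\<^bsub>R\<^esub>))"
proof -
  let ?L = "loc_module R P M" and ?RP = "loc_ring R P" and ?rf = "loc_frac R P (regular_module R)"
  interpret L: abelian_group ?L
    by (rule abelian_group_loc_module)
  obtain b where b: "b \<in> carrier ?L" "module_span ?RP ?L {b} = carrier ?L"
    and indep: "\<And>c. c \<in> {b} \<rightarrow> carrier ?RP \<Longrightarrow> (\<Oplus>\<^bsub>?L\<^esub> x\<in>{b}. c x \<odot>\<^bsub>?L\<^esub> x) = \<zero>\<^bsub>?L\<^esub> \<Longrightarrow> c b = \<zero>\<^bsub>?RP\<^esub>"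
    using assms unfolding free_module_of_rank_def module_basis_def by (auto simp: card_1_singleton_iff)
  obtain e s0 where e: "b = fraction e s0" "e \<in> carrier M" "s0 \<in> S"
    using b(1) by (auto simp: carrier_loc_module)
  have smult: "?rf r s \<odot>\<^bsub>?L\<^esub> fraction a t = fraction (r \<odot>\<^bsub>M\<^esub> a) (s \<otimes>\<^bsub>R\<^esub> t)"
    if "r \<in> carrier R" "s \<in> S" "a \<in> carrier M" "t \<in> S" for r s a t
    using loc_smult_frac[OF that] by (simp add: loc_module_def)
  \<comment> \<open>The span is an intersection of submodules, so it is contained in this submodule
    of all multiples of \<open>e\<close>.\<close>
  define N where "N = {fraction (r \<odot>\<^bsub>M\<^esub> e) t | r t. r \<in> carrier R \<and> t \<in> S}"
  have N_I: "fraction (r \<odot>\<^bsub>M\<^esub> e) t \<in> N" if "r \<in> carrier R" "t \<in> S" for r t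
    using that unfolding N_def by blast
  have "submodule N ?RP ?L"
  proof (intro submodule.intro submodule_axioms.intro)
    show "subgroup N (add_monoid ?L)"
    proof (rule group.subgroupI[OF L.a_group])
      show "N \<subseteq> carrier (add_monoid ?L)"
        using e(2) by (auto simp: N_def intro!: frac_in)
      show "N \<noteq> {}"
        using N_I[OF R.one_closed S_one] by blast
      fix x assume "x \<in> N"
      then obtain r t where x: "x = fraction (r \<odot>\<^bsub>M\<^esub> e) t" "r \<in> carrier R" "t \<in> S"
        by (auto simp: N_def)
      have "fraction ((\<ominus>\<^bsub>R\<^esub> r) \<odot>\<^bsub>M\<^esub> e) t \<oplus>\<^bsub>?L\<^esub> x =
        fraction (t \<odot>\<^bsub>M\<^esub> ((\<ominus>\<^bsub>R\<^esub> r) \<odot>\<^bsub>M\<^esub> e) \<oplus>\<^bsub>M\<^esub> t \<odot>\<^bsub>M\<^esub> (r \<odot>\<^bsub>M\<^esub> e)) (t \<otimes>\<^bsub>R\<^esub> t)"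
        unfolding x(1) by (rule loc_module_simps(2)) (use x e in auto)
      also have "t \<odot>\<^bsub>M\<^esub> ((\<ominus>\<^bsub>R\<^esub> r) \<odot>\<^bsub>M\<^esub> e) \<oplus>\<^bsub>M\<^esub> t \<odot>\<^bsub>M\<^esub> (r \<odot>\<^bsub>M\<^esub> e) = \<zero>\<^bsub>M\<^esub>"
        using x e by (simp add: smult_r_distr[symmetric] smult_l_distr[symmetric] R.l_neg)
      also have "fraction \<zero>\<^bsub>M\<^esub> (t \<otimes>\<^bsub>R\<^esub> t) = \<zero>\<^bsub>?L\<^esub>"
        unfolding loc_module_simps(1) by (rule frac_eqI) (use x S_one S_mult in auto)
      finally have "\<ominus>\<^bsub>?L\<^esub> x = fraction ((\<ominus>\<^bsub>R\<^esub> r) \<odot>\<^bsub>M\<^esub> e) t"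
        using x e by (intro L.minus_equality) (auto intro!: frac_in)
      then show "inv\<^bsub>add_monoid ?L\<^esub> x \<in> N"
        using x N_I by (simp add: a_inv_def[symmetric])
      fix y assume "y \<in> N"
      then obtain q u where y: "y = fraction (q \<odot>\<^bsub>M\<^esub> e) u" "q \<in> carrier R" "u \<in> S"
        by (auto simp: N_def)
      have "x \<oplus>\<^bsub>?L\<^esub> y = fraction (u \<odot>\<^bsub>M\<^esub> (r \<odot>\<^bsub>M\<^esub> e) \<oplus>\<^bsub>M\<^esub> t \<odot>\<^bsub>M\<^esub> (q \<odot>\<^bsub>M\<^esub> e)) (t \<otimes>\<^bsub>R\<^esub> u)"
        unfolding x(1) y(1) by (rule loc_module_simps(2)) (use x y e in auto)
      also have "u \<odot>\<^bsub>M\<^esub> (r \<odot>\<^bsub>M\<^esub> e) \<oplus>\<^bsub>M\<^esub> t \<odot>\<^bsub>M\<^esub> (q \<odot>\<^bsub>M\<^esub> e) = (u \<otimes>\<^bsub>R\<^esub> r \<oplus>\<^bsub>R\<^esub> t \<otimes>\<^bsub>R\<^esub> q) \<odot>\<^bsub>M\<^esub> e"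
        using x y e by (simp add: smult_l_distr smult_assoc1)
      finally show "x \<otimes>\<^bsub>add_monoid ?L\<^esub> y \<in> N"
        using x y S_mult[of t u] by (auto intro!: N_I)
    qed
    fix c x assume "c \<in> carrier ?RP" "x \<in> N"
    then obtain q u r t where c: "c = ?rf q u" "q \<in> carrier R" "u \<in> S"
      and x: "x = fraction (r \<odot>\<^bsub>M\<^esub> e) t" "r \<in> carrier R" "t \<in> S"
      by (auto simp: N_def carrier_loc_ring)
    have "c \<odot>\<^bsub>?L\<^esub> x = fraction ((q \<otimes>\<^bsub>R\<^esub> r) \<odot>\<^bsub>M\<^esub> e) (u \<otimes>\<^bsub>R\<^esub> t)"
      unfolding c(1) x(1) using c x e by (simp add: smult smult_assoc1)
    then show "c \<odot>\<^bsub>?L\<^esub> x \<in> N"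
      using c x S_mult[of u t] by (auto intro!: N_I)
  qed
  moreover have "b \<in> N"
    using N_I[OF R.one_closed e(3)] e by simp
  ultimately have carrier: "carrier ?L \<subseteq> N"
    unfolding b(2)[symmetric] module_span_def by blast
  have "\<exists>s\<in>S. \<exists>r\<in>carrier R. s \<odot>\<^bsub>M\<^esub> a = r \<odot>\<^bsub>M\<^esub> e" if a: "a \<in> carrier M" for a
  proof -
    have "fraction a \<one>\<^bsub>R\<^esub> \<in> N"
      using carrier frac_in[OF a S_one] by blast
    then obtain r t where r: "fraction a \<one>\<^bsub>R\<^esub> = fraction (r \<odot>\<^bsub>M\<^esub> e) t" "r \<in> carrier R" "t \<in> S"
      by (auto simp: N_def)
    then obtain w where w: "w \<in> S" "w \<odot>\<^bsub>M\<^esub> (t \<odot>\<^bsub>M\<^esub> a) = w \<odot>\<^bsub>M\<^esub> (\<one>\<^bsub>R\<^esub> \<odot>\<^bsub>M\<^esub> (r \<odot>\<^bsub>M\<^esub> e))"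
      using frac_eq_iff[of a "\<one>\<^bsub>R\<^esub>" "r \<odot>\<^bsub>M\<^esub> e" t] a e S_one by auto
    then have "(w \<otimes>\<^bsub>R\<^esub> t) \<odot>\<^bsub>M\<^esub> a = (w \<otimes>\<^bsub>R\<^esub> r) \<odot>\<^bsub>M\<^esub> e"
      using a e r by (simp add: smult_assoc1)
    moreover have "w \<otimes>\<^bsub>R\<^esub> r \<in> carrier R"
      using w r by simp
    ultimately show ?thesis
      using S_mult[OF w(1) r(3)] by blast
  qed
  moreover have "\<exists>w\<in>S. w \<otimes>\<^bsub>R\<^esub> r = \<zero>\<^bsub>R\<^esub>" if r: "r \<in> carrier R" "r \<odot>\<^bsub>M\<^esub> e = \<zero>\<^bsub>M\<^esub>" for r
  proof -
    have "?rf r \<one>\<^bsub>R\<^esub> \<odot>\<^bsub>?L\<^esub> b = fraction \<zero>\<^bsub>M\<^esub> s0"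
      unfolding e(1) using smult[OF r(1) S_one e(2,3)] r e(3) by simp
    also have "\<dots> = \<zero>\<^bsub>?L\<^esub>"
      unfolding loc_module_simps(1) by (rule frac_eqI) (use e S_one in auto)
    finally have "(\<Oplus>\<^bsub>?L\<^esub> x\<in>{b}. ?rf r \<one>\<^bsub>R\<^esub> \<odot>\<^bsub>?L\<^esub> x) = \<zero>\<^bsub>?L\<^esub>"
      by (simp add: L.finsum_insert)
    then have "?rf r \<one>\<^bsub>R\<^esub> = \<zero>\<^bsub>?RP\<^esub>"
      using indep[of "\<lambda>_. ?rf r \<one>\<^bsub>R\<^esub>"] r(1) S_one by (auto simp: carrier_loc_ring)
    then have "?rf r \<one>\<^bsub>R\<^esub> = ?rf \<zero>\<^bsub>R\<^esub> \<one>\<^bsub>R\<^esub>"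
      by (simp add: loc_ring_def)
    then obtain w where "w \<in> S" "w \<otimes>\<^bsub>R\<^esub> (\<one>\<^bsub>R\<^esub> \<otimes>\<^bsub>R\<^esub> r) = w \<otimes>\<^bsub>R\<^esub> (\<one>\<^bsub>R\<^esub> \<otimes>\<^bsub>R\<^esub> \<zero>\<^bsub>R\<^esub>)"
      using regular_frac_eq_iff[OF r(1) S_one R.zero_closed S_one] by blast
    then show ?thesis
      using r(1) by (intro bexI[of _ w]) simp_all
  qed
  ultimately show ?thesis
    using e(2) by blast
qed

text \<open>The product of the denominators of finitely many generators serves them all, and the
  elements that it serves form a submodule.\<close>

lemma common_denominator:
  assumes fg: "finitely_generated_module R M" and e: "e \<in> carrier M"
    and gen: "\<And>a. a \<in> carrier M \<Longrightarrow> \<exists>s\<in>S. \<exists>r\<in>carrier R. s \<odot>\<^bsub>M\<^esub> a = r \<odot>\<^bsub>M\<^esub> e"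
  shows "\<exists>s\<in>S. \<forall>a\<in>carrier M. \<exists>r\<in>carrier R. s \<odot>\<^bsub>M\<^esub> a = r \<odot>\<^bsub>M\<^esub> e"
proof -
  obtain F where F: "finite F" "F \<subseteq> carrier M" "module_span R M F = carrier M"
    using fg by (auto simp: finitely_generated_module_def)
  have "\<exists>s\<in>S. \<forall>a\<in>F. \<exists>r\<in>carrier R. s \<odot>\<^bsub>M\<^esub> a = r \<odot>\<^bsub>M\<^esub> e"
    using F(1,2)
  proof (induction F rule: finite_induct)
    case empty
    then show ?case
      using S_one by blast
  next
    case (insert x F)
    obtain s where s: "s \<in> S" "\<And>a. a \<in> F \<Longrightarrow> \<exists>r\<in>carrier R. s \<odot>\<^bsub>M\<^esub> a = r \<odot>\<^bsub>M\<^esub> e"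
      using insert by auto
    obtain t r where t: "t \<in> S" "r \<in> carrier R" "t \<odot>\<^bsub>M\<^esub> x = r \<odot>\<^bsub>M\<^esub> e"
      using gen insert.prems by blast
    have "\<exists>r\<in>carrier R. (s \<otimes>\<^bsub>R\<^esub> t) \<odot>\<^bsub>M\<^esub> a = r \<odot>\<^bsub>M\<^esub> e" if a: "a \<in> insert x F" for a
    proof (cases "a = x")
      case True
      have "(s \<otimes>\<^bsub>R\<^esub> t) \<odot>\<^bsub>M\<^esub> x = (s \<otimes>\<^bsub>R\<^esub> r) \<odot>\<^bsub>M\<^esub> e"
        using s t e insert.prems by (simp add: smult_assoc1)
      then show ?thesis
        using True s(1) t(2) by (intro bexI[of _ "s \<otimes>\<^bsub>R\<^esub> r"]) auto
    next
      case False
      then obtain q where q: "q \<in> carrier R" "s \<odot>\<^bsub>M\<^esub> a = q \<odot>\<^bsub>M\<^esub> e"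
        using s(2) a by blast
      have "(s \<otimes>\<^bsub>R\<^esub> t) \<odot>\<^bsub>M\<^esub> a = t \<odot>\<^bsub>M\<^esub> (s \<odot>\<^bsub>M\<^esub> a)"
        using s t a insert.prems by (subst R.m_comm) (auto simp: smult_assoc1)
      also have "\<dots> = (t \<otimes>\<^bsub>R\<^esub> q) \<odot>\<^bsub>M\<^esub> e"
        using t q e by (simp add: smult_assoc1)
      finally show ?thesis
        using t(1) q(1) by (intro bexI[of _ "t \<otimes>\<^bsub>R\<^esub> q"]) auto
    qed
    then show ?case
      using S_mult[OF s(1) t(1)] by blast
  qed
  then obtain s where s: "s \<in> S" "\<And>a. a \<in> F \<Longrightarrow> \<exists>r\<in>carrier R. s \<odot>\<^bsub>M\<^esub> a = r \<odot>\<^bsub>M\<^esub> e"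
    by blast
  define N where "N = {a \<in> carrier M. \<exists>r\<in>carrier R. s \<odot>\<^bsub>M\<^esub> a = r \<odot>\<^bsub>M\<^esub> e}"
  have sR: "s \<in> carrier R"
    using s(1) by simp
  have "submodule N R M"
  proof (rule submoduleI)
    show "N \<subseteq> carrier M"
      by (auto simp: N_def)
    show "\<zero>\<^bsub>M\<^esub> \<in> N"
      using e sR by (auto simp: N_def intro!: bexI[of _ "\<zero>\<^bsub>R\<^esub>"])
    fix a assume "a \<in> N"
    then obtain r where a: "a \<in> carrier M" "r \<in> carrier R" "s \<odot>\<^bsub>M\<^esub> a = r \<odot>\<^bsub>M\<^esub> e"
      by (auto simp: N_def)
    have "s \<odot>\<^bsub>M\<^esub> (\<ominus>\<^bsub>M\<^esub> a) = (\<ominus>\<^bsub>R\<^esub> r) \<odot>\<^bsub>M\<^esub> e"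
      using a e sR by (simp add: smult_l_minus smult_r_minus)
    then show "\<ominus>\<^bsub>M\<^esub> a \<in> N"
      using a(1,2) unfolding N_def by blast
    {
      fix b assume "b \<in> N"
      then obtain q where b: "b \<in> carrier M" "q \<in> carrier R" "s \<odot>\<^bsub>M\<^esub> b = q \<odot>\<^bsub>M\<^esub> e"
        by (auto simp: N_def)
      have "s \<odot>\<^bsub>M\<^esub> (a \<oplus>\<^bsub>M\<^esub> b) = (r \<oplus>\<^bsub>R\<^esub> q) \<odot>\<^bsub>M\<^esub> e"
        using a b e sR by (simp add: smult_l_distr smult_r_distr)
      then show "a \<oplus>\<^bsub>M\<^esub> b \<in> N"
        using a(1,2) b(1,2) unfolding N_def by blast
    }
    fix q assume q: "q \<in> carrier R"
    have "s \<odot>\<^bsub>M\<^esub> (q \<odot>\<^bsub>M\<^esub> a) = (q \<otimes>\<^bsub>R\<^esub> r) \<odot>\<^bsub>M\<^esub> e"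
      using a e sR q by (simp add: smult_left_commute[of s q] smult_assoc1)
    then show "q \<odot>\<^bsub>M\<^esub> a \<in> N"
      using a(1,2) q unfolding N_def by blast
  qed
  moreover have "F \<subseteq> N"
    using F(2) s(2) by (auto simp: N_def)
  ultimately have "carrier M \<subseteq> N"
    unfolding F(3)[symmetric] module_span_def by blast
  then show ?thesis
    using s(1) by (auto simp: N_def)
qed

end

section \<open>Depth and prime ideals\<close>

text \<open>Used for the restrictions to a plane, to an axis and to the origin, each with values in
  a domain.\<close>

lemma kernel_primeideal:
  fixes h :: "'r \<Rightarrow> 'a::idom"
  assumes "cring R" and add: "\<And>a b. a \<in> carrier R \<Longrightarrow> b \<in> carrier R \<Longrightarrow> h (a \<oplus>\<^bsub>R\<^esub> b) = h a + h b"
    and mult: "\<And>a b. a \<in> carrier R \<Longrightarrow> b \<in> carrier R \<Longrightarrow> h (a \<otimes>\<^bsub>R\<^esub> b) = h a * h b"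
    and one: "h \<one>\<^bsub>R\<^esub> = 1"
  shows "primeideal {r \<in> carrier R. h r = 0} R"
proof -
  interpret cring R by fact
  have zero: "h \<zero>\<^bsub>R\<^esub> = 0"
    using add[of "\<zero>\<^bsub>R\<^esub>" "\<zero>\<^bsub>R\<^esub>"] by (metis add_cancel_right_right r_zero zero_closed)
  have uminus: "h (\<ominus>\<^bsub>R\<^esub> a) = - h a" if "a \<in> carrier R" for a
    using add[of a "\<ominus>\<^bsub>R\<^esub> a"] that by (simp add: r_neg zero eq_neg_iff_add_eq_0 add.commute)
  show ?thesis
  proof (rule primeidealI)
    show "ideal {r \<in> carrier R. h r = 0} R"
    proof (rule idealI[OF ring_axioms])
      show "subgroup {r \<in> carrier R. h r = 0} (add_monoid R)"
      proof (rule group.subgroupI[OF a_group])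
        show "{r \<in> carrier R. h r = 0} \<noteq> {}"
          using zero by auto
      qed (auto simp: add uminus a_inv_def[symmetric])
    qed (auto simp: mult)
    show "carrier R \<noteq> {r \<in> carrier R. h r = 0}"
      using one by force
  qed (auto simp: mult is_cring)
qed

text \<open>Zorn's lemma gives an ideal maximal among those containing \<open>I\<close> and missing
  all powers of \<open>s\<close>. For \<open>a\<close>, \<open>b\<close> outside it, adjoining
  either one captures a power of \<open>s\<close>; the product of these powers would lie in it if
  \<open>a \<otimes> b\<close> did.\<close>

lemma (in cring) prime_avoiding_powers:
  assumes I: "ideal I R" and s: "s \<in> carrier R" "\<And>n::nat. s [^] n \<notin> I"
  shows "\<exists>P. primeideal P R \<and> I \<subseteq> P \<and> s \<notin> P"
proof -
  define A where "A = {J. ideal J R \<and> I \<subseteq> J \<and> (\<forall>n::nat. s [^] n \<notin> J)}"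
  have "\<exists>P\<in>A. \<forall>J\<in>A. P \<subseteq> J \<longrightarrow> J = P"
  proof (rule subset_Zorn)
    fix C assume C: "subset.chain A C"
    show "\<exists>U\<in>A. \<forall>J\<in>C. J \<subseteq> U"
    proof (cases "C = {}")
      case True
      then show ?thesis
        using I s by (auto simp: A_def)
    next
      case False
      have "subset.chain {I. ideal I R} C"
        using C unfolding subset_chain_def by (auto simp: A_def)
      from chain_Union_is_ideal[OF this] have "ideal (\<Union>C) R"
        using False by simp
      then have "\<Union>C \<in> A"
        using C False unfolding subset_chain_def by (auto simp: A_def)
      then show ?thesis
        by blast
    qed
  qed
  then obtain P where P: "P \<in> A" "\<And>J. J \<in> A \<Longrightarrow> P \<subseteq> J \<Longrightarrow> J = P"
    by blast
  have ideal: "ideal P R" and IP: "I \<subseteq> P" and sP: "\<And>n::nat. s [^] n \<notin> P"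
    using P(1) by (auto simp: A_def)
  interpret P: ideal P R by fact
  have power: "\<exists>n::nat. \<exists>p\<in>P. \<exists>r\<in>carrier R. s [^] n = p \<oplus> r \<otimes> a"
    if a: "a \<in> carrier R" "a \<notin> P" for a
  proof -
    let ?J = "P <+>\<^bsub>R\<^esub> PIdl a"
    have J: "ideal ?J R"
      by (rule add_ideals[OF ideal cgenideal_ideal[OF a(1)]])
    have "P \<subseteq> ?J"
    proof
      fix p assume "p \<in> P"
      then have "p = p \<oplus> \<zero> \<otimes> a" "p \<in> carrier R"
        using a(1) P.a_Hcarr by auto
      then show "p \<in> ?J"
        using \<open>p \<in> P\<close> unfolding set_add_def' cgenideal_def by blast
    qed
    moreover have "a \<in> ?J"
    proof -
      have "a = \<zero> \<oplus> \<one> \<otimes> a"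
        using a(1) by simp
      then show ?thesis
        using P.zero_closed unfolding set_add_def' cgenideal_def by blast
    qed
    ultimately have "?J \<notin> A"
      using P(2) a(2) by blast
    then obtain n :: nat where "s [^] n \<in> ?J"
      using J IP \<open>P \<subseteq> ?J\<close> by (auto simp: A_def)
    then show ?thesis
      unfolding set_add_def' cgenideal_def by blast
  qed
  have "primeideal P R"
  proof (rule primeidealI[OF ideal is_cring])
    show "carrier R \<noteq> P"
      using sP[of 0] by auto
    fix a b assume ab: "a \<in> carrier R" "b \<in> carrier R" "a \<otimes> b \<in> P"
    show "a \<in> P \<or> b \<in> P"
    proof (rule ccontr)
      assume "\<not> (a \<in> P \<or> b \<in> P)"
      then obtain n m :: nat and p q r t where pr: "p \<in> P" "r \<in> carrier R" "s [^] n = p \<oplus> r \<otimes> a"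
        and qt: "q \<in> P" "t \<in> carrier R" "s [^] m = q \<oplus> t \<otimes> b"
        using power ab by meson
      have carr: "p \<in> carrier R" "q \<in> carrier R"
        using pr qt P.a_Hcarr by auto
      have "s [^] (n + m) = (p \<oplus> r \<otimes> a) \<otimes> (q \<oplus> t \<otimes> b)"
        using s(1) by (simp add: nat_pow_mult[symmetric] pr qt)
      also have "\<dots> = p \<otimes> (q \<oplus> t \<otimes> b) \<oplus> ((r \<otimes> a) \<otimes> q \<oplus> (r \<otimes> t) \<otimes> (a \<otimes> b))"
        using carr pr qt ab by algebra
      also have "\<dots> \<in> P"
      proof (intro P.a_closed)
        show "p \<otimes> (q \<oplus> t \<otimes> b) \<in> P"
          by (rule P.I_r_closed[OF pr(1)]) (use carr qt ab in simp)
        show "(r \<otimes> a) \<otimes> q \<in> P"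
          by (rule P.I_l_closed[OF qt(1)]) (use pr ab in simp)
        show "(r \<otimes> t) \<otimes> (a \<otimes> b) \<in> P"
          by (rule P.I_l_closed[OF ab(3)]) (use pr qt in simp)
      qed
      finally show False
        using sP by blast
    qed
  qed
  then show ?thesis
    using IP sP[of 1] s(1) by (intro exI[of _ P]) simp
qed

text \<open>A supremum of lengths that is at least 2 comes with an actual sequence of two or more
  members. Regularity of the second on the quotient by the first is spelled out by equations in
  \<open>M\<close>.\<close>

lemma depth_ge_2:
  fixes M :: "('r, 'm, 'y) module_scheme"
  assumes M: "Module.module R M" and depth: "2 \<le> module_depth R M"
  shows "\<exists>s t. s \<in> carrier R - Units R \<and> t \<in> carrier R - Units R \<and>
    (\<forall>a\<in>carrier M. s \<odot>\<^bsub>M\<^esub> a = \<zero>\<^bsub>M\<^esub> \<longrightarrow> a = \<zero>\<^bsub>M\<^esub>) \<and>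
    (\<forall>a\<in>carrier M. \<forall>b\<in>carrier M. t \<odot>\<^bsub>M\<^esub> a = s \<odot>\<^bsub>M\<^esub> b \<longrightarrow> (\<exists>c\<in>carrier M. a = s \<odot>\<^bsub>M\<^esub> c))"
proof -
  interpret M: Module.module R M by fact
  have "\<exists>rs. set rs \<subseteq> carrier R - Units R \<and> regular_sequence R M rs \<and> 2 \<le> length rs"
  proof (rule ccontr)
    assume "\<not> ?thesis"
    then have "\<forall>rs. set rs \<subseteq> carrier R - Units R \<and> regular_sequence R M rs \<longrightarrow> length rs \<le> 1"
      by (metis One_nat_def not_less_eq_eq numeral_2_eq_2)
    then have "module_depth R M \<le> 1"
      unfolding module_depth_def by (intro Sup_least) (auto simp: one_enat_def)
    with depth have "(2::enat) \<le> 1"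
      by (rule order_trans)
    then show False
      by (simp add: one_enat_def numeral_eq_enat)
  qed
  then obtain s t rs where rs: "set (s # t # rs) \<subseteq> carrier R - Units R" "regular_sequence R M (s # t # rs)"
    by (metis (no_types, lifting) Suc_le_length_iff numeral_2_eq_2)
  have s: "s \<in> carrier R"
    using rs(1) by simp
  have reg: "a \<in> list_mult_module R M (take i (s # t # rs))"
    if "i < length (s # t # rs)" "a \<in> carrier M"
      "(s # t # rs) ! i \<odot>\<^bsub>M\<^esub> a \<in> list_mult_module R M (take i (s # t # rs))" for i a
    using rs(2) that unfolding regular_sequence_def by blast
  have "submodule {\<zero>\<^bsub>M\<^esub>} R M"
    by (rule M.submoduleI) auto
  then have "module_span R M {} \<subseteq> {\<zero>\<^bsub>M\<^esub>}"
    unfolding module_span_def by blast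
  moreover have "\<zero>\<^bsub>M\<^esub> \<in> module_span R M T" for T
    unfolding module_span_def using subgroup.one_closed submodule.axioms(1) by fastforce
  ultimately have zero: "list_mult_module R M [] = {\<zero>\<^bsub>M\<^esub>}"
    unfolding list_mult_module_def by auto
  define N where "N = {s \<odot>\<^bsub>M\<^esub> a | a. a \<in> carrier M}"
  have "submodule N R M"
  proof (rule M.submoduleI)
    show "N \<subseteq> carrier M"
      using s by (auto simp: N_def)
    show "\<zero>\<^bsub>M\<^esub> \<in> N"
      using s by (auto simp: N_def intro!: exI[of _ "\<zero>\<^bsub>M\<^esub>"])
    fix a assume "a \<in> N"
    then obtain b where b: "a = s \<odot>\<^bsub>M\<^esub> b" "b \<in> carrier M"
      by (auto simp: N_def)
    have "\<ominus>\<^bsub>M\<^esub> a = s \<odot>\<^bsub>M\<^esub> (\<ominus>\<^bsub>M\<^esub> b)"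
      using b s by (simp add: M.smult_r_minus)
    then show "\<ominus>\<^bsub>M\<^esub> a \<in> N"
      using b(2) unfolding N_def by blast
    {
      fix c assume "c \<in> N"
      then obtain d where d: "c = s \<odot>\<^bsub>M\<^esub> d" "d \<in> carrier M"
        by (auto simp: N_def)
      have "a \<oplus>\<^bsub>M\<^esub> c = s \<odot>\<^bsub>M\<^esub> (b \<oplus>\<^bsub>M\<^esub> d)"
        using b d s by (simp add: M.smult_r_distr)
      then show "a \<oplus>\<^bsub>M\<^esub> c \<in> N"
        using b(2) d(2) unfolding N_def by blast
    }
    fix r assume r: "r \<in> carrier R"
    have "r \<odot>\<^bsub>M\<^esub> a = s \<odot>\<^bsub>M\<^esub> (r \<odot>\<^bsub>M\<^esub> b)"
      using b s r by (simp add: M.smult_assoc1[symmetric] M.R.m_comm)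
    then show "r \<odot>\<^bsub>M\<^esub> a \<in> N"
      using b(2) r unfolding N_def by blast
  qed
  moreover have gens: "{r \<odot>\<^bsub>M\<^esub> a |r a. r \<in> set [s] \<and> a \<in> carrier M} = N"
    by (auto simp: N_def)
  ultimately have sM: "list_mult_module R M [s] = N"
    unfolding list_mult_module_def gens module_span_def by blast
  have "a = \<zero>\<^bsub>M\<^esub>" if "a \<in> carrier M" "s \<odot>\<^bsub>M\<^esub> a = \<zero>\<^bsub>M\<^esub>" for a
    using reg[of 0 a] that zero by simp
  moreover have "\<exists>c\<in>carrier M. a = s \<odot>\<^bsub>M\<^esub> c"
    if "a \<in> carrier M" "b \<in> carrier M" "t \<odot>\<^bsub>M\<^esub> a = s \<odot>\<^bsub>M\<^esub> b" for a b
  proof -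
    have "a \<in> N"
      using reg[of 1 a] that sM by (auto simp: N_def)
    then show ?thesis
      by (auto simp: N_def)
  qed
  ultimately show ?thesis
    using rs(1) by (intro exI[of _ s] exI[of _ t]) auto
qed

section \<open>Prime ideals of the ring\<close>

definition plane_prime :: "comp \<Rightarrow> 'k::field pow5 set set"
  where "plane_prime i = {r \<in> carrier cusp_ring. planes_of r i = 0}"

definition axis_prime :: "comp \<Rightarrow> 'k::field pow5 set set"
  where "axis_prime i = {r \<in> carrier cusp_ring. set_t0 (planes_of r i) = 0}"

definition origin_prime :: "'k::field pow5 set set"
  where "origin_prime = {r \<in> carrier cusp_ring. planes_of r PV $ 0 $ 0 = 0}"

lemma primeideals:
  "primeideal (plane_prime i) cusp_ring" "primeideal (axis_prime i) cusp_ring"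
  "primeideal origin_prime cusp_ring"
  unfolding plane_prime_def axis_prime_def origin_prime_def
  by (rule kernel_primeideal[OF cring_cusp_ring]; simp)+

lemma prime_chain:
  "plane_prime i \<subset> (axis_prime i :: 'k::field pow5 set set)"
  "axis_prime i \<subset> (origin_prime :: 'k::field pow5 set set)"
proof -
  have "var_s $ 0 $ 0 = (0 :: 'k)" "var_t $ 0 $ 0 = (0 :: 'k)"
    by (simp_all add: var_s_def var_t_def)
  then have in_prime: "of_planes (axis_var j) \<in> (axis_prime i :: 'k pow5 set set) \<longleftrightarrow> j \<noteq> i"
    "of_planes (axis_var j) \<in> (plane_prime i :: 'k pow5 set set) \<longleftrightarrow> j \<noteq> i \<and> i \<noteq> prev_comp j"
    "of_planes (axis_var j) \<in> (origin_prime :: 'k pow5 set set)" for j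
    by (simp_all add: axis_prime_def plane_prime_def origin_prime_def)
      (auto simp: axis_var_def)
  have "plane_prime i \<subseteq> (axis_prime i :: 'k pow5 set set)"
    by (auto simp: plane_prime_def axis_prime_def)
  then show "plane_prime i \<subset> (axis_prime i :: 'k pow5 set set)"
    \<comment> \<open>The other coordinate of the plane vanishes on the axis but not on the
      plane.\<close>
    using in_prime(1,2)[of "next_comp i"] by auto
  have "planes_of r PV $ 0 $ 0 = 0" if "r \<in> carrier cusp_ring" "set_t0 (planes_of r i) = 0" for r :: "'k pow5 set"
    using fibre_prod_const[OF planes_of_in[OF that(1)], of PV i] arg_cong[OF that(2), of "\<lambda>F. F $ 0"] by simp
  then have "axis_prime i \<subseteq> (origin_prime :: 'k pow5 set set)"
    by (auto simp: axis_prime_def origin_prime_def)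
  then show "axis_prime i \<subset> (origin_prime :: 'k pow5 set set)"
    using in_prime(1,3)[of i] by auto
qed

lemma not_maximal:
  fixes P :: "'k::field pow5 set set"
  assumes "P \<subset> origin_prime"
  shows "\<not> maximalideal P cusp_ring"
proof
  let ?m = "origin_prime :: 'k pow5 set set"
  assume max: "maximalideal P cusp_ring"
  have ideal: "ideal ?m cusp_ring"
    by (rule primeideal.axioms(1)[OF primeideals(3)])
  have sub: "?m \<subseteq> carrier cusp_ring"
    unfolding origin_prime_def by blast
  have "?m = P \<or> ?m = carrier cusp_ring"
    by (rule maximalideal.I_maximal[OF max ideal psubset_imp_subset[OF assms] sub])
  moreover have "carrier cusp_ring \<noteq> ?m"
    by (rule primeideal.I_notcarr[OF primeideals(3)])
  ultimately show False
    using assms by auto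
qed

text \<open>The chain of a plane, an axis and the origin. This bound turns maximal Cohen-Macaulay
  into depth at least two.\<close>

lemma krull_dim_cusp_ring: "2 \<le> krull_dim (cusp_ring :: 'k::field pow5 set ring)"
proof -
  define P where "P n = (if n = 0 then plane_prime PV else if n = 1 then axis_prime PV
    else (origin_prime :: 'k pow5 set set))" for n :: nat
  have "\<forall>i\<le>2. primeideal (P i) cusp_ring"
    by (simp add: P_def primeideals)
  moreover have "\<forall>i<2. P i \<subset> P (Suc i)"
    using prime_chain[of PV, where 'k = 'k] by (simp add: P_def)
  ultimately have "enat 2 \<le> krull_dim (cusp_ring :: 'k pow5 set ring)"
    unfolding krull_dim_def by (intro Sup_upper) blast
  then show ?thesis
    by (simp add: numeral_eq_enat)
qed

section \<open>Rank one modules\<close>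

lemma rank_one_generator:
  assumes M: "rank_one_cm_lf cusp_ring M" and P: "primeideal P cusp_ring" "P \<subset> origin_prime"
  shows "\<exists>e\<in>carrier M. (\<forall>a\<in>carrier M. \<exists>s\<in>carrier cusp_ring - P. \<exists>r\<in>carrier cusp_ring.
      s \<odot>\<^bsub>M\<^esub> a = r \<odot>\<^bsub>M\<^esub> e) \<and>
    (\<forall>r\<in>carrier cusp_ring. r \<odot>\<^bsub>M\<^esub> e = \<zero>\<^bsub>M\<^esub> \<longrightarrow>
      (\<exists>w\<in>carrier cusp_ring - P. w \<otimes>\<^bsub>cusp_ring\<^esub> r = \<zero>\<^bsub>cusp_ring\<^esub>))"
proof (rule module_at_prime.free_of_rank_one_generator)
  show "module_at_prime cusp_ring M P"
    using M P by (simp add: module_at_prime_def module_at_prime_axioms_def rank_one_cm_lf_def cm_lf_def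
        maximal_cohen_macaulay_def)
  show "free_module_of_rank 1 (loc_ring cusp_ring P) (loc_module cusp_ring P M)"
    using M P not_maximal by (auto simp: rank_one_cm_lf_def)
qed

text \<open>If \<open>a \<noteq> 0\<close>, then no power of \<open>s\<close> annihilates \<open>a\<close>, so some nonmaximal prime contains the
  annihilator of \<open>a\<close>; but the localization of \<open>M\<close> at this prime is free, hence torsion-free.\<close>

lemma rank_one_torsion_free:
  assumes M: "rank_one_cm_lf cusp_ring M" and c: "c \<in> carrier cusp_ring" "\<And>i. planes_of c i \<noteq> 0"
    and s: "s \<in> carrier cusp_ring - Units cusp_ring"
      "\<And>a. a \<in> carrier M \<Longrightarrow> s \<odot>\<^bsub>M\<^esub> a = \<zero>\<^bsub>M\<^esub> \<Longrightarrow> a = \<zero>\<^bsub>M\<^esub>"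
    and a: "a \<in> carrier M" "c \<odot>\<^bsub>M\<^esub> a = \<zero>\<^bsub>M\<^esub>"
  shows "a = \<zero>\<^bsub>M\<^esub>"
proof (rule ccontr)
  assume "a \<noteq> \<zero>\<^bsub>M\<^esub>"
  interpret M: Module.module cusp_ring M
    using M by (simp add: rank_one_cm_lf_def cm_lf_def maximal_cohen_macaulay_def)
  define I where "I = {r \<in> carrier cusp_ring. r \<odot>\<^bsub>M\<^esub> a = \<zero>\<^bsub>M\<^esub>}"
  have sR: "s \<in> carrier cusp_ring"
    using s(1) by simp
  have I: "ideal I cusp_ring"
  proof (rule idealI[OF cusp.ring_axioms])
    show "subgroup I (add_monoid cusp_ring)"
    proof (rule group.subgroupI[OF cusp.a_group])
      show "I \<noteq> {}"
        using a(1) by (auto simp: I_def intro!: exI[of _ "\<zero>\<^bsub>cusp_ring\<^esub>"])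
      show "inv\<^bsub>add_monoid cusp_ring\<^esub> r \<in> I" if "r \<in> I" for r
      proof -
        have "\<ominus>\<^bsub>cusp_ring\<^esub> r \<in> I"
          using that a(1) by (auto simp: I_def M.smult_l_minus)
        then show ?thesis
          unfolding a_inv_def .
      qed
      show "r \<otimes>\<^bsub>add_monoid cusp_ring\<^esub> q \<in> I" if "r \<in> I" "q \<in> I" for r q
      proof -
        have "r \<oplus>\<^bsub>cusp_ring\<^esub> q \<in> I"
          using that a(1) by (auto simp: I_def M.smult_l_distr)
        then show ?thesis
          by simp
      qed
    qed (auto simp: I_def)
    show "r \<otimes>\<^bsub>cusp_ring\<^esub> q \<in> I" if "q \<in> I" "r \<in> carrier cusp_ring" for q r
      using that a(1) by (auto simp: I_def M.smult_assoc1)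
    then show "q \<otimes>\<^bsub>cusp_ring\<^esub> r \<in> I" if "q \<in> I" "r \<in> carrier cusp_ring" for q r
      using that cusp.m_comm[of q r] by (auto simp: I_def)
  qed
  have "s [^]\<^bsub>cusp_ring\<^esub> n \<notin> I" for n :: nat
  proof (induction n)
    case 0
    show ?case
      using \<open>a \<noteq> \<zero>\<^bsub>M\<^esub>\<close> a(1) M.smult_one by (simp add: I_def)
  next
    case (Suc n)
    have *: "s [^]\<^bsub>cusp_ring\<^esub> n \<in> carrier cusp_ring"
      using sR by simp
    have "s [^]\<^bsub>cusp_ring\<^esub> Suc n \<odot>\<^bsub>M\<^esub> a = s \<odot>\<^bsub>M\<^esub> (s [^]\<^bsub>cusp_ring\<^esub> n \<odot>\<^bsub>M\<^esub> a)"
      using sR a(1) * by (simp add: M.smult_assoc1[symmetric] cusp.m_comm)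
    then show ?case
      using Suc.IH s(2)[of "s [^]\<^bsub>cusp_ring\<^esub> n \<odot>\<^bsub>M\<^esub> a"] a(1) * by (auto simp: I_def)
  qed
  then obtain Q where Q: "primeideal Q cusp_ring" "I \<subseteq> Q" "s \<notin> Q"
    using cusp.prime_avoiding_powers[OF I sR] by blast
  have "r \<in> origin_prime" if "r \<in> Q" for r
  proof -
    have ideal: "ideal Q cusp_ring"
      by (rule primeideal.axioms(1)[OF Q(1)])
    have "r \<notin> Units cusp_ring"
      using that ideal.I_l_closed[OF ideal] ideal.one_imp_carrier[OF ideal] primeideal.I_notcarr[OF Q(1)]
      by (metis cusp.Units_inv_closed cusp.Units_l_inv)
    moreover have "r \<in> carrier cusp_ring"
      using that by (rule ideal.Icarr[OF ideal])
    ultimately show ?thesis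
      using cusp_ring_nonunit_const by (auto simp: origin_prime_def)
  qed
  moreover have "s \<in> origin_prime"
    using s(1) cusp_ring_nonunit_const[OF s(1)] by (auto simp: origin_prime_def)
  ultimately have "Q \<subset> origin_prime"
    using Q(3) by auto
  from rank_one_generator[OF M Q(1) this] obtain e t r where e: "e \<in> carrier M"
    and t: "t \<in> carrier cusp_ring - Q" "r \<in> carrier cusp_ring" "t \<odot>\<^bsub>M\<^esub> a = r \<odot>\<^bsub>M\<^esub> e"
    and ann: "\<And>r. r \<in> carrier cusp_ring \<Longrightarrow> r \<odot>\<^bsub>M\<^esub> e = \<zero>\<^bsub>M\<^esub> \<Longrightarrow>
      \<exists>w\<in>carrier cusp_ring - Q. w \<otimes>\<^bsub>cusp_ring\<^esub> r = \<zero>\<^bsub>cusp_ring\<^esub>"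
    using a(1) by blast
  have tR: "t \<in> carrier cusp_ring"
    using t(1) by simp
  \<comment> \<open>Since \<open>e\<close> is torsion-free at \<open>Q\<close>, some
    \<open>w\<close> outside \<open>Q\<close> kills c r. Each plane is a domain on which
    \<open>c\<close> is nonzero, so \<open>w\<close> kills \<open>r\<close>; then w t annihilates
    \<open>a\<close> and lies in \<open>Q\<close>, against primality.\<close>
  have "(c \<otimes>\<^bsub>cusp_ring\<^esub> r) \<odot>\<^bsub>M\<^esub> e = (c \<otimes>\<^bsub>cusp_ring\<^esub> t) \<odot>\<^bsub>M\<^esub> a"
    using c(1) t(2) e a(1) tR by (simp add: M.smult_assoc1 t(3))
  also have "\<dots> = t \<odot>\<^bsub>M\<^esub> (c \<odot>\<^bsub>M\<^esub> a)"
    using c(1) a(1) tR by (simp add: M.smult_assoc1[symmetric] cusp.m_comm)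
  also have "\<dots> = \<zero>\<^bsub>M\<^esub>"
    using a(2) tR by simp
  finally obtain w where w: "w \<in> carrier cusp_ring" "w \<notin> Q"
    "w \<otimes>\<^bsub>cusp_ring\<^esub> (c \<otimes>\<^bsub>cusp_ring\<^esub> r) = \<zero>\<^bsub>cusp_ring\<^esub>"
    using ann[of "c \<otimes>\<^bsub>cusp_ring\<^esub> r"] c(1) t(2) by auto
  have "planes_of (w \<otimes>\<^bsub>cusp_ring\<^esub> (c \<otimes>\<^bsub>cusp_ring\<^esub> r)) = 0"
    unfolding w(3) by (rule planes_of_simps)
  then have "planes_of w * (planes_of c * planes_of r) = 0"
    using w(1) c(1) t(2) by simp
  then have "planes_of w i * planes_of r i = 0" for i
    using c(2)[of i] by (simp add: fun_eq_iff) metis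
  then have "planes_of (w \<otimes>\<^bsub>cusp_ring\<^esub> r) = planes_of \<zero>\<^bsub>cusp_ring\<^esub>"
    unfolding planes_of_simps(4) using w(1) t(2) by (simp add: fun_eq_iff del: mult_eq_0_iff)
  then have wr: "w \<otimes>\<^bsub>cusp_ring\<^esub> r = \<zero>\<^bsub>cusp_ring\<^esub>"
    using w(1) t(2) by (subst (asm) planes_of_eq_iff) simp_all
  have "(w \<otimes>\<^bsub>cusp_ring\<^esub> t) \<odot>\<^bsub>M\<^esub> a = (w \<otimes>\<^bsub>cusp_ring\<^esub> r) \<odot>\<^bsub>M\<^esub> e"
    using w(1) t(2) e a(1) tR by (simp add: M.smult_assoc1 t(3))
  then have "w \<otimes>\<^bsub>cusp_ring\<^esub> t \<in> Q"
    using Q(2) w(1) tR e unfolding wr by (auto simp: I_def)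
  then show False
    using primeideal.I_prime[OF Q(1) w(1) tR] w(2) t(1) by blast
qed

text \<open>The coordinate on the \<open>i\<close>-th plane is a trivialization of \<open>M\<close> at its generic point, with
  denominators cleared; local freeness and depth make the five coordinates jointly injective.\<close>

lemma rank_one_embedding:
  fixes M :: "('k::field pow5 set, 'm) module"
  assumes M: "rank_one_cm_lf cusp_ring M"
  shows "\<exists>N. planes_submodule N \<and> saturated N \<and> (\<forall>i. \<exists>e. axis_generator N i e) \<and>
    (\<forall>i. \<exists>p. p \<noteq> 0 \<and> single i p \<in> N) \<and> module_iso cusp_ring M (planes_module N)"
proof -
  let ?R = "cusp_ring :: 'k pow5 set ring"
  interpret M: Module.module ?R M
    using M by (simp add: rank_one_cm_lf_def cm_lf_def maximal_cohen_macaulay_def)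
  have fg: "finitely_generated_module ?R M"
    using M by (simp add: rank_one_cm_lf_def cm_lf_def maximal_cohen_macaulay_def)
  have plane: "plane_prime i \<subset> (origin_prime :: 'k pow5 set set)" for i
    using prime_chain[of i] by (rule psubset_trans)
  have "\<exists>e s. e \<in> carrier M \<and> s \<in> carrier ?R - plane_prime i \<and>
    (\<forall>a\<in>carrier M. \<exists>r\<in>carrier ?R. s \<odot>\<^bsub>M\<^esub> a = r \<odot>\<^bsub>M\<^esub> e) \<and>
    (\<forall>r\<in>carrier ?R. r \<odot>\<^bsub>M\<^esub> e = \<zero>\<^bsub>M\<^esub> \<longrightarrow> (\<exists>w\<in>carrier ?R - plane_prime i. w \<otimes>\<^bsub>?R\<^esub> r = \<zero>\<^bsub>?R\<^esub>))" for i
  proof -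
    have loc: "module_at_prime ?R M (plane_prime i)"
      by (intro module_at_prime.intro module_at_prime_axioms.intro M.module_axioms primeideals)
    obtain e where e: "e \<in> carrier M"
      "\<forall>a\<in>carrier M. \<exists>s\<in>carrier ?R - plane_prime i. \<exists>r\<in>carrier ?R. s \<odot>\<^bsub>M\<^esub> a = r \<odot>\<^bsub>M\<^esub> e"
      "\<forall>r\<in>carrier ?R. r \<odot>\<^bsub>M\<^esub> e = \<zero>\<^bsub>M\<^esub> \<longrightarrow> (\<exists>w\<in>carrier ?R - plane_prime i. w \<otimes>\<^bsub>?R\<^esub> r = \<zero>\<^bsub>?R\<^esub>)"
      using rank_one_generator[OF M primeideals(1) plane[of i]] by (elim bexE conjE) (rule that)
    have "\<exists>s\<in>carrier ?R - plane_prime i. \<forall>a\<in>carrier M. \<exists>r\<in>carrier ?R. s \<odot>\<^bsub>M\<^esub> a = r \<odot>\<^bsub>M\<^esub> e"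
      by (rule module_at_prime.common_denominator[OF loc fg e(1)]) (use e(2) in blast)
    then obtain s where "s \<in> carrier ?R - plane_prime i"
      "\<forall>a\<in>carrier M. \<exists>r\<in>carrier ?R. s \<odot>\<^bsub>M\<^esub> a = r \<odot>\<^bsub>M\<^esub> e"
      by (elim bexE) (rule that)
    with e(1,3) show ?thesis
      by (intro exI[of _ e] exI[of _ s] conjI)
  qed
  then have "\<forall>i. \<exists>es. fst es \<in> carrier M \<and> snd es \<in> carrier ?R - plane_prime i \<and>
    (\<forall>a\<in>carrier M. \<exists>r\<in>carrier ?R. snd es \<odot>\<^bsub>M\<^esub> a = r \<odot>\<^bsub>M\<^esub> fst es) \<and>
    (\<forall>r\<in>carrier ?R. r \<odot>\<^bsub>M\<^esub> fst es = \<zero>\<^bsub>M\<^esub> \<longrightarrow> (\<exists>w\<in>carrier ?R - plane_prime i. w \<otimes>\<^bsub>?R\<^esub> r = \<zero>\<^bsub>?R\<^esub>))"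
    by simp
  from choice[OF this] obtain es where "\<forall>i. fst (es i) \<in> carrier M \<and> snd (es i) \<in> carrier ?R - plane_prime i \<and>
    (\<forall>a\<in>carrier M. \<exists>r\<in>carrier ?R. snd (es i) \<odot>\<^bsub>M\<^esub> a = r \<odot>\<^bsub>M\<^esub> fst (es i)) \<and>
    (\<forall>r\<in>carrier ?R. r \<odot>\<^bsub>M\<^esub> fst (es i) = \<zero>\<^bsub>M\<^esub> \<longrightarrow>
      (\<exists>w\<in>carrier ?R - plane_prime i. w \<otimes>\<^bsub>?R\<^esub> r = \<zero>\<^bsub>?R\<^esub>))" ..
  then have es: "\<And>i. fst (es i) \<in> carrier M"
    "\<And>i. snd (es i) \<in> carrier ?R - plane_prime i"
    "\<And>i a. a \<in> carrier M \<Longrightarrow> \<exists>r\<in>carrier ?R. snd (es i) \<odot>\<^bsub>M\<^esub> a = r \<odot>\<^bsub>M\<^esub> fst (es i)"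
    "\<And>i r. r \<in> carrier ?R \<Longrightarrow> r \<odot>\<^bsub>M\<^esub> fst (es i) = \<zero>\<^bsub>M\<^esub> \<Longrightarrow>
      \<exists>w\<in>carrier ?R - plane_prime i. w \<otimes>\<^bsub>?R\<^esub> r = \<zero>\<^bsub>?R\<^esub>"
    by simp_all
  define e where "e i = fst (es i)" for i
  define \<delta> where "\<delta> i = snd (es i)" for i
  have e: "e i \<in> carrier M" and \<delta>: "\<delta> i \<in> carrier ?R" "planes_of (\<delta> i) i \<noteq> 0" for i
    using es(1,2)[of i] by (simp_all add: e_def \<delta>_def plane_prime_def)
  have ann: "planes_of r i = 0" if r: "r \<in> carrier ?R" "r \<odot>\<^bsub>M\<^esub> e i = \<zero>\<^bsub>M\<^esub>" for r i
  proof -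
    obtain w where w: "w \<in> carrier ?R" "planes_of w i \<noteq> 0" "w \<otimes>\<^bsub>?R\<^esub> r = \<zero>\<^bsub>?R\<^esub>"
      using es(4)[of r i] r by (auto simp: e_def plane_prime_def)
    have "planes_of (w \<otimes>\<^bsub>?R\<^esub> r) = 0"
      unfolding w(3) by (rule planes_of_simps)
    then have "planes_of w * planes_of r = 0"
      using w(1) r(1) by simp
    from fun_cong[OF this, of i] show ?thesis
      using w(2) by simp
  qed
  \<comment> \<open>The chosen numerator is arbitrary, but by \<open>ann\<close> its value on the
    plane \<open>i\<close> is not; only this value enters \<phi>.\<close>
  define coord where "coord i a = (SOME r. r \<in> carrier ?R \<and> \<delta> i \<odot>\<^bsub>M\<^esub> a = r \<odot>\<^bsub>M\<^esub> e i)" for i a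
  define \<phi> where "\<phi> a = (\<lambda>i. planes_of (coord i a) i)" for a
  have coord: "coord i a \<in> carrier ?R" "\<delta> i \<odot>\<^bsub>M\<^esub> a = coord i a \<odot>\<^bsub>M\<^esub> e i"
    if "a \<in> carrier M" for i a
  proof -
    have "\<exists>r. r \<in> carrier ?R \<and> \<delta> i \<odot>\<^bsub>M\<^esub> a = r \<odot>\<^bsub>M\<^esub> e i"
      using es(3)[OF that, of i] by (auto simp: e_def \<delta>_def)
    from someI_ex[OF this] show "coord i a \<in> carrier ?R" "\<delta> i \<odot>\<^bsub>M\<^esub> a = coord i a \<odot>\<^bsub>M\<^esub> e i"
      by (auto simp: coord_def)
  qed
  have \<phi>_eq: "\<phi> a i = planes_of r i"
    if a: "a \<in> carrier M" and r: "r \<in> carrier ?R" "\<delta> i \<odot>\<^bsub>M\<^esub> a = r \<odot>\<^bsub>M\<^esub> e i" for a r i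
  proof -
    have "(coord i a \<oplus>\<^bsub>?R\<^esub> \<ominus>\<^bsub>?R\<^esub> r) \<odot>\<^bsub>M\<^esub> e i = \<zero>\<^bsub>M\<^esub>"
      using a r coord[OF a, of i] e[of i]
      by (simp add: M.smult_l_distr M.smult_l_minus M.M.r_neg)
    from ann[OF _ this] have "planes_of (coord i a) i - planes_of r i = 0"
      using coord(1)[OF a, of i] r(1) by simp
    then show ?thesis
      by (simp add: \<phi>_def)
  qed
  have \<phi>_add: "\<phi> (a \<oplus>\<^bsub>M\<^esub> b) = \<phi> a + \<phi> b" if a: "a \<in> carrier M" and b: "b \<in> carrier M" for a b
  proof
    fix i
    have "\<delta> i \<odot>\<^bsub>M\<^esub> (a \<oplus>\<^bsub>M\<^esub> b) = (coord i a \<oplus>\<^bsub>?R\<^esub> coord i b) \<odot>\<^bsub>M\<^esub> e i"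
      using a b coord[OF a, of i] coord[OF b, of i] e[of i] \<delta>(1)[of i]
      by (simp add: M.smult_l_distr M.smult_r_distr)
    then have "\<phi> (a \<oplus>\<^bsub>M\<^esub> b) i = planes_of (coord i a \<oplus>\<^bsub>?R\<^esub> coord i b) i"
      using a b coord(1) by (intro \<phi>_eq) auto
    then show "\<phi> (a \<oplus>\<^bsub>M\<^esub> b) i = (\<phi> a + \<phi> b) i"
      using coord(1)[OF a] coord(1)[OF b] by (simp add: \<phi>_def)
  qed
  have \<phi>_smult: "\<phi> (r \<odot>\<^bsub>M\<^esub> a) = planes_of r * \<phi> a" if r: "r \<in> carrier ?R" and a: "a \<in> carrier M" for r a
  proof
    fix i
    have "\<delta> i \<odot>\<^bsub>M\<^esub> (r \<odot>\<^bsub>M\<^esub> a) = r \<odot>\<^bsub>M\<^esub> (\<delta> i \<odot>\<^bsub>M\<^esub> a)"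
      using a r \<delta>(1)[of i] by (simp add: M.smult_assoc1[symmetric] cusp.m_comm)
    also have "\<dots> = (r \<otimes>\<^bsub>?R\<^esub> coord i a) \<odot>\<^bsub>M\<^esub> e i"
      using a r coord[OF a, of i] e[of i] by (simp add: M.smult_assoc1)
    finally have "\<phi> (r \<odot>\<^bsub>M\<^esub> a) i = planes_of (r \<otimes>\<^bsub>?R\<^esub> coord i a) i"
      using a r coord(1) by (intro \<phi>_eq) auto
    then show "\<phi> (r \<odot>\<^bsub>M\<^esub> a) i = (planes_of r * \<phi> a) i"
      using r coord(1)[OF a] by (simp add: \<phi>_def)
  qed
  have \<phi>_e: "\<phi> (e i) i \<noteq> 0" for i
    using \<phi>_eq[OF e \<delta>(1) refl, of i] \<delta>(2)[of i] by simp
  define N where "N = \<phi> ` carrier M"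
  have N: "planes_submodule N"
    unfolding planes_submodule_def
  proof (intro conjI ballI)
    fix g h assume "g \<in> N" "h \<in> N"
    then obtain a b where "a \<in> carrier M" "b \<in> carrier M" "g = \<phi> a" "h = \<phi> b"
      by (auto simp: N_def)
    then show "g + h \<in> N"
      unfolding N_def by (intro image_eqI[of _ _ "a \<oplus>\<^bsub>M\<^esub> b"]) (simp_all add: \<phi>_add)
  next
    fix c g :: "'k planes" assume "c \<in> fibre_prod" "g \<in> N"
    moreover then obtain a where "a \<in> carrier M" "g = \<phi> a"
      by (auto simp: N_def)
    ultimately show "c * g \<in> N"
      unfolding N_def by (intro image_eqI[of _ _ "of_planes c \<odot>\<^bsub>M\<^esub> a"]) (simp_all add: \<phi>_smult)
  qed
  have nz: "\<exists>p. p \<noteq> 0 \<and> single i p \<in> N" for i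
  proof -
    have "single i (var_s * var_t * \<phi> (e i) i) = corner i * \<phi> (e i)"
      by (auto simp: single_def corner_def fun_eq_iff)
    moreover have "\<phi> (e i) \<in> N"
      using e by (simp add: N_def)
    ultimately have "single i (var_s * var_t * \<phi> (e i) i) \<in> N"
      using N by (simp add: planes_submodule_def)
    moreover have "var_s * var_t * \<phi> (e i) i \<noteq> 0"
      by (simp add: \<phi>_e)
    ultimately show ?thesis
      by blast
  qed
  \<comment> \<open>The zero module counts as maximal Cohen-Macaulay without any condition on depth,
    so it has to be excluded first.\<close>
  have "carrier M \<noteq> {\<zero>\<^bsub>M\<^esub>}"
  proof
    assume "carrier M = {\<zero>\<^bsub>M\<^esub>}"
    then have "\<one>\<^bsub>?R\<^esub> \<odot>\<^bsub>M\<^esub> e PV = \<zero>\<^bsub>M\<^esub>"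
      using e[of PV] M.smult_one[OF e[of PV]] by simp
    from ann[OF cusp.one_closed this] show False
      unfolding planes_of_simps by simp
  qed
  then have "2 \<le> module_depth ?R M"
    using M krull_dim_cusp_ring[where 'k = 'k]
    by (simp add: rank_one_cm_lf_def cm_lf_def maximal_cohen_macaulay_def)
  from depth_ge_2[OF M.module_axioms this] obtain s t where
    s: "s \<in> carrier ?R - Units ?R" and t: "t \<in> carrier ?R - Units ?R"
    and reg_s: "\<And>a. a \<in> carrier M \<Longrightarrow> s \<odot>\<^bsub>M\<^esub> a = \<zero>\<^bsub>M\<^esub> \<Longrightarrow> a = \<zero>\<^bsub>M\<^esub>"
    and reg_t: "\<And>a b. a \<in> carrier M \<Longrightarrow> b \<in> carrier M \<Longrightarrow> t \<odot>\<^bsub>M\<^esub> a = s \<odot>\<^bsub>M\<^esub> b \<Longrightarrow>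
      \<exists>c\<in>carrier M. a = s \<odot>\<^bsub>M\<^esub> c"
    by blast
  have sR: "s \<in> carrier ?R" and tR: "t \<in> carrier ?R"
    using s t by simp_all
  have \<phi>_0: "a = \<zero>\<^bsub>M\<^esub>" if a: "a \<in> carrier M" "\<phi> a = 0" for a
  proof -
    \<comment> \<open>The corner restricts \<delta> to a single plane, and there the coordinate of
      \<open>a\<close> is zero. The sum of the \<open>d i\<close> then annihilates \<open>a\<close>
      and is nonzero on every plane.\<close>
    define d where "d i = of_planes (corner i) \<otimes>\<^bsub>?R\<^esub> \<delta> i" for i :: comp
    have d: "d i \<in> carrier ?R" "planes_of (d i) = corner i * planes_of (\<delta> i)" for i
      using \<delta>(1)[of i] by (simp_all add: d_def)
    have da: "d i \<odot>\<^bsub>M\<^esub> a = \<zero>\<^bsub>M\<^esub>" for i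
    proof -
      have "planes_of (of_planes (corner i) \<otimes>\<^bsub>?R\<^esub> coord i a) = corner i * planes_of (coord i a)"
        using coord(1)[OF a(1)] by simp
      also have "\<dots> = planes_of \<zero>\<^bsub>?R\<^esub>"
        unfolding planes_of_simps using fun_cong[OF a(2), of i] by (auto simp: fun_eq_iff corner_def \<phi>_def)
      finally have 0: "of_planes (corner i) \<otimes>\<^bsub>?R\<^esub> coord i a = \<zero>\<^bsub>?R\<^esub>"
        using coord(1)[OF a(1)] by (subst (asm) planes_of_eq_iff) simp_all
      have "d i \<odot>\<^bsub>M\<^esub> a = (of_planes (corner i) \<otimes>\<^bsub>?R\<^esub> coord i a) \<odot>\<^bsub>M\<^esub> e i"
        using coord[OF a(1), of i] \<delta>(1)[of i] e[of i] a(1) by (simp add: d_def M.smult_assoc1)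
      then show ?thesis
        unfolding 0 using e[of i] by (simp)
    qed
    define c where "c = d PV \<oplus>\<^bsub>?R\<^esub> (d PX \<oplus>\<^bsub>?R\<^esub> (d PY \<oplus>\<^bsub>?R\<^esub> (d PZ \<oplus>\<^bsub>?R\<^esub> d PU)))"
    show ?thesis
    proof (rule rank_one_torsion_free[OF M _ _ s reg_s a(1)])
      show "c \<in> carrier ?R" "c \<odot>\<^bsub>M\<^esub> a = \<zero>\<^bsub>M\<^esub>"
        using d(1) da a(1) by (simp_all add: c_def M.smult_l_distr)
      show "planes_of c i \<noteq> 0" for i
        using d \<delta>(2)[of i] by (cases i) (simp_all add: c_def corner_def)
    qed
  qed
  have inj: "inj_on \<phi> (carrier M)"
  proof (rule inj_onI)
    fix a b assume ab: "a \<in> carrier M" "b \<in> carrier M" "\<phi> a = \<phi> b"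
    have "\<phi> (\<ominus>\<^bsub>M\<^esub> b) + \<phi> b = \<phi> \<zero>\<^bsub>M\<^esub>"
      using ab by (simp add: \<phi>_add[symmetric] M.M.l_neg)
    moreover have "\<phi> \<zero>\<^bsub>M\<^esub> = 0"
      using \<phi>_add[of "\<zero>\<^bsub>M\<^esub>" "\<zero>\<^bsub>M\<^esub>"] by simp
    ultimately have "\<phi> (a \<oplus>\<^bsub>M\<^esub> \<ominus>\<^bsub>M\<^esub> b) = 0"
      using ab by (simp add: \<phi>_add add.commute)
    then have "a \<oplus>\<^bsub>M\<^esub> \<ominus>\<^bsub>M\<^esub> b = \<zero>\<^bsub>M\<^esub>"
      using ab by (intro \<phi>_0) auto
    then show "a = b"
      using ab M.M.minus_equality[of a "\<ominus>\<^bsub>M\<^esub> b"] by simp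
  qed
  \<comment> \<open>Otherwise \<open>s\<close> would kill a nonzero element of the module supported
    on the plane \<open>i\<close>.\<close>
  have s_nz: "planes_of s i \<noteq> 0" for i
  proof
    assume s0: "planes_of s i = 0"
    obtain p where p: "p \<noteq> 0" "single i p \<in> N"
      using nz by blast
    then obtain a where a: "a \<in> carrier M" "\<phi> a = single i p"
      by (auto simp: N_def)
    have "\<phi> (s \<odot>\<^bsub>M\<^esub> a) = 0"
      using a sR s0 by (auto simp: \<phi>_smult single_def fun_eq_iff)
    then have "s \<odot>\<^bsub>M\<^esub> a = \<zero>\<^bsub>M\<^esub>"
      using a sR by (intro \<phi>_0) auto
    then have "a = \<zero>\<^bsub>M\<^esub>"
      by (rule reg_s[OF a(1)])
    then have "\<phi> a = 0"
      using \<phi>_add[of "\<zero>\<^bsub>M\<^esub>" "\<zero>\<^bsub>M\<^esub>"] by simp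
    from fun_cong[OF this, of i] show False
      using a(2) p(1) by (simp add: single_def)
  qed
  have "saturated N"
    unfolding saturated_def
  proof (intro allI impI)
    fix w assume w: "\<forall>i. axis_var i * w \<in> N"
    have max: "planes_of r * w \<in> N" if r: "r \<in> carrier ?R - Units ?R" for r
    proof -
      have "planes_of r \<in> fibre_prod"
        using r by simp
      from fibre_prod_decomp[OF this cusp_ring_nonunit_const[OF r]] obtain c where
        c: "\<And>j. c j \<in> fibre_prod" "planes_of r = axis_var PX * c PX + axis_var PY * c PY
          + axis_var PZ * c PZ + axis_var PU * c PU + axis_var PV * c PV"
        by blast
      have add: "g + h \<in> N" if "g \<in> N" "h \<in> N" for g h
        using that N by (simp add: planes_submodule_def)
      have "axis_var j * c j * w \<in> N" for j
      proof -
        have "c j * (axis_var j * w) \<in> N"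
          using w c(1) N by (simp add: planes_submodule_def)
        then show ?thesis
          by (simp add: ac_simps)
      qed
      then show ?thesis
        unfolding c(2) by (simp only: distrib_right add)
    qed
    obtain a b where a: "a \<in> carrier M" "planes_of s * w = \<phi> a" and b: "b \<in> carrier M" "planes_of t * w = \<phi> b"
      using max[OF s] max[OF t] by (auto simp: N_def)
    \<comment> \<open>The products of \<open>w\<close> with \<open>s\<close> and \<open>t\<close>
      come from \<open>a\<close> and \<open>b\<close>. Regularity of \<open>t\<close> modulo
      \<open>s\<close> shows that \<open>a\<close> is a multiple of \<open>s\<close>, and cancelling
      \<open>s\<close> puts \<open>w\<close> in the image.\<close>
    have "\<phi> (t \<odot>\<^bsub>M\<^esub> a) = planes_of t * (planes_of s * w)"
      using a tR by (simp add: \<phi>_smult)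
    also have "\<dots> = planes_of s * (planes_of t * w)"
      by (rule mult.left_commute)
    also have "\<dots> = \<phi> (s \<odot>\<^bsub>M\<^esub> b)"
      using b sR by (simp add: \<phi>_smult)
    finally have "t \<odot>\<^bsub>M\<^esub> a = s \<odot>\<^bsub>M\<^esub> b"
      using inj a(1) b(1) sR tR by (auto dest: inj_onD)
    then obtain c where c: "c \<in> carrier M" "a = s \<odot>\<^bsub>M\<^esub> c"
      using reg_t a(1) b(1) by blast
    have "planes_of s * w = planes_of s * \<phi> c"
      using c sR by (simp add: a(2) \<phi>_smult)
    then have "w = \<phi> c"
      using s_nz by (simp add: fun_eq_iff)
    then show "w \<in> N"
      using c(1) by (simp add: N_def)
  qed
  moreover have "\<exists>g. axis_generator N i g" for i
  proof -
    obtain m where m: "m \<in> carrier M"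
      "\<forall>a\<in>carrier M. \<exists>s\<in>carrier ?R - axis_prime i. \<exists>r\<in>carrier ?R. s \<odot>\<^bsub>M\<^esub> a = r \<odot>\<^bsub>M\<^esub> m"
      using rank_one_generator[OF M primeideals(2) prime_chain(2)[of i]] by (elim bexE conjE) (rule that)
    have "axis_generator N i (\<phi> m)"
      unfolding axis_generator_def
    proof (intro conjI ballI)
      show "\<phi> m \<in> N"
        using m(1) by (simp add: N_def)
      fix g assume "g \<in> N"
      then obtain a where a: "a \<in> carrier M" "g = \<phi> a"
        by (auto simp: N_def)
      obtain q r where q: "q \<in> carrier ?R - axis_prime i" and r: "r \<in> carrier ?R"
        and qa: "q \<odot>\<^bsub>M\<^esub> a = r \<odot>\<^bsub>M\<^esub> m"
        using m(2)[rule_format, OF a(1)] by (elim bexE) (rule that)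
      have "planes_of q * \<phi> a = planes_of r * \<phi> m"
        using arg_cong[OF qa, of \<phi>] q r a m(1) by (simp add: \<phi>_smult)
      then show "\<exists>c\<in>fibre_prod. \<exists>d\<in>fibre_prod. set_t0 (c i) \<noteq> 0 \<and> c * g = d * \<phi> m"
        using q r a(2) by (intro bexI[of _ "planes_of q"] bexI[of _ "planes_of r"]) (auto simp: axis_prime_def)
    qed
    then show ?thesis
      by blast
  qed
  moreover have "\<phi> \<in> module_hom ?R M (planes_module N)"
    by (auto simp: module_hom_def N_def \<phi>_add \<phi>_smult)
  then have "module_iso ?R M (planes_module N)"
    using inj by (auto simp: module_iso_def bij_betw_def N_def)
  ultimately show ?thesis
    using N nz by blast
qed

lemma rank_one_iso_cusp_module:
  fixes M :: "('k::field pow5 set, 'm) module"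
  assumes "rank_one_cm_lf cusp_ring M"
  shows "\<exists>w (c :: 'k). normalized_weight w \<and> c \<noteq> 0 \<and> module_iso cusp_ring M (cusp_module w c)"
proof -
  obtain N where N: "planes_submodule N" "saturated N" "\<forall>i. \<exists>e. axis_generator N i e"
    "\<forall>i. \<exists>p. p \<noteq> 0 \<and> single i p \<in> N" and iso: "module_iso cusp_ring M (planes_module N)"
    using rank_one_embedding[OF assms] by (elim exE conjE) (rule that)
  obtain w and c :: 'k where w: "normalized_weight w" "c \<noteq> 0"
    "module_iso cusp_ring (planes_module N) (planes_module (glued (glue1 w) (glue2 w c)))"
    using saturated_classification[OF N(1,2) N(3)[rule_format] N(4)[rule_format]]
    by (elim exE conjE) (rule that)
  have "module_iso cusp_ring M (cusp_module w c)"
    by (rule module_iso_trans[OF iso module_iso_trans[OF w(3) cusp_module_iso_glued[OF w(1,2)]]])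
  with w(1,2) show ?thesis
    by (intro exI[of _ w] exI[of _ c] conjI)
qed

theorem proposition8p11:
  shows "(\<forall>M :: ('k::field pow5 set, 'm) module. rank_one_cm_lf cusp_ring M \<longrightarrow>
            (\<exists>w (c :: 'k). normalized_weight w \<and> c \<noteq> 0 \<and>
               module_iso cusp_ring M (cusp_module w c))) \<and>
         (\<forall>w w' (c :: 'k) c'. normalized_weight w \<longrightarrow> normalized_weight w' \<longrightarrow> c \<noteq> 0 \<longrightarrow> c' \<noteq> 0 \<longrightarrow>
            (module_iso cusp_ring (cusp_module w c) (cusp_module w' c') \<longleftrightarrow> w = w' \<and> c = c'))"
  by (intro conjI allI impI) (erule rank_one_iso_cusp_module, rule cusp_module_iso_iff)

end
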